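(* Let $\mathbb{K}$ be a field, $n\ge 1$, and let $K_n=K_{n,\Gamma}^{P,Q}(\mathbb{K})$ be the algebra defined in the context. Suppose that $q_i=1$ and that $p_i$ is not a root of unity for every $1\le i\le n$. If $M$ is a nonzero finitely generated (right) $K_n$-module that is not a $\mathscr{Z}$-torsion module, then $$\operatorname{GK-dim}(M)\ \ge\ n-1=\frac{\operatorname{GK-dim}(K_n)}{2}-1.$$
   Context: Definition of $K_n$: let $P=(p_1,\ldots,p_n)$ and $Q=(q_1,\ldots,q_n)$ be $n$-tuples of elements of $\mathbb{K}^*$ with $p_i\ne q_i$ for all $i$, and let $\Gamma=(\gamma_{ij})$ be a multiplicatively antisymmetric $n\times n$ matrix over $\mathbb{K}$ (that is, $\gamma_{ii}=1$ and $\gamma_{ij}\gamma_{ji}=1$ for all $i,j$). The algebra $K_n=K_{n,\Gamma}^{P,Q}(\mathbb{K})$ is the $\mathbb{K}$-algebra generated by $x_1,y_1,\ldots,x_n,y_n$ subject to the relations $x_ix_j=q_ip_j^{-1}\gamma_{ij}x_jx_i$ for $i<j$; $y_iy_j=\gamma_{ij}y_jy_i$ for $i<j$; $x_iy_j=p_j\gamma_{ij}^{-1}y_jx_i$ for $i<j$; $x_iy_j=q_j\gamma_{ij}^{-1}y_jx_i$ for $i>j$; $x_iy_i-q_iy_ix_i=\sum_{l=1}^{i-1}(q_l-p_l)y_lx_l$ for all $i$. It is an affine noetherian domain. The elements $z_i:=\sum_{l\le i}(q_l-p_l)y_lx_l$ ($1\le i\le n$) are normal in $K_n$ and commute with each other,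 and $\mathscr{Z}:=\{z_1^{j_1}\cdots z_n^{j_n}: j_i\in\mathbb{Z}_{\ge 0}\}$ is an Ore set in $K_n$. A module $M$ is $\mathscr{Z}$-torsion if every $m\in M$ satisfies $ms=0$ for some $s\in\mathscr{Z}$. $\operatorname{GK-dim}$ denotes Gelfand--Kirillov dimension over $\mathbb{K}$. *)

theory Defs
  imports
    "HOL-Library.Poly_Mapping"
    "HOL-Library.Liminf_Limsup"
    "HOL-Library.Extended_Real"
    "HOL-Algebra.QuotRing"
    "Jordan_Normal_Form.VS_Connect"
begin

section \<open>Free algebras on the generators $x_1,y_1,\dots,x_n,y_n$\<close>

datatype gen = X nat | Y nat

datatype gword = GWord (letters: "gen list")

instantiation gword :: monoid_add
begin
definition zero_gword :: gword where "0 = GWord []"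
definition plus_gword :: "gword \<Rightarrow> gword \<Rightarrow> gword"
  where "u + v = GWord (letters u @ letters v)"
instance
  by standard (simp_all add: zero_gword_def plus_gword_def)
end

text \<open>
  The monoid of words is written additively, so the convolution product of
  \<^typ>\<open>gword \<Rightarrow>\<^sub>0 'k\<close> is the product of the free algebra on all generators
  \<^term>\<open>X i\<close>, \<^term>\<open>Y i\<close>; \<open>free_alg n\<close> is the subalgebra on those with index in $1,\dots,n$.
\<close>

type_synonym 'k ncpoly = "gword \<Rightarrow>\<^sub>0 'k"

definition gens :: "nat \<Rightarrow> gen set"
  where "gens n = X ` {1..n} \<union> Y ` {1..n}"

definition free_alg :: "nat \<Rightarrow> 'k::field ncpoly ring"
  where "free_alg n =
    \<lparr>carrier = {f. \<forall>w\<in>Poly_Mapping.keys f. set (letters w) \<subseteq> gens n},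
     mult = (*), one = 1, zero = 0, add = (+)\<rparr>"

abbreviation scal :: "'k::field \<Rightarrow> 'k ncpoly"
  where "scal c \<equiv> Poly_Mapping.single 0 c"

abbreviation fx :: "nat \<Rightarrow> 'k::field ncpoly"
  where "fx i \<equiv> Poly_Mapping.single (GWord [X i]) 1"

abbreviation fy :: "nat \<Rightarrow> 'k::field ncpoly"
  where "fy i \<equiv> Poly_Mapping.single (GWord [Y i]) 1"

section \<open>The algebra $K_{n,\Gamma}^{P,Q}(\mathbb K)$\<close>

definition Kn_data ::
  "nat \<Rightarrow> (nat \<Rightarrow> 'k::field) \<Rightarrow> (nat \<Rightarrow> 'k) \<Rightarrow> (nat \<Rightarrow> nat \<Rightarrow> 'k) \<Rightarrow> bool"
  where "Kn_data n p q \<gamma> \<longleftrightarrow>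
    (\<forall>i\<in>{1..n}. p i \<noteq> 0 \<and> q i \<noteq> 0 \<and> p i \<noteq> q i) \<and>
    (\<forall>i\<in>{1..n}. \<gamma> i i = 1) \<and>
    (\<forall>i\<in>{1..n}. \<forall>j\<in>{1..n}. \<gamma> i j * \<gamma> j i = 1)"

definition Kn_relators ::
  "nat \<Rightarrow> (nat \<Rightarrow> 'k::field) \<Rightarrow> (nat \<Rightarrow> 'k) \<Rightarrow> (nat \<Rightarrow> nat \<Rightarrow> 'k) \<Rightarrow> 'k ncpoly set"
  where "Kn_relators n p q \<gamma> =
    {fx i * fx j - scal (q i * inverse (p j) * \<gamma> i j) * fx j * fx i | i j.
       i \<in> {1..n} \<and> j \<in> {1..n} \<and> i < j} \<union>
    {fy i * fy j - scal (\<gamma> i j) * fy j * fy i | i j.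
       i \<in> {1..n} \<and> j \<in> {1..n} \<and> i < j} \<union>
    {fx i * fy j - scal (p j * inverse (\<gamma> i j)) * fy j * fx i | i j.
       i \<in> {1..n} \<and> j \<in> {1..n} \<and> i < j} \<union>
    {fx i * fy j - scal (q j * inverse (\<gamma> i j)) * fy j * fx i | i j.
       i \<in> {1..n} \<and> j \<in> {1..n} \<and> i > j} \<union>
    {fx i * fy i - scal (q i) * fy i * fx i
       - (\<Sum>l\<in>{1..<i}. scal (q l - p l) * fy l * fx l) | i. i \<in> {1..n}}"

definition Kn_ideal ::
  "nat \<Rightarrow> (nat \<Rightarrow> 'k::field) \<Rightarrow> (nat \<Rightarrow> 'k) \<Rightarrow> (nat \<Rightarrow> nat \<Rightarrow> 'k) \<Rightarrow> 'k ncpoly set"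
  where "Kn_ideal n p q \<gamma> = Idl\<^bsub>free_alg n\<^esub> (Kn_relators n p q \<gamma>)"

text \<open>The quotient ring, with its scalar multiplication added as a further record field.\<close>

definition Kn ::
  "nat \<Rightarrow> (nat \<Rightarrow> 'k::field) \<Rightarrow> (nat \<Rightarrow> 'k) \<Rightarrow> (nat \<Rightarrow> nat \<Rightarrow> 'k) \<Rightarrow>
    ('k, 'k ncpoly set) module"
  where "Kn n p q \<gamma> =
    (let I = Kn_ideal n p q \<gamma>; A = free_alg n Quot I in
     ring.extend A (module.fields (\<lambda>c a. (I +>\<^bsub>free_alg n\<^esub> scal c) \<otimes>\<^bsub>A\<^esub> a)))"

definition Kn_x ::
  "nat \<Rightarrow> (nat \<Rightarrow> 'k::field) \<Rightarrow> (nat \<Rightarrow> 'k) \<Rightarrow> (nat \<Rightarrow> nat \<Rightarrow> 'k) \<Rightarrow> nat \<Rightarrow> 'k ncpoly set"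
  where "Kn_x n p q \<gamma> i = Kn_ideal n p q \<gamma> +>\<^bsub>free_alg n\<^esub> fx i"

definition Kn_y ::
  "nat \<Rightarrow> (nat \<Rightarrow> 'k::field) \<Rightarrow> (nat \<Rightarrow> 'k) \<Rightarrow> (nat \<Rightarrow> nat \<Rightarrow> 'k) \<Rightarrow> nat \<Rightarrow> 'k ncpoly set"
  where "Kn_y n p q \<gamma> i = Kn_ideal n p q \<gamma> +>\<^bsub>free_alg n\<^esub> fy i"

definition Kn_z ::
  "nat \<Rightarrow> (nat \<Rightarrow> 'k::field) \<Rightarrow> (nat \<Rightarrow> 'k) \<Rightarrow> (nat \<Rightarrow> nat \<Rightarrow> 'k) \<Rightarrow> nat \<Rightarrow> 'k ncpoly set"
  where "Kn_z n p q \<gamma> i =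
    (\<Oplus>\<^bsub>Kn n p q \<gamma>\<^esub>l\<in>{1..i}.
       (q l - p l) \<odot>\<^bsub>Kn n p q \<gamma>\<^esub> (Kn_y n p q \<gamma> l \<otimes>\<^bsub>Kn n p q \<gamma>\<^esub> Kn_x n p q \<gamma> l))"

text \<open>\<open>ordered_monomial A z j m\<close> is $z_1^{j_1}\cdots z_m^{j_m}$, multiplied in this order.\<close>

primrec ordered_monomial ::
  "('a, 'b) monoid_scheme \<Rightarrow> (nat \<Rightarrow> 'a) \<Rightarrow> (nat \<Rightarrow> nat) \<Rightarrow> nat \<Rightarrow> 'a"
  where
    "ordered_monomial A z j 0 = \<one>\<^bsub>A\<^esub>"
  | "ordered_monomial A z j (Suc m) =
       ordered_monomial A z j m \<otimes>\<^bsub>A\<^esub> (z (Suc m) [^]\<^bsub>A\<^esub> j (Suc m))"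

definition Kn_Z ::
  "nat \<Rightarrow> (nat \<Rightarrow> 'k::field) \<Rightarrow> (nat \<Rightarrow> 'k) \<Rightarrow> (nat \<Rightarrow> nat \<Rightarrow> 'k) \<Rightarrow> 'k ncpoly set set"
  where "Kn_Z n p q \<gamma> = {ordered_monomial (Kn n p q \<gamma>) (Kn_z n p q \<gamma>) j n | j. True}"

section \<open>Right modules\<close>

record ('a, 'm) right_module = "'m ring" +
  ract :: "'m \<Rightarrow> 'a \<Rightarrow> 'm" (infixl \<open>\<triangleleft>\<index>\<close> 70)

text \<open>
  As in the library locale \<^locale>\<open>abelian_group\<close>, the fields \<open>mult\<close> and \<open>one\<close> of \<open>M\<close> are unused.
\<close>

locale right_module = A?: ring A + M?: abelian_group M
  for A :: "('a, 'x) ring_scheme" and M :: "('a, 'm, 'e) right_module_scheme" (structure) +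
  assumes ract_closed:
      "\<lbrakk>m \<in> carrier M; a \<in> carrier A\<rbrakk> \<Longrightarrow> m \<triangleleft> a \<in> carrier M"
    and ract_add_left:
      "\<lbrakk>m \<in> carrier M; m' \<in> carrier M; a \<in> carrier A\<rbrakk> \<Longrightarrow>
        (m \<oplus>\<^bsub>M\<^esub> m') \<triangleleft> a = (m \<triangleleft> a) \<oplus>\<^bsub>M\<^esub> (m' \<triangleleft> a)"
    and ract_add_right:
      "\<lbrakk>m \<in> carrier M; a \<in> carrier A; b \<in> carrier A\<rbrakk> \<Longrightarrow>
        m \<triangleleft> (a \<oplus>\<^bsub>A\<^esub> b) = (m \<triangleleft> a) \<oplus>\<^bsub>M\<^esub> (m \<triangleleft> b)"
    and ract_mult:
      "\<lbrakk>m \<in> carrier M; a \<in> carrier A; b \<in> carrier A\<rbrakk> \<Longrightarrow>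
        m \<triangleleft> (a \<otimes>\<^bsub>A\<^esub> b) = (m \<triangleleft> a) \<triangleleft> b"
    and ract_one:
      "m \<in> carrier M \<Longrightarrow> m \<triangleleft> \<one>\<^bsub>A\<^esub> = m"

definition right_submodule ::
  "('a, 'x) ring_scheme \<Rightarrow> ('a, 'm, 'e) right_module_scheme \<Rightarrow> 'm set \<Rightarrow> bool"
  where "right_submodule A M N \<longleftrightarrow>
    subgroup N (add_monoid M) \<and> (\<forall>m\<in>N. \<forall>a\<in>carrier A. m \<triangleleft>\<^bsub>M\<^esub> a \<in> N)"

definition fin_generated ::
  "('a, 'x) ring_scheme \<Rightarrow> ('a, 'm, 'e) right_module_scheme \<Rightarrow> bool"
  where "fin_generated A M \<longleftrightarrow>
    (\<exists>S. finite S \<and> S \<subseteq> carrier M \<and>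
      (\<forall>N. right_submodule A M N \<and> S \<subseteq> N \<longrightarrow> N = carrier M))"

definition torsion_wrt :: "'a set \<Rightarrow> ('a, 'm, 'e) right_module_scheme \<Rightarrow> bool"
  where "torsion_wrt S M \<longleftrightarrow> (\<forall>m\<in>carrier M. \<exists>s\<in>S. m \<triangleleft>\<^bsub>M\<^esub> s = \<zero>\<^bsub>M\<^esub>)"

text \<open>The vector space underlying a right module over an algebra \<open>A\<close>: $c\cdot m = m(c 1_A)$.\<close>

definition scalar_space ::
  "('k, 'a, 'x) module_scheme \<Rightarrow> ('a, 'm, 'e) right_module_scheme \<Rightarrow> ('k, 'm) module"
  where "scalar_space A M =
    \<lparr>carrier = carrier M, mult = mult M, one = one M, zero = zero M, add = add M,
     smult = (\<lambda>c m. m \<triangleleft>\<^bsub>M\<^esub> (c \<odot>\<^bsub>A\<^esub> \<one>\<^bsub>A\<^esub>))\<rparr>"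

section \<open>Gelfand--Kirillov dimension\<close>

abbreviation lspan ::
  "('k, 'y) ring_scheme \<Rightarrow> ('k, 'v, 'x) module_scheme \<Rightarrow> 'v set \<Rightarrow> 'v set"
  where "lspan \<equiv> LinearCombinations.module.span"

definition subspace_dim ::
  "('k, 'y) ring_scheme \<Rightarrow> ('k, 'v, 'x) module_scheme \<Rightarrow> 'v set \<Rightarrow> nat"
  where "subspace_dim K V W = vectorspace.dim K (V\<lparr>carrier := W\<rparr>)"

definition fin_dim_subspace ::
  "('k, 'y) ring_scheme \<Rightarrow> ('k, 'v, 'x) module_scheme \<Rightarrow> 'v set \<Rightarrow> bool"
  where "fin_dim_subspace K V W \<longleftrightarrow>
    VectorSpace.subspace K W V \<and> vectorspace.fin_dim K (V\<lparr>carrier := W\<rparr>)"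

primrec subspace_power ::
  "('k, 'y) ring_scheme \<Rightarrow> ('k, 'a, 'x) module_scheme \<Rightarrow> 'a set \<Rightarrow> nat \<Rightarrow> 'a set"
  where
    "subspace_power K A V 0 = lspan K A {\<one>\<^bsub>A\<^esub>}"
  | "subspace_power K A V (Suc k) =
       lspan K A {u \<otimes>\<^bsub>A\<^esub> v | u v. u \<in> subspace_power K A V k \<and> v \<in> V}"

text \<open>
  \<open>GKdim_algebra K A\<close> is $\sup_V \limsup_k \log_k \dim_K V^k$ over the finite-dimensional
  subspaces $V \ni 1$ of \<open>A\<close>, and \<open>GKdim_module K A M\<close> is
  $\sup_{V,F} \limsup_k \log_k \dim_K F V^k$ with in addition \<open>F\<close> a finite-dimensional subspace
  of \<open>M\<close>.  The values at $k\in\{0,1\}$ are junk and do not affect the limes superior.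
  Since \<open>ln 0 = 0\<close>, the zero module gets dimension 0 (not $-\infty$), and adding $F = 0$ to the
  supremum changes nothing for nonzero modules.
\<close>

definition GKdim_algebra ::
  "('k, 'y) ring_scheme \<Rightarrow> ('k, 'a, 'x) module_scheme \<Rightarrow> ereal"
  where "GKdim_algebra K A =
    (SUP V \<in> {V. fin_dim_subspace K A V \<and> \<one>\<^bsub>A\<^esub> \<in> V}.
       limsup (\<lambda>k. ereal (log (real k) (real (subspace_dim K A (subspace_power K A V k))))))"

definition GKdim_module ::
  "('k, 'y) ring_scheme \<Rightarrow> ('k, 'a, 'x) module_scheme \<Rightarrow> ('a, 'm, 'e) right_module_scheme \<Rightarrow> ereal"
  where "GKdim_module K A M =
    (SUP (V, F) \<in> {(V, F). fin_dim_subspace K A V \<and> \<one>\<^bsub>A\<^esub> \<in> V \<and>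
                            fin_dim_subspace K (scalar_space A M) F}.
       limsup (\<lambda>k. ereal (log (real k) (real (subspace_dim K (scalar_space A M)
         (lspan K (scalar_space A M)
           {f \<triangleleft>\<^bsub>M\<^esub> v | f v. f \<in> F \<and> v \<in> subspace_power K A V k}))))))"

definition root_of_unity :: "'k::field \<Rightarrow> bool"
  where "root_of_unity a \<longleftrightarrow> (\<exists>m::nat. m > 0 \<and> a ^ m = 1)"

section \<open>Well-definedness\<close>

lemma keys_mult_letters:
  assumes "\<forall>w\<in>Poly_Mapping.keys f. set (letters w) \<subseteq> G" "\<forall>w\<in>Poly_Mapping.keys g. set (letters w) \<subseteq> G"
  shows "\<forall>w\<in>Poly_Mapping.keys (f * g :: 'k::field ncpoly). set (letters w) \<subseteq> G"
proof
  fix w assume "w \<in> Poly_Mapping.keys (f * g)"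
  then obtain u v where "u \<in> Poly_Mapping.keys f" "v \<in> Poly_Mapping.keys g" "w = u + v"
    using keys_mult[of f g] by blast
  with assms show "set (letters w) \<subseteq> G" by (auto simp: plus_gword_def)
qed

lemma ring_free_alg: "ring (free_alg n :: 'k::field ncpoly ring)"
proof (rule ringI)
  show "abelian_group (free_alg n :: 'k ncpoly ring)"
  proof (rule abelian_groupI)
    fix x y :: "'k ncpoly"
    assume "x \<in> carrier (free_alg n)" "y \<in> carrier (free_alg n)"
    then show "x \<oplus>\<^bsub>free_alg n\<^esub> y \<in> carrier (free_alg n)"
      using subsetD[OF Poly_Mapping.keys_add[of x y]] unfolding free_alg_def by fastforce
  next
    fix x :: "'k ncpoly" assume "x \<in> carrier (free_alg n)"
    then show "\<exists>y\<in>carrier (free_alg n). y \<oplus>\<^bsub>free_alg n\<^esub> x = \<zero>\<^bsub>free_alg n\<^esub>"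
      by (intro bexI[of _ "- x"]) (auto simp: free_alg_def)
  qed (auto simp: free_alg_def add.assoc add.commute)
  show "Group.monoid (free_alg n :: 'k ncpoly ring)"
  proof (rule monoidI)
    fix x y :: "'k ncpoly"
    assume "x \<in> carrier (free_alg n)" "y \<in> carrier (free_alg n)"
    then show "x \<otimes>\<^bsub>free_alg n\<^esub> y \<in> carrier (free_alg n)"
      using keys_mult_letters[of x "gens n" y] by (auto simp: free_alg_def)
  next
    show "\<one>\<^bsub>free_alg n\<^esub> \<in> carrier (free_alg n :: 'k ncpoly ring)"
      using keys_single[of "0::gword" "1::'k"] by (auto simp: free_alg_def zero_gword_def simp flip: single_one split: if_splits)
  qed (auto simp: free_alg_def mult.assoc)
qed (auto simp: free_alg_def algebra_simps)

lemma in_free_alg: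
  "scal c \<in> carrier (free_alg n)"
  "i \<in> {1..n} \<Longrightarrow> fx i \<in> carrier (free_alg n)"
  "i \<in> {1..n} \<Longrightarrow> fy i \<in> carrier (free_alg n)"
  by (auto simp: free_alg_def zero_gword_def gens_def)

lemma free_alg_closed:
  assumes "f \<in> carrier (free_alg n)" "g \<in> carrier (free_alg n)"
  shows "f + g \<in> carrier (free_alg n)" "f - g \<in> carrier (free_alg n)" "f * g \<in> carrier (free_alg n)"
proof -
  have "w \<in> Poly_Mapping.keys f \<or> w \<in> Poly_Mapping.keys g" if "w \<in> Poly_Mapping.keys (f + g)" for w
    using subsetD[OF Poly_Mapping.keys_add that] by simp
  with assms show "f + g \<in> carrier (free_alg n)"
    unfolding free_alg_def by fastforce
  have "w \<in> Poly_Mapping.keys f \<or> w \<in> Poly_Mapping.keys g" if "w \<in> Poly_Mapping.keys (f - g)" for w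
    using subsetD[OF keys_diff that] by simp
  with assms show "f - g \<in> carrier (free_alg n)"
    unfolding free_alg_def by fastforce
  show "f * g \<in> carrier (free_alg n)"
    using assms keys_mult_letters[of f "gens n" g] by (simp add: free_alg_def)
qed

lemma free_alg_sum:
  "(\<And>i. i \<in> S \<Longrightarrow> f i \<in> carrier (free_alg n)) \<Longrightarrow> sum f S \<in> carrier (free_alg n)"
proof (induction S rule: infinite_finite_induct)
  case (insert x F)
  then show ?case by (auto intro!: free_alg_closed)
qed (auto simp: free_alg_def)

lemma Kn_relators_closed: "Kn_relators n p q \<gamma> \<subseteq> carrier (free_alg n)"
  unfolding Kn_relators_def
  by (intro Un_least; clarify; intro free_alg_closed free_alg_sum in_free_alg; simp)

lemma ideal_Kn: "ideal (Kn_ideal n p q \<gamma>) (free_alg n)"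
  unfolding Kn_ideal_def by (rule ring.genideal_ideal[OF ring_free_alg Kn_relators_closed])

lemma Kn_simps:
  "carrier (Kn n p q \<gamma>) = carrier (free_alg n Quot Kn_ideal n p q \<gamma>)"
  "mult (Kn n p q \<gamma>) = mult (free_alg n Quot Kn_ideal n p q \<gamma>)"
  "one (Kn n p q \<gamma>) = one (free_alg n Quot Kn_ideal n p q \<gamma>)"
  "zero (Kn n p q \<gamma>) = zero (free_alg n Quot Kn_ideal n p q \<gamma>)"
  "add (Kn n p q \<gamma>) = add (free_alg n Quot Kn_ideal n p q \<gamma>)"
  "smult (Kn n p q \<gamma>) c a =
     (Kn_ideal n p q \<gamma> +>\<^bsub>free_alg n\<^esub> scal c) \<otimes>\<^bsub>free_alg n Quot Kn_ideal n p q \<gamma>\<^esub> a"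
  by (simp_all add: Kn_def Let_def ring.defs module.defs)

lemma ring_Kn: "ring (Kn n p q \<gamma>)"
proof -
  interpret ideal "Kn_ideal n p q \<gamma>" "free_alg n" by (rule ideal_Kn)
  interpret Q: ring "free_alg n Quot Kn_ideal n p q \<gamma>" by (rule quotient_is_ring)
  have "abelian_group (Kn n p q \<gamma>)"
  proof (rule abelian_groupI)
    fix x assume "x \<in> carrier (Kn n p q \<gamma>)"
    then show "\<exists>y\<in>carrier (Kn n p q \<gamma>). y \<oplus>\<^bsub>Kn n p q \<gamma>\<^esub> x = \<zero>\<^bsub>Kn n p q \<gamma>\<^esub>"
      using Q.l_neg[of x] Q.a_inv_closed[of x] unfolding Kn_simps by blast
  qed (simp_all add: Kn_simps Q.a_ac)
  moreover have "Group.monoid (Kn n p q \<gamma>)"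
    by (rule monoidI) (simp_all add: Kn_simps Q.m_assoc)
  ultimately show ?thesis
    by (rule ringI) (simp_all add: Kn_simps Q.l_distr Q.r_distr)
qed

lemma vectorspace_Kn: "vectorspace (class_ring :: 'k::field ring) (Kn n p q (\<gamma>::nat\<Rightarrow>nat\<Rightarrow>'k))"
proof -
  let ?F = "free_alg n" let ?I = "Kn_ideal n p q \<gamma>"
  interpret ideal ?I ?F by (rule ideal_Kn)
  interpret Q: ring "?F Quot ?I" by (rule quotient_is_ring)
  interpret K: ring "Kn n p q \<gamma>" by (rule ring_Kn)
  note h = rcos_ring_hom
  have c: "?I +>\<^bsub>?F\<^esub> scal c \<in> carrier (?F Quot ?I)" for c
    using ring_hom_closed[OF h in_free_alg(1)] .
  have a: "?I +>\<^bsub>?F\<^esub> scal (c + d) = (?I +>\<^bsub>?F\<^esub> scal c) \<oplus>\<^bsub>?F Quot ?I\<^esub> (?I +>\<^bsub>?F\<^esub> scal d)" for c d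
    using ring_hom_add[OF h in_free_alg(1) in_free_alg(1), of c d] by (simp add: free_alg_def single_add)
  have m: "?I +>\<^bsub>?F\<^esub> scal (c * d) = (?I +>\<^bsub>?F\<^esub> scal c) \<otimes>\<^bsub>?F Quot ?I\<^esub> (?I +>\<^bsub>?F\<^esub> scal d)" for c d
    using ring_hom_mult[OF h in_free_alg(1) in_free_alg(1), of c d] by (simp add: free_alg_def mult_single)
  have o: "?I +>\<^bsub>?F\<^esub> 1 = \<one>\<^bsub>?F Quot ?I\<^esub>"
    using ring_hom_one[OF h] by (simp add: free_alg_def)
  show ?thesis
    by (intro vectorspace.intro moduleI class_field.field_axioms class_cring.cring_axioms K.abelian_group_axioms)
       (simp_all add: Kn_simps a c m o Q.l_distr Q.r_distr Q.m_assoc)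
qed

lemma vectorspace_scalar_space:
  assumes "right_module (Kn n p q (\<gamma>::nat\<Rightarrow>nat\<Rightarrow>'k::field)) M"
  shows "vectorspace (class_ring :: 'k ring) (scalar_space (Kn n p q \<gamma>) M)"
proof -
  let ?K = "Kn n p q \<gamma>"
  interpret R: right_module ?K M by fact
  interpret V: vectorspace "class_ring :: 'k ring" ?K by (rule vectorspace_Kn)
  let ?F = "free_alg n" let ?I = "Kn_ideal n p q \<gamma>"
  interpret I: ideal ?I ?F by (rule ideal_Kn)
  interpret Q: ring "?F Quot ?I" by (rule I.quotient_is_ring)
  have c: "?I +>\<^bsub>?F\<^esub> scal c \<in> carrier (?F Quot ?I)" for c
    using ring_hom_closed[OF I.rcos_ring_hom in_free_alg(1)] .
  have [simp]: "(c::'k) \<odot>\<^bsub>?K\<^esub> \<one>\<^bsub>?K\<^esub> \<in> carrier ?K" for c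
    by (rule V.smult_closed) auto
  have m: "(c * d) \<odot>\<^bsub>?K\<^esub> \<one>\<^bsub>?K\<^esub> = (d \<odot>\<^bsub>?K\<^esub> \<one>\<^bsub>?K\<^esub>) \<otimes>\<^bsub>?K\<^esub> (c \<odot>\<^bsub>?K\<^esub> \<one>\<^bsub>?K\<^esub>)" for c d :: 'k
  proof -
    have "(c * d) \<odot>\<^bsub>?K\<^esub> \<one>\<^bsub>?K\<^esub> = d \<odot>\<^bsub>?K\<^esub> (c \<odot>\<^bsub>?K\<^esub> \<one>\<^bsub>?K\<^esub>)"
      using V.smult_assoc1[of d c "\<one>\<^bsub>?K\<^esub>"] by (simp add: mult.commute)
    also have "\<dots> = (d \<odot>\<^bsub>?K\<^esub> \<one>\<^bsub>?K\<^esub>) \<otimes>\<^bsub>?K\<^esub> (c \<odot>\<^bsub>?K\<^esub> \<one>\<^bsub>?K\<^esub>)"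
      by (auto simp: Kn_simps c Q.m_assoc)
    finally show ?thesis .
  qed
  have add: "(c + d) \<odot>\<^bsub>?K\<^esub> \<one>\<^bsub>?K\<^esub> = (c \<odot>\<^bsub>?K\<^esub> \<one>\<^bsub>?K\<^esub>) \<oplus>\<^bsub>?K\<^esub> (d \<odot>\<^bsub>?K\<^esub> \<one>\<^bsub>?K\<^esub>)" for c d :: 'k
    using V.smult_l_distr[of c d "\<one>\<^bsub>?K\<^esub>"] by simp
  have one: "(1::'k) \<odot>\<^bsub>?K\<^esub> \<one>\<^bsub>?K\<^esub> = \<one>\<^bsub>?K\<^esub>"
    using V.smult_one[of "\<one>\<^bsub>?K\<^esub>"] by simp
  have ab: "abelian_group (scalar_space ?K M)"
  proof (rule abelian_groupI)
    fix x assume "x \<in> carrier (scalar_space ?K M)"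
    then show "\<exists>y\<in>carrier (scalar_space ?K M).
        y \<oplus>\<^bsub>scalar_space ?K M\<^esub> x = \<zero>\<^bsub>scalar_space ?K M\<^esub>"
      using R.M.l_neg[of x] R.M.a_inv_closed[of x] unfolding scalar_space_def by auto
  qed (simp_all add: scalar_space_def R.M.a_ac)
  show ?thesis
    by (intro vectorspace.intro moduleI class_field.field_axioms class_cring.cring_axioms ab)
       (simp_all add: scalar_space_def m add one R.ract_closed R.ract_add_left R.ract_add_right
          R.ract_mult R.ract_one)
qed

end

theory Submission
  imports Defs
begin

text \<open>
  Lower bound for \<open>M\<close>. Write \<open>z\<^sub>j\<close> for the normal elements; since \<open>q = 1\<close>, \<open>x\<^sub>i\<close> and \<open>y\<^sub>i\<close> commute
  with \<open>z\<^sub>j\<close> for \<open>j \<ge> i\<close> and scale it by \<open>p\<^sub>i\<close> and \<open>1/p\<^sub>i\<close> for \<open>j < i\<close>. Pass to a torsion-free cyclic quotient and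
  treat \<open>z\<^sub>n, \<dots>, z\<^sub>1\<close> in this order, keeping a nonzero subspace stable under the generators of lower
  index on which every polynomial in the \<open>z\<close>'s treated so far acts as zero or injectively. If \<open>z\<^sub>i\<close> is transcendental
  over the previous ones, its powers give one independent parameter. Otherwise pass to the kernel of a
  polynomial \<open>f(z\<^sub>i)\<close> of minimal degree: the powers of \<open>x\<close> or \<open>y\<close> of index \<open>i + 1\<close> map it
  injectively to the kernels of the twists \<open>f(\<mu>\<^sup>l z\<^sub>i)\<close>, which are independent because \<open>f\<close> is minimal and
  \<open>p\<close> is not a root of unity. Either way \<open>n - 1\<close> parameters result, of bounded degree each.

  Dimension of the algebra. Words sorted by \<open>y\<^sub>1 < x\<^sub>1 < y\<^sub>2 < x\<^sub>2 < \<dots>\<close> span, which gives \<open>2n\<close> as an upper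
  bound. For the lower bound, \<open>x\<^sub>i\<close> and \<open>z\<^sub>i\<close> are represented by weighted shifts of a lattice of rank \<open>2n\<close> and
  \<open>y\<^sub>i = (z\<^sub>i - z\<^bsub>i-1\<^esub>) x\<^sub>i\<^sup>-\<^sup>1 / (1 - p\<^sub>i)\<close>, so that the monomials in the \<open>z\<close>'s and \<open>x\<close>'s are independent.
\<close>

subsection \<open>Linearly independent families in modules\<close>

text \<open>The bound is n - 1 rather than n because, when z_i is algebraic, its parameter comes
  from a generator of index i + 1. For z_n there is none, so that step only makes the polynomials in
  z_n act as zero or injectively. Growth comes exactly from the lost stability: generators of index
  at most i preserve the kernel of a polynomial in z_i, whereas those of index i + 1 rescale z_i and
  carry the kernel to the kernels of the twists. Either of x and y of index i + 1 may fail to act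
  injectively on the kernel. Up to scalars, however, xy and yx are z_{i+1} - p z_i and z_{i+1} -
  z_i; passing these factors through powers of x or y yields z_{i+1} - p^k z_i with k > 0 for x and
  k \<le> 0 for y. Two of them with different k cannot both kill the kernel, since z_i is injective
  and p is not a root of unity, so one of x and y always works. Computations take place in the free
  algebra, as congruences modulo the relations. A torsion-free cyclic module is encoded by a right
  ideal J, and its subspaces by sets M containing J.\<close>

definition wmono :: "'r::monoid_mult list \<Rightarrow> nat list \<Rightarrow> 'r"
  where "wmono ts a = prod_list (map2 (\<lambda>t k. t ^ k) ts a)"

lemma wmono_Nil [simp]: "wmono [] a = 1"
  by (simp add: wmono_def)

lemma wmono_snoc: "length a = length ts \<Longrightarrow> wmono (ts @ [t]) (a @ [k]) = wmono ts a * t ^ k"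
  by (simp add: wmono_def)

definition box :: "nat \<Rightarrow> nat \<Rightarrow> nat list set"
  where "box N s = {a. length a = N \<and> set a \<subseteq> {..<s}}"

lemma finite_box [simp]: "finite (box N s)"
  using finite_lists_length_eq[of "{..<s}" N] by (simp add: box_def conj_commute)

lemma card_box: "card (box N s) = s ^ N"
  using card_lists_length_eq[of "{..<s}" N] by (simp add: box_def conj_commute)

lemma box_0 [simp]: "box 0 s = {[]}"
  by (auto simp: box_def)

lemma sum_box_Suc: "sum f (box (Suc N) s) = (\<Sum>k<s. \<Sum>a\<in>box N s. f (a @ [k]))"
proof -
  let ?h = "\<lambda>(k::nat, a::nat list). a @ [k]"
  have "b \<in> ?h ` ({..<s} \<times> box N s)" if "b \<in> box (Suc N) s" for b
    using that by (cases b rule: rev_cases) (force simp: box_def)+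
  then have "bij_betw ?h ({..<s} \<times> box N s) (box (Suc N) s)"
    unfolding bij_betw_def by (auto simp: inj_on_def box_def)
  then have "sum f (box (Suc N) s) = (\<Sum>(k, a)\<in>{..<s} \<times> box N s. f (a @ [k]))"
    using sum.reindex_bij_betw[of ?h _ _ f] by (simp add: case_prod_unfold)
  then show ?thesis by (simp add: sum.cartesian_product)
qed

section \<open>Congruence modulo a two-sided ideal and commutation up to scalars\<close>

locale scalar_ideal =
  fixes sc :: "'k::field \<Rightarrow> 'r::ring_1"
    and I :: "'r set"
  assumes sc_add: "sc (c + d) = sc c + sc d"
    and sc_mult: "sc (c * d) = sc c * sc d"
    and sc_1: "sc 1 = 1"
    and sc_comm: "sc c * a = a * sc c"
    and I_add: "a \<in> I \<Longrightarrow> b \<in> I \<Longrightarrow> a + b \<in> I"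
    and I_rmult: "a \<in> I \<Longrightarrow> a * b \<in> I"
    and I_lmult: "a \<in> I \<Longrightarrow> b * a \<in> I"
    and I_zero: "0 \<in> I"
begin

definition eqI :: "'r \<Rightarrow> 'r \<Rightarrow> bool" (infix "\<doteq>" 50)
  where "a \<doteq> b \<longleftrightarrow> a - b \<in> I"

lemma sc_0 [simp]: "sc 0 = 0"
  using sc_add[of 0 0] by simp

lemma sc_minus: "sc (- c) = - sc c"
  using sc_add[of c "- c"] by (simp add: eq_neg_iff_add_eq_0 add.commute)

lemma sc_diff: "sc (c - d) = sc c - sc d"
  using sc_add[of c "- d"] by (simp add: sc_minus)

lemma sc_left: "a * (sc c * b) = sc c * (a * b)"
  by (metis mult.assoc sc_comm)

lemma I_uminus: "a \<in> I \<Longrightarrow> - a \<in> I"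
  using I_lmult[of a "- 1"] by simp

lemma eq_refl [simp]: "a \<doteq> a"
  by (simp add: eqI_def I_zero)

lemma eq_sym: "a \<doteq> b \<Longrightarrow> b \<doteq> a"
  using I_uminus[of "a - b"] by (simp add: eqI_def)

lemma eq_trans [trans]: "a \<doteq> b \<Longrightarrow> b \<doteq> c \<Longrightarrow> a \<doteq> c"
  using I_add[of "a - b" "b - c"] by (simp add: eqI_def)

lemma eq_add: "a \<doteq> b \<Longrightarrow> c \<doteq> d \<Longrightarrow> a + c \<doteq> b + d"
  using I_add[of "a - b" "c - d"] by (simp add: eqI_def algebra_simps)

lemma eq_lmult: "a \<doteq> b \<Longrightarrow> c * a \<doteq> c * b"
  using I_lmult[of "a - b" c] by (simp add: eqI_def algebra_simps)

lemma eq_rmult: "a \<doteq> b \<Longrightarrow> a * c \<doteq> b * c"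
  using I_rmult[of "a - b" c] by (simp add: eqI_def algebra_simps)

lemma eq_diff: "a \<doteq> b \<Longrightarrow> c \<doteq> d \<Longrightarrow> a - c \<doteq> b - d"
  using eq_add[of a b "- c" "- d"] eq_lmult[of c d "- 1"] by simp

lemma eq_sum: "(\<And>a. a \<in> S \<Longrightarrow> f a \<doteq> g a) \<Longrightarrow> sum f S \<doteq> sum g S"
  by (induction S rule: infinite_finite_induct) (auto simp: eq_add)

lemma commI_add: "a * c \<doteq> c * a \<Longrightarrow> b * c \<doteq> c * b \<Longrightarrow> (a + b) * c \<doteq> c * (a + b)"
  using eq_add by (simp add: distrib_left distrib_right)

lemma commI_mult: "a * c \<doteq> c * a \<Longrightarrow> b * c \<doteq> c * b \<Longrightarrow> a * b * c \<doteq> c * (a * b)"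
  using eq_lmult[of "b * c" "c * b" a] eq_rmult[of "a * c" "c * a" b] eq_trans
  by (simp add: mult.assoc)

lemma comm_power: "a * c \<doteq> c * a \<Longrightarrow> a ^ k * c \<doteq> c * a ^ k"
  by (induction k) (auto intro: commI_mult)

definition qc :: "'k \<Rightarrow> 'r \<Rightarrow> 'r \<Rightarrow> bool"
  where "qc c a b \<longleftrightarrow> a * b \<doteq> sc c * (b * a)"

lemma qc_1: "qc 1 a b \<longleftrightarrow> a * b \<doteq> b * a"
  by (simp add: qc_def sc_1)

lemma qc_sym:
  assumes "qc c a b" "c \<noteq> 0" shows "qc (inverse c) b a"
proof -
  have "sc (inverse c) * (a * b) \<doteq> sc (inverse c) * (sc c * (b * a))"
    using assms(1) by (intro eq_lmult) (simp add: qc_def)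
  also have "\<dots> = sc (inverse c * c) * (b * a)" by (simp only: sc_mult mult.assoc)
  also have "\<dots> = b * a" using assms(2) by (simp add: sc_1)
  finally show ?thesis by (simp add: qc_def eq_sym)
qed

lemma qc_mult_right:
  assumes "qc c a b" "qc d a b'" shows "qc (c * d) a (b * b')"
proof -
  have "a * b * b' \<doteq> sc c * (b * a) * b'" using assms(1) by (intro eq_rmult) (simp add: qc_def)
  also have "sc c * (b * a) * b' = sc c * b * (a * b')" by (simp only: mult.assoc)
  also have "\<dots> \<doteq> sc c * b * (sc d * (b' * a))" using assms(2) by (intro eq_lmult) (simp add: qc_def)
  also have "\<dots> = sc (c * d) * (b * b' * a)" by (simp add: sc_mult mult.assoc sc_left[of b])
  finally show ?thesis by (simp add: qc_def mult.assoc)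
qed

lemma qc_mult_left:
  assumes "qc c a b" "qc d a' b" shows "qc (c * d) (a * a') b"
proof -
  have "a * (a' * b) \<doteq> a * (sc d * (b * a'))" using assms(2) by (intro eq_lmult) (simp add: qc_def)
  also have "a * (sc d * (b * a')) = sc d * (a * b * a')" by (simp add: sc_left[of a] mult.assoc)
  also have "\<dots> \<doteq> sc d * (sc c * (b * a) * a')"
    using assms(1) by (intro eq_lmult eq_rmult) (simp add: qc_def)
  also have "\<dots> = sc (c * d) * (b * (a * a'))" by (simp add: sc_mult mult.assoc mult.commute[of c])
  finally show ?thesis by (simp add: qc_def mult.assoc)
qed

lemma qc_add_right: "qc c a b \<Longrightarrow> qc c a b' \<Longrightarrow> qc c a (b + b')"
  unfolding qc_def using eq_add by (simp add: distrib_left distrib_right)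

lemma qc_add_left: "qc c a b \<Longrightarrow> qc c a' b \<Longrightarrow> qc c (a + a') b"
  unfolding qc_def using eq_add by (simp add: distrib_left distrib_right)

lemma qc_0 [simp]: "qc c a 0" "qc c 0 a"
  by (simp_all add: qc_def)

lemma qc_sc: "qc 1 a (sc c)" "qc 1 (sc c) a"
  by (simp_all add: qc_1 sc_comm)

lemma qc_sc_mult: "qc c a b \<Longrightarrow> qc c a (sc d * b)" "qc c a b \<Longrightarrow> qc c (sc d * a) b"
  using qc_mult_right[OF qc_sc(1)[of a d], of c b] qc_mult_left[OF qc_sc(2)[of d b], of c a] by simp_all

lemma qc_sum_right: "(\<And>l. l \<in> S \<Longrightarrow> qc c a (f l)) \<Longrightarrow> qc c a (sum f S)"
  by (induction S rule: infinite_finite_induct) (simp_all add: qc_add_right)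

lemma qc_sum_left: "(\<And>l. l \<in> S \<Longrightarrow> qc c (f l) a) \<Longrightarrow> qc c (sum f S) a"
  by (induction S rule: infinite_finite_induct) (simp_all add: qc_add_left)

end

text \<open>The quotient by J is a cyclic right module on which every z_j is injective. J is only a
  right ideal, while the relations hold modulo the two-sided I, so that they may be applied in the
  middle of a product. \<open>xy\<close> and \<open>yx\<close> start at index 2 because the step for
  z_i uses the generators of index i + 1.\<close>

locale skew = scalar_ideal sc I
  for sc :: "'k::field \<Rightarrow> 'r::ring_1" and I +
  fixes J :: "'r set"
    and x y z :: "nat \<Rightarrow> 'r"
    and p :: "nat \<Rightarrow> 'k"
    and n :: nat
  assumes I_J: "I \<subseteq> J"
    and J_add: "a \<in> J \<Longrightarrow> b \<in> J \<Longrightarrow> a + b \<in> J"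
    and J_rmult: "a \<in> J \<Longrightarrow> a * b \<in> J"
    and one_J: "1 \<notin> J"
    and z_inj: "1 \<le> j \<Longrightarrow> j \<le> n \<Longrightarrow> u * z j \<in> J \<Longrightarrow> u \<in> J"
    and zz: "\<lbrakk>1 \<le> i; i \<le> n; 1 \<le> j; j \<le> n\<rbrakk> \<Longrightarrow> z i * z j - z j * z i \<in> I"
    and xz: "\<lbrakk>1 \<le> i; i \<le> j; j \<le> n\<rbrakk> \<Longrightarrow> x i * z j - z j * x i \<in> I"
    and yz: "\<lbrakk>1 \<le> i; i \<le> j; j \<le> n\<rbrakk> \<Longrightarrow> y i * z j - z j * y i \<in> I"
    and xz': "\<lbrakk>1 \<le> j; j < i; i \<le> n\<rbrakk> \<Longrightarrow> x i * z j - sc (p i) * z j * x i \<in> I"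
    and yz': "\<lbrakk>1 \<le> j; j < i; i \<le> n\<rbrakk> \<Longrightarrow> y i * z j - sc (inverse (p i)) * z j * y i \<in> I"
    and xy: "\<lbrakk>2 \<le> i; i \<le> n\<rbrakk> \<Longrightarrow> sc (1 - p i) * x i * y i - (z i - sc (p i) * z (i - 1)) \<in> I"
    and yx: "\<lbrakk>2 \<le> i; i \<le> n\<rbrakk> \<Longrightarrow> sc (1 - p i) * y i * x i - (z i - z (i - 1)) \<in> I"
    and p_nz: "1 \<le> i \<Longrightarrow> i \<le> n \<Longrightarrow> p i \<noteq> 0"
    and p_root: "1 \<le> i \<Longrightarrow> i \<le> n \<Longrightarrow> \<not> root_of_unity (p i)"
begin

lemma J_uminus: "a \<in> J \<Longrightarrow> - a \<in> J"
  using J_rmult[of a "- 1"] by simp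

lemma J_diff: "a \<in> J \<Longrightarrow> b \<in> J \<Longrightarrow> a - b \<in> J"
  using J_add[of a "- b"] J_uminus by simp

lemma J_zero: "0 \<in> J"
  using I_J I_zero by auto

lemma J_sum: "(\<And>a. a \<in> S \<Longrightarrow> f a \<in> J) \<Longrightarrow> sum f S \<in> J"
  by (induction S rule: infinite_finite_induct) (auto simp: J_zero J_add)

lemma eq_J: "a \<doteq> b \<Longrightarrow> a \<in> J \<longleftrightarrow> b \<in> J"
  using J_add[of "a - b" b] J_diff[of a "a - b"] I_J by (auto simp: eqI_def)

lemma p_pow: "1 \<le> i \<Longrightarrow> i \<le> n \<Longrightarrow> 0 < k \<Longrightarrow> p i ^ k \<noteq> 1"
  using p_root[of i] unfolding root_of_unity_def by blast

section \<open>Polynomials in the normal elements\<close>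

inductive_set D :: "nat \<Rightarrow> 'r set" for i where
  D_sc: "sc c \<in> D i"
| D_z: "i \<le> j \<Longrightarrow> 1 \<le> j \<Longrightarrow> j \<le> n \<Longrightarrow> z j \<in> D i"
| D_add: "a \<in> D i \<Longrightarrow> b \<in> D i \<Longrightarrow> a + b \<in> D i"
| D_mult: "a \<in> D i \<Longrightarrow> b \<in> D i \<Longrightarrow> a * b \<in> D i"

lemma D_0: "0 \<in> D i" and D_1: "1 \<in> D i"
  using D_sc[of 0] D_sc[of 1] by (simp_all add: sc_1)

lemma D_diff: "a \<in> D i \<Longrightarrow> b \<in> D i \<Longrightarrow> a - b \<in> D i"
  using D_add[of a i "sc (- 1) * b"] D_mult[OF D_sc[of "- 1"], of b i]
  by (simp add: sc_minus sc_1)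

lemma D_power: "a \<in> D i \<Longrightarrow> a ^ k \<in> D i"
  by (induction k) (auto intro: D_1 D_mult)

lemma D_sum: "(\<And>k. k \<in> S \<Longrightarrow> f k \<in> D i) \<Longrightarrow> sum f S \<in> D i"
  by (induction S rule: infinite_finite_induct) (auto intro: D_0 D_add)

lemma D_mono: "a \<in> D i \<Longrightarrow> j \<le> i \<Longrightarrow> a \<in> D j"
  by (induction rule: D.induct) (auto intro: D.intros)

lemma D_comm_gen:
  assumes "a \<in> D i" "\<And>j. i \<le> j \<Longrightarrow> 1 \<le> j \<Longrightarrow> j \<le> n \<Longrightarrow> z j * b \<doteq> b * z j"
  shows "a * b \<doteq> b * a"
  using assms(1) by induction (auto intro: assms(2) commI_add commI_mult simp: sc_comm)

lemma D_comm: "a \<in> D i \<Longrightarrow> b \<in> D j \<Longrightarrow> a * b \<doteq> b * a"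
  by (erule D_comm_gen, rule eq_sym, erule D_comm_gen) (auto simp: eqI_def intro: zz)

lemma D_x: "a \<in> D i \<Longrightarrow> 1 \<le> j \<Longrightarrow> j \<le> i \<Longrightarrow> a * x j \<doteq> x j * a"
  by (erule D_comm_gen, rule eq_sym) (auto simp: eqI_def intro: xz)

lemma D_y: "a \<in> D i \<Longrightarrow> 1 \<le> j \<Longrightarrow> j \<le> i \<Longrightarrow> a * y j \<doteq> y j * a"
  by (erule D_comm_gen, rule eq_sym) (auto simp: eqI_def intro: yz)

lemma D_last: "a \<in> D (Suc n) \<Longrightarrow> \<exists>c. a = sc c"
proof (induction rule: D.induct)
  case (D_add a b) then show ?case by (metis sc_add)
next
  case (D_mult a b) then show ?case by (metis sc_mult)
qed auto

definition ev :: "nat \<Rightarrow> (nat \<Rightarrow> 'r) \<Rightarrow> nat \<Rightarrow> 'r"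
  where "ev i g L = (\<Sum>k<L. g k * z i ^ k)"

lemma ev_Suc: "ev i g (Suc L) = ev i g L + g L * z i ^ L"
  by (simp add: ev_def)

lemma ev_D: "1 \<le> i \<Longrightarrow> i \<le> n \<Longrightarrow> (\<And>k. g k \<in> D (Suc i)) \<Longrightarrow> ev i g L \<in> D i"
  unfolding ev_def by (intro D_sum D_mult D_power D_z) (auto intro: D_mono[of _ "Suc i"])

text \<open>Elements of \<open>D i\<close> are built by arbitrary sums and products, and the z's
  commute only modulo I; a normal form as a polynomial in z_i over \<open>D (Suc i)\<close> can
  therefore be demanded only up to congruence.\<close>

definition PL :: "nat \<Rightarrow> 'r set"
  where "PL i = {d. \<exists>g L. (\<forall>k. g k \<in> D (Suc i)) \<and> d \<doteq> ev i g L}"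

lemma PLI: "(\<And>k. g k \<in> D (Suc i)) \<Longrightarrow> d \<doteq> ev i g L \<Longrightarrow> d \<in> PL i"
  unfolding PL_def by blast

lemma ev_pad: "ev i g L = ev i (\<lambda>k. if k < L then g k else 0) (L + L')"
  unfolding ev_def by (rule sum.mono_neutral_cong_left) auto

lemma PL_add:
  assumes "a \<in> PL i" "b \<in> PL i" shows "a + b \<in> PL i"
proof -
  obtain g L where g: "\<forall>k. g k \<in> D (Suc i)" "a \<doteq> ev i g L" using assms(1) by (auto simp: PL_def)
  obtain h L' where h: "\<forall>k. h k \<in> D (Suc i)" "b \<doteq> ev i h L'" using assms(2) by (auto simp: PL_def)
  let ?f = "\<lambda>k. (if k < L then g k else 0) + (if k < L' then h k else 0)"
  have "ev i ?f (L + L') = ev i g L + ev i h L'"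
    by (subst ev_pad[of i g L L'], subst ev_pad[of i h L' L])
       (simp add: ev_def distrib_right sum.distrib add.commute[of L'])
  then have "a + b \<doteq> ev i ?f (L + L')" using eq_add[OF g(2) h(2)] by simp
  moreover have "\<forall>k. ?f k \<in> D (Suc i)" using g h by (auto intro: D_add D_0)
  ultimately show ?thesis using PLI[of ?f] by blast
qed

lemma PL_z:
  assumes "a \<in> PL i" shows "a * z i \<in> PL i"
proof -
  obtain g L where g: "\<forall>k. g k \<in> D (Suc i)" "a \<doteq> ev i g L" using assms(1) by (auto simp: PL_def)
  let ?f = "\<lambda>k. case k of 0 \<Rightarrow> 0 | Suc k \<Rightarrow> g k"
  have "ev i ?f (Suc L) = ev i g L * z i"
    unfolding ev_def by (subst sum.lessThan_Suc_shift) (simp add: sum_distrib_right mult.assoc power_commutes)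
  then have "a * z i \<doteq> ev i ?f (Suc L)" using eq_rmult[OF g(2)] by simp
  moreover have "\<forall>k. ?f k \<in> D (Suc i)" using g by (auto intro: D_0 split: nat.split)
  ultimately show ?thesis using PLI[of ?f] by blast
qed

lemma PL_rmult:
  assumes "a \<in> PL i" "b \<in> D (Suc i)" "1 \<le> i" "i \<le> n" shows "a * b \<in> PL i"
proof -
  obtain g L where g: "\<forall>k. g k \<in> D (Suc i)" "a \<doteq> ev i g L" using assms(1) by (auto simp: PL_def)
  have "ev i g L * b \<doteq> ev i (\<lambda>k. g k * b) L"
    unfolding ev_def sum_distrib_right mult.assoc
    by (intro eq_sum eq_lmult D_comm[OF D_power[OF D_z] assms(2), of i]) (use assms in auto)
  then have "a * b \<doteq> ev i (\<lambda>k. g k * b) L" using eq_rmult[OF g(2)] eq_trans by blast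
  moreover have "\<forall>k. g k * b \<in> D (Suc i)" using g assms by (auto intro: D_mult)
  ultimately show ?thesis using PLI[of "\<lambda>k. g k * b"] by blast
qed

lemma PL_D: "b \<in> D (Suc i) \<Longrightarrow> b \<in> PL i"
  unfolding PL_def
  by (intro CollectI exI[of _ "\<lambda>k. b"] exI[of _ 1]) (auto simp: ev_def)

lemma PL_cong: "a \<doteq> b \<Longrightarrow> b \<in> PL i \<Longrightarrow> a \<in> PL i"
  unfolding PL_def using eq_trans by blast

lemma D_PL:
  assumes "d \<in> D i" "1 \<le> i" "i \<le> n" shows "d \<in> PL i"
  using assms(1)
proof induction
  case (D_z j)
  then show ?case
    using PL_z[OF PL_D[OF D_1], of i] by (cases "j = i") (auto intro!: PL_D D.D_z)
next
  case (D_mult a b)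
  obtain g L where g: "\<forall>k. g k \<in> D (Suc i)" "b \<doteq> ev i g L" using D_mult by (auto simp: PL_def)
  have pw: "a * c * z i ^ k \<in> PL i" if "c \<in> D (Suc i)" for c k
  proof (induction k)
    case 0
    then show ?case using PL_rmult[OF D_mult.IH(1) that] assms by simp
  next
    case (Suc k)
    then show ?case using PL_z[OF Suc] by (simp add: mult.assoc power_commutes)
  qed
  have "a * ev i g l \<in> PL i" for l
  proof (induction l)
    case 0
    then show ?case using PL_D[OF D_0] by (simp add: ev_def)
  next
    case (Suc l)
    then show ?case using PL_add[OF Suc pw[of "g l" l]] g(1) by (simp add: ev_Suc distrib_left mult.assoc)
  qed
  then show ?case using PL_cong[OF eq_lmult[OF g(2)]] by blast
qed (auto intro: PL_D PL_add D_sc)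

text \<open>Sets M containing J stand for the subspaces M/J. All z_j must act, but x_j and y_j only
  up to index i: this is what survives when M is cut down to the kernel of a polynomial in
  z_i.\<close>

definition stable :: "'r set \<Rightarrow> nat \<Rightarrow> bool"
  where "stable M i \<longleftrightarrow> J \<subseteq> M \<and> (\<forall>u\<in>M. \<forall>v\<in>M. u + v \<in> M) \<and> (\<forall>u\<in>M. \<forall>c. u * sc c \<in> M) \<and>
    (\<forall>u\<in>M. \<forall>j. 1 \<le> j \<and> j \<le> n \<longrightarrow> u * z j \<in> M) \<and>
    (\<forall>u\<in>M. \<forall>j. 1 \<le> j \<and> j \<le> i \<and> j \<le> n \<longrightarrow> u * x j \<in> M \<and> u * y j \<in> M)"

lemma stableD:
  assumes "stable M i"
  shows "u \<in> J \<Longrightarrow> u \<in> M"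
    and "u \<in> M \<Longrightarrow> v \<in> M \<Longrightarrow> u + v \<in> M"
    and "u \<in> M \<Longrightarrow> u * sc c \<in> M"
    and "u \<in> M \<Longrightarrow> 1 \<le> j \<Longrightarrow> j \<le> n \<Longrightarrow> u * z j \<in> M"
    and "u \<in> M \<Longrightarrow> 1 \<le> j \<Longrightarrow> j \<le> i \<Longrightarrow> j \<le> n \<Longrightarrow> u * x j \<in> M"
    and "u \<in> M \<Longrightarrow> 1 \<le> j \<Longrightarrow> j \<le> i \<Longrightarrow> j \<le> n \<Longrightarrow> u * y j \<in> M"
  using assms unfolding stable_def by blast+

lemma stable_D:
  assumes "stable M i" "d \<in> D j"
  shows "u \<in> M \<Longrightarrow> u * d \<in> M"
  using assms(2)
proof (induction arbitrary: u)
  case (D_mult a b)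
  then show ?case by (metis mult.assoc)
next
  case (D_add a b)
  then show ?case using stableD(2)[OF assms(1)] by (simp add: distrib_left)
qed (auto intro: stableD[OF assms(1)])

lemma stable_power:
  fixes t :: 'r
  assumes "\<And>u. u \<in> M \<Longrightarrow> u * t \<in> M"
  shows "u \<in> M \<Longrightarrow> u * t ^ k \<in> M"
proof (induction k arbitrary: u)
  case (Suc k)
  have "u * t * t ^ k \<in> M" by (intro Suc.IH assms Suc.prems)
  then show ?case by (simp add: mult.assoc)
qed simp

lemma stable_sum:
  assumes "stable M i" "\<And>a. a \<in> S \<Longrightarrow> f a \<in> M" shows "sum f S \<in> M"
  using assms(2) stableD(1,2)[OF assms(1)] J_zero
  by (induction S rule: infinite_finite_induct) auto

lemma stable_mono: "stable M i \<Longrightarrow> j \<le> i \<Longrightarrow> stable M j"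
  unfolding stable_def by (meson order_trans)

definition zer :: "'r set \<Rightarrow> 'r \<Rightarrow> bool"
  where "zer M d \<longleftrightarrow> (\<forall>u\<in>M. u * d \<in> J)"

text \<open>Equivalently, \<open>D i\<close> acts on the nonzero space M/J through a commutative
  domain, and without torsion over it.\<close>

definition ok :: "'r set \<Rightarrow> nat \<Rightarrow> bool"
  where "ok M i \<longleftrightarrow> stable M i \<and> \<not> M \<subseteq> J \<and>
    (\<forall>d\<in>D i. \<forall>u\<in>M. u * d \<in> J \<longrightarrow> u \<in> J \<or> zer M d)"

lemma okD: "ok M i \<Longrightarrow> d \<in> D i \<Longrightarrow> u \<in> M \<Longrightarrow> u * d \<in> J \<Longrightarrow> u \<notin> J \<Longrightarrow> zer M d"
  by (auto simp: ok_def)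

lemma sc_J:
  assumes "u * sc c \<in> J" "c \<noteq> 0" shows "u \<in> J"
proof -
  have "u * sc c * sc (inverse c) = u"
    using assms(2) by (simp add: mult.assoc sc_1 flip: sc_mult)
  then show ?thesis using J_rmult[OF assms(1), of "sc (inverse c)"] by simp
qed

text \<open>The descending induction can start here, since \<open>D (Suc n)\<close> consists of
  scalars, and a scalar is zero or invertible.\<close>

lemma ok_UNIV: "ok UNIV (Suc n)"
  unfolding ok_def
proof (intro conjI ballI impI)
  fix d u assume "d \<in> D (Suc n)" "u * d \<in> J"
  moreover then obtain c where c: "d = sc c" using D_last by blast
  ultimately show "u \<in> J \<or> zer UNIV d"
    using sc_J[of u c] J_zero by (cases "c = 0") (simp_all add: zer_def)
next
  show "\<not> UNIV \<subseteq> J" using one_J by blast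
qed (simp add: stable_def)

lemma J_rmult': "a * b \<in> J \<Longrightarrow> a * (b * c) \<in> J"
  using J_rmult[of "a * b" c] by (simp add: mult.assoc)

lemma zer_mult: "zer M a \<Longrightarrow> zer M (a * b)"
  unfolding zer_def by (blast intro: J_rmult')

lemma zer_add: "zer M a \<Longrightarrow> zer M b \<Longrightarrow> zer M (a + b)"
  by (simp add: zer_def distrib_left J_add)

lemma zer_cong: "a \<doteq> b \<Longrightarrow> zer M a \<longleftrightarrow> zer M b"
  unfolding zer_def using eq_J[OF eq_lmult] by blast

lemma zer_sum: "(\<And>k. k \<in> S \<Longrightarrow> zer M (f k)) \<Longrightarrow> zer M (sum f S)"
  by (induction S rule: infinite_finite_induct) (simp_all add: zer_add, simp_all add: zer_def J_zero)

lemma zer_ev: "(\<And>k. k < L \<Longrightarrow> zer M (g k)) \<Longrightarrow> zer M (ev i g L)"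
  unfolding ev_def by (intro zer_sum zer_mult) auto

text \<open>Some nonzero element of M/J is algebraic of degree d over the previous z's. Under
  \<open>ok M (Suc i)\<close> a leading coefficient that does not annihilate M acts injectively, so
  d is a genuine degree.\<close>

definition root_deg :: "'r set \<Rightarrow> nat \<Rightarrow> nat \<Rightarrow> bool"
  where "root_deg M i d \<longleftrightarrow> (\<exists>f u. (\<forall>k. f k \<in> D (Suc i)) \<and> \<not> zer M (f d) \<and>
    u \<in> M \<and> u \<notin> J \<and> u * ev i f (Suc d) \<in> J)"

text \<open>The top coefficient must annihilate M, since otherwise the polynomial would witness
  \<open>root_deg\<close> at its degree. It can then be dropped, and the argument repeats one degree
  lower.\<close>

lemma below_root_deg:
  assumes "\<And>d. d < L \<Longrightarrow> \<not> root_deg M i d"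
    and "\<And>k. g k \<in> D (Suc i)" "u \<in> M" "u \<notin> J" "u * ev i g L \<in> J"
  shows "k < L \<Longrightarrow> zer M (g k)"
  using assms(1,5)
proof (induction L arbitrary: k)
  case (Suc L)
  have z: "zer M (g L)"
    using Suc.prems assms(2-4) unfolding root_deg_def by blast
  then have "u * (g L * z i ^ L) \<in> J" using assms(3) by (intro J_rmult') (simp add: zer_def)
  then have "u * ev i g L \<in> J"
    using J_diff[OF Suc.prems(3), of "u * (g L * z i ^ L)"] by (simp add: ev_Suc distrib_left)
  then show ?case using Suc z by (cases "k = L") auto
qed simp

text \<open>A polynomial in z_i that kills a single nonzero element has only coefficients that
  annihilate M, and hence annihilates M itself.\<close>

lemma ok_transcendental:
  assumes "ok M (Suc i)" "1 \<le> i" "i \<le> n" "\<And>d. \<not> root_deg M i d"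
  shows "ok M i"
  unfolding ok_def
proof (intro conjI ballI impI)
  show "stable M i" using assms(1) stable_mono[of M "Suc i" i] by (auto simp: ok_def)
  show "\<not> M \<subseteq> J" using assms(1) by (auto simp: ok_def)
  fix d u assume d: "d \<in> D i" "u \<in> M" "u * d \<in> J"
  obtain g L where g: "\<forall>k. g k \<in> D (Suc i)" "d \<doteq> ev i g L"
    using D_PL[OF d(1) assms(2,3)] by (auto simp: PL_def)
  have "u * ev i g L \<in> J" using d(3) eq_J[OF eq_lmult[OF g(2)]] by simp
  then have "zer M d" if "u \<notin> J"
    unfolding zer_cong[OF g(2)] using below_root_deg[of L M i g u] assms(4) g(1) d(2) that
    by (intro zer_ev) auto
  then show "u \<in> J \<or> zer M d" by blast
qed

end

section \<open>The algebraic case: kernels of a polynomial and of its twists\<close>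

context skew begin

lemma zer_sc: "zer M (sc c * a) \<Longrightarrow> c \<noteq> 0 \<Longrightarrow> zer M a"
  unfolding zer_def using sc_J by (metis sc_comm mult.assoc)

lemma skew_power:
  assumes "a * b \<doteq> sc c * b * a"
  shows "a ^ l * b ^ k \<doteq> sc (c ^ (l * k)) * b ^ k * a ^ l"
proof -
  have 1: "a * b ^ k \<doteq> sc (c ^ k) * b ^ k * a" for k
  proof (induction k)
    case (Suc k)
    have e: "sc (c ^ Suc k) = sc (c ^ k) * sc c"
      by (simp add: sc_mult[symmetric] mult.commute)
    have "a * b ^ k * b \<doteq> sc (c ^ k) * b ^ k * a * b" by (rule eq_rmult[OF Suc])
    also have "sc (c ^ k) * b ^ k * a * b \<doteq> sc (c ^ k) * b ^ k * (sc c * b * a)"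
      using eq_lmult[OF assms, of "sc (c ^ k) * b ^ k"] by (simp add: mult.assoc)
    also have "sc (c ^ k) * b ^ k * (sc c * b * a) = sc (c ^ Suc k) * b ^ Suc k * a"
      by (simp only: e power_Suc2[of b] mult.assoc sc_left[of "b ^ k" c])
    finally show ?case by (simp only: power_Suc2[of b] mult.assoc)
  qed (simp add: sc_1)
  show ?thesis
  proof (induction l)
    case (Suc l)
    have e: "sc (c ^ (Suc l * k)) = sc (c ^ (l * k)) * sc (c ^ k)"
      by (simp add: sc_mult[symmetric] power_add mult.commute)
    have "a * (a ^ l * b ^ k) \<doteq> a * (sc (c ^ (l * k)) * b ^ k * a ^ l)" by (rule eq_lmult[OF Suc])
    also have "a * (sc (c ^ (l * k)) * b ^ k * a ^ l) = sc (c ^ (l * k)) * (a * b ^ k) * a ^ l"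
      by (simp add: mult.assoc sc_left[of a])
    also have "\<dots> \<doteq> sc (c ^ (l * k)) * (sc (c ^ k) * b ^ k * a) * a ^ l"
      by (intro eq_rmult eq_lmult 1)
    also have "\<dots> = sc (c ^ (Suc l * k)) * b ^ k * a ^ Suc l"
      by (simp only: e mult.assoc power_Suc)
    finally show ?case by (simp only: mult.assoc power_Suc)
  qed (simp add: sc_1)
qed

end

text \<open>Here z_i is algebraic and f has the least possible degree d. Leading coefficients cannot
  be inverted in \<open>D (Suc i)\<close>; minimality of d together with the injectivity of
  \<open>f d\<close> plays the part of a minimal polynomial over a field.\<close>

locale skew_alg = skew sc I J x y z p n
  for sc :: "'k::field \<Rightarrow> 'r::ring_1" and I J x y z p n +
  fixes M :: "'r set" and i d :: nat and f :: "nat \<Rightarrow> 'r"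
  assumes ok_M: "ok M (Suc i)" and i: "1 \<le> i" "i \<le> n"
    and f: "f k \<in> D (Suc i)" and f_d: "\<not> zer M (f d)"
    and root: "\<exists>u\<in>M. u \<notin> J \<and> u * ev i f (Suc d) \<in> J"
    and min_d: "e < d \<Longrightarrow> \<not> root_deg M i e"
begin

lemma M: "stable M (Suc i)"
  using ok_M by (simp add: ok_def)

definition F :: 'r where "F = ev i f (Suc d)"

definition ker :: "'r set" where "ker = {u \<in> M. u * F \<in> J}"

lemma ker_M: "u \<in> ker \<Longrightarrow> u \<in> M"
  by (simp add: ker_def)

lemma F_D: "F \<in> D i"
  unfolding F_def by (intro ev_D i f)

lemma min_coeffs:
  assumes "\<And>k. g k \<in> D (Suc i)" "u \<in> M" "u \<notin> J" "u * ev i g L \<in> J" "L \<le> d" "k < L"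
  shows "zer M (g k)"
  using below_root_deg[of L M i g u k] assms min_d by auto

lemma f_d_inj: "u \<in> M \<Longrightarrow> u * f d \<in> J \<Longrightarrow> u \<in> J"
  using okD[OF ok_M f] f_d by blast

lemma d_pos: "d > 0"
proof (rule ccontr)
  assume "\<not> d > 0"
  then show False using root f_d_inj by (auto simp: ev_def)
qed

lemma comm_J: "a * b \<doteq> b * a \<Longrightarrow> u * b \<in> J \<Longrightarrow> u * a * b \<in> J"
  using eq_J[OF eq_lmult[of "a * b" "b * a" u]] J_rmult[of "u * b" a] by (simp add: mult.assoc)

text \<open>Generators of index at most i commute with z_i, ..., z_n and hence with
  \<open>F\<close>. Those of index i + 1 do not, which is why stability drops from
  \<open>Suc i\<close> to i.\<close>

lemma ker_stable: "stable ker i"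
proof -
  have "u * t \<in> ker" if "u \<in> ker" "u * t \<in> M" "t * F \<doteq> F * t" for u t
    using that comm_J[of t F u] by (simp add: ker_def)
  note c = this
  show ?thesis
    unfolding stable_def
  proof (intro conjI ballI allI impI subsetI)
    fix u assume "u \<in> J"
    then show "u \<in> ker" using stableD(1)[OF M] J_rmult by (simp add: ker_def)
  next
    fix u v assume "u \<in> ker" "v \<in> ker"
    then show "u + v \<in> ker" using stableD(2)[OF M] J_add by (simp add: ker_def distrib_right)
  next
    fix u e assume u: "u \<in> ker"
    show "u * sc e \<in> ker" by (rule c[OF u stableD(3)[OF M ker_M[OF u]]]) (simp add: sc_comm)
  next
    fix u j assume u: "u \<in> ker" and j: "1 \<le> j \<and> j \<le> n"
    show "u * z j \<in> ker"
      by (rule c[OF u stableD(4)[OF M ker_M[OF u]]], use j in simp, use j in simp,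
          rule D_comm[OF D_z[of j] F_D]) (use j in auto)
  next
    fix u j assume u: "u \<in> ker" and j: "1 \<le> j \<and> j \<le> i \<and> j \<le> n"
    show "u * x j \<in> ker"
      by (rule c[OF u stableD(5)[OF M ker_M[OF u]]]) (use j in \<open>auto intro: eq_sym[OF D_x[OF F_D]]\<close>)
    show "u * y j \<in> ker"
      by (rule c[OF u stableD(6)[OF M ker_M[OF u]]]) (use j in \<open>auto intro: eq_sym[OF D_y[OF F_D]]\<close>)
  qed
qed

text \<open>Division with remainder by \<^term>\<open>F\<close>, after multiplication by its leading coefficient.\<close>

lemma ker_poly:
  assumes "\<And>k. g k \<in> D (Suc i)" "u \<in> ker" "u \<notin> J" "u * ev i g L \<in> J" "v \<in> ker"
  shows "v * ev i g L \<in> J"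
  using assms(1,4)
proof (induction L arbitrary: g)
  case 0
  then show ?case by (simp add: ev_def J_zero)
next
  case (Suc L)
  show ?case
  proof (cases "Suc L \<le> d")
    case True
    then have "zer M (ev i g (Suc L))"
      using min_coeffs[of g u "Suc L"] Suc.prems assms(2,3) by (intro zer_ev) (auto dest: ker_M)
    then show ?thesis using assms(5) by (auto simp: zer_def dest: ker_M)
  next
    case False
    then obtain e where L: "L = e + d" by (metis add.commute le_Suc_ex not_less_eq_eq)
    \<comment> \<open>\<open>?s\<close> holds the coefficients of g L * z_i^e * F. The coefficient
      of \<open>?g\<close> at L is a commutator of \<open>f d\<close> and \<open>g L\<close>, thus
      congruent but not equal to 0. So \<open>ev\<close> is cut off at L, and the commutation is
      used once, in the derivation of \<open>g\<close>.\<close>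
    let ?s = "\<lambda>k. if e \<le> k then g L * f (k - e) else 0"
    let ?g = "\<lambda>k. f d * g k - ?s k"
    let ?G = "ev i g (Suc L)"
    have "ev i ?s L = (\<Sum>k\<in>{e..<e + d}. g L * f (k - e) * z i ^ k)"
      unfolding ev_def L by (rule sum.mono_neutral_cong_right) auto
    also have "\<dots> = (\<Sum>k<d. g L * f k * z i ^ (k + e))"
      by (rule sum.reindex_bij_witness[of _ "\<lambda>k. k + e" "\<lambda>k. k - e"]) auto
    also have "\<dots> = g L * ev i f d * z i ^ e"
      by (simp add: ev_def sum_distrib_left sum_distrib_right mult.assoc power_add)
    finally have s: "ev i ?s L = g L * ev i f d * z i ^ e" .
    have "ev i ?g L = f d * ev i g L - ev i ?s L"
      by (simp add: ev_def left_diff_distrib sum_subtractf sum_distrib_left mult.assoc)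
    also have "\<dots> = f d * ?G - f d * g L * z i ^ L - g L * ev i f d * z i ^ e"
      unfolding s by (simp add: ev_Suc algebra_simps)
    also have "\<dots> \<doteq> f d * ?G - g L * f d * z i ^ L - g L * ev i f d * z i ^ e"
      by (intro eq_diff eq_refl eq_rmult D_comm[OF f Suc.prems(1)])
    also have "\<dots> = f d * ?G - g L * F * z i ^ e"
      by (simp add: F_def ev_Suc L power_add algebra_simps power_commutes)
    finally have g: "ev i ?g L \<doteq> f d * ?G - g L * F * z i ^ e" .
    have "?G \<in> D i" using Suc.prems(1) by (intro ev_D i)
    then have c: "f d * ?G \<doteq> ?G * f d" by (intro D_comm[OF f])
    have key: "w * ev i ?g L \<in> J \<longleftrightarrow> w * ?G * f d \<in> J" if "w \<in> ker" for w
    proof -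
      have "w * g L \<in> ker" by (rule stable_D[OF ker_stable Suc.prems(1) that])
      then have r: "w * g L * F * z i ^ e \<in> J" using J_rmult[of "w * g L * F"] by (simp add: ker_def)
      have "w * ev i ?g L \<in> J \<longleftrightarrow> w * (f d * ?G - g L * F * z i ^ e) \<in> J"
        by (rule eq_J[OF eq_lmult[OF g]])
      also have "\<dots> \<longleftrightarrow> w * (f d * ?G) \<in> J"
        using J_add[OF _ r, of "w * (f d * ?G - g L * F * z i ^ e)"] J_diff[OF _ r, of "w * (f d * ?G)"]
        by (auto simp: algebra_simps)
      also have "\<dots> \<longleftrightarrow> w * ?G * f d \<in> J"
        using eq_J[OF eq_lmult[OF c]] by (simp add: mult.assoc)
      finally show ?thesis .
    qed
    have "?g k \<in> D (Suc i)" for k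
      using f Suc.prems(1) by (auto intro!: D_diff D_mult D_0)
    then have "v * ev i ?g L \<in> J"
      using Suc.IH[of ?g] key[OF assms(2)] J_rmult[OF Suc.prems(2)] by blast
    then have "v * ?G * f d \<in> J" using key[OF assms(5)] by blast
    moreover have "v * ?G \<in> M" by (rule stable_D[OF M \<open>?G \<in> D i\<close> ker_M[OF assms(5)]])
    ultimately show ?thesis by (rule f_d_inj[rotated])
  qed
qed

lemma ok_ker: "ok ker i"
  unfolding ok_def
proof (intro conjI ballI impI)
  show "stable ker i" by (rule ker_stable)
  show "\<not> ker \<subseteq> J" using root by (auto simp: ker_def F_def)
  fix e u assume e: "e \<in> D i" "u \<in> ker" "u * e \<in> J"
  obtain g L where g: "\<forall>k. g k \<in> D (Suc i)" "e \<doteq> ev i g L"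
    using D_PL[OF e(1) i] by (auto simp: PL_def)
  have "u * ev i g L \<in> J" using e(3) eq_J[OF eq_lmult[OF g(2)]] by simp
  then have "zer ker e" if "u \<notin> J"
    unfolding zer_cong[OF g(2)] using ker_poly[OF _ e(2) that] g(1) by (auto simp: zer_def)
  then show "u \<in> J \<or> zer ker e" by blast
qed

text \<open>This is \<open>F\<close> with z_i replaced by \<mu>^l z_i.\<close>

definition Ft :: "'k \<Rightarrow> nat \<Rightarrow> 'r"
  where "Ft \<mu> l = ev i (\<lambda>k. sc (\<mu> ^ (l * k)) * f k) (Suc d)"

lemma Ft_D: "Ft \<mu> l \<in> D i"
  unfolding Ft_def by (intro ev_D i D_mult D_sc f)

text \<open>
  If \<open>v\<close> were a common root of two twists of \<^term>\<open>F\<close>, then eliminating the leading terms would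
  give a polynomial of smaller degree, so that the constant coefficient of \<^term>\<open>F\<close> vanishes and
  \<^term>\<open>F\<close> is divisible by \<^term>\<open>z i\<close>.
\<close>

lemma Ft_disjoint:
  assumes \<mu>: "\<mu> \<noteq> 0" "\<And>k. k > 0 \<Longrightarrow> \<mu> ^ k \<noteq> 1"
    and v: "v \<in> M" "l < l'" "v * Ft \<mu> l \<in> J" "v * Ft \<mu> l' \<in> J"
  shows "v \<in> J"
proof (rule ccontr)
  assume nv: "v \<notin> J"
  let ?c = "\<mu> ^ ((l' - l) * d)"
  let ?g = "\<lambda>k. sc (\<mu> ^ (l' * k)) * f k - sc ?c * (sc (\<mu> ^ (l * k)) * f k)"
  have "l' * d = (l' - l) * d + l * d" using v(2) by (simp add: diff_mult_distrib)
  then have "?g d = 0" by (simp add: power_add sc_mult mult.assoc)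
  then have "ev i ?g d = ev i ?g (Suc d)" by (simp add: ev_Suc)
  also have "\<dots> = Ft \<mu> l' - sc ?c * Ft \<mu> l"
    by (simp only: Ft_def ev_def left_diff_distrib sum_subtractf sum_distrib_left mult.assoc)
  finally have "v * ev i ?g d = v * Ft \<mu> l' - v * Ft \<mu> l * sc ?c"
    by (simp add: right_diff_distrib mult.assoc sc_comm[of ?c "Ft \<mu> l"])
  then have vg: "v * ev i ?g d \<in> J" using v(3,4) J_diff J_rmult by simp
  have gD: "?g k \<in> D (Suc i)" for k by (intro D_diff D_mult D_sc f)
  have "zer M (?g 0)" by (rule min_coeffs[OF gD v(1) nv vg order_refl d_pos])
  then have "zer M (sc (1 - ?c) * f 0)" by (simp add: sc_diff sc_1 left_diff_distrib)
  then have "zer M (f 0)" by (rule zer_sc) (use \<mu>(2)[of "(l' - l) * d"] v(2) d_pos in simp)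
  then have vf: "v * f 0 \<in> J" using v(1) by (simp add: zer_def)
  let ?h = "\<lambda>k. sc (\<mu> ^ (l * Suc k)) * f (Suc k)"
  have "Ft \<mu> l = f 0 + ev i ?h d * z i"
    unfolding Ft_def ev_def sum.lessThan_Suc_shift
    by (simp add: sum_distrib_right mult.assoc power_commutes sc_1)
  then have "v * ev i ?h d * z i \<in> J"
    using J_diff[OF v(3) vf] by (simp add: distrib_left mult.assoc)
  \<comment> \<open>After cancelling z_i, v is killed by a polynomial of degree d - 1 whose top
    coefficient is still a nonzero multiple of \<open>f d\<close>. This contradicts the minimality
    of d.\<close>
  then have "v * ev i ?h d \<in> J" by (rule z_inj[OF i])
  moreover have "?h k \<in> D (Suc i)" for k by (intro D_mult D_sc f)
  ultimately have "zer M (?h (d - 1))" using d_pos by (intro min_coeffs[OF _ v(1) nv]) auto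
  then have "zer M (f d)" using d_pos zer_sc[of M "\<mu> ^ (l * d)" "f d"] \<mu>(1) by simp
  then show False using f_d by blast
qed

text \<open>The argument is that for eigenvectors of distinct eigenvalues. Multiplying by
  \<open>Ft \<mu> L\<close> kills the last summand and preserves the kernels of the other twists. By
  induction each remaining v l is then killed by two different twists, hence zero modulo J.\<close>

lemma Ft_independent:
  assumes \<mu>: "\<mu> \<noteq> 0" "\<And>k. k > 0 \<Longrightarrow> \<mu> ^ k \<noteq> 1"
    and "\<And>l. l < L \<Longrightarrow> v l \<in> M" "\<And>l. l < L \<Longrightarrow> v l * Ft \<mu> l \<in> J" "(\<Sum>l<L. v l) \<in> J" "l < L"
  shows "v l \<in> J"
  using assms(3-6)
proof (induction L arbitrary: v l)
  case (Suc L)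
  let ?w = "\<lambda>l. v l * Ft \<mu> L"
  have "(\<Sum>l<L. ?w l) = (\<Sum>l<Suc L. v l) * Ft \<mu> L - ?w L"
    by (simp add: sum_distrib_right distrib_right)
  then have s: "(\<Sum>l<L. ?w l) \<in> J" using Suc.prems by (auto intro: J_diff J_rmult)
  have w: "?w l \<in> M" if "l < L" for l
    using that by (intro stable_D[OF M Ft_D] Suc.prems) auto
  have w': "?w l * Ft \<mu> l \<in> J" if "l < L" for l
    using that Suc.prems by (intro comm_J D_comm[OF Ft_D Ft_D]) auto
  have J: "v l \<in> J" if "l < L" for l
    using Ft_disjoint[OF \<mu>, of "v l" l L] Suc.prems Suc.IH[of ?w, OF w w' s that] that by auto
  then have "(\<Sum>l<L. v l) \<in> J" by (intro J_sum) auto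
  then have "v L \<in> J" using J_diff[OF Suc.prems(3), of "\<Sum>l<L. v l"] by simp
  then show ?case using J Suc.prems(4) by (cases "l = L") auto
qed simp

text \<open>Passing t^l across z_i multiplies z_i by \<rho>^l. The twist by \<rho>^-l undoes this,
  so t^l times the twisted polynomial is congruent to \<open>F\<close> * t^l.\<close>

lemma ker_shift:
  assumes "t * z i \<doteq> sc \<rho> * z i * t" "\<rho> \<noteq> 0" "\<And>e. e \<in> D (Suc i) \<Longrightarrow> e * t \<doteq> t * e" "u \<in> ker"
  shows "u * t ^ l * Ft (inverse \<rho>) l \<in> J"
proof -
  let ?\<mu> = "inverse \<rho>"
  have c: "e * t ^ l \<doteq> t ^ l * e" if "e \<in> D (Suc i)" for e
    using comm_power[of t e l] assms(3)[OF that] eq_sym by blast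
  have sw: "t ^ l * (sc (?\<mu> ^ (l * k)) * z i ^ k) \<doteq> z i ^ k * t ^ l" for k
  proof -
    have "t ^ l * (sc (?\<mu> ^ (l * k)) * z i ^ k) = sc (?\<mu> ^ (l * k)) * (t ^ l * z i ^ k)"
      by (rule sc_left)
    also have "\<dots> \<doteq> sc (?\<mu> ^ (l * k)) * (sc (\<rho> ^ (l * k)) * z i ^ k * t ^ l)"
      by (intro eq_lmult skew_power assms)
    also have "\<dots> = sc (?\<mu> ^ (l * k) * \<rho> ^ (l * k)) * (z i ^ k * t ^ l)"
      by (simp only: sc_mult mult.assoc)
    also have "\<dots> = z i ^ k * t ^ l"
      using assms(2) by (simp add: sc_1 flip: power_mult_distrib)
    finally show ?thesis .
  qed
  have "t ^ l * Ft ?\<mu> l = (\<Sum>k<Suc d. t ^ l * (sc (?\<mu> ^ (l * k)) * f k * z i ^ k))"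
    by (simp only: Ft_def ev_def sum_distrib_left)
  also have "\<dots> \<doteq> (\<Sum>k<Suc d. f k * z i ^ k * t ^ l)"
  proof (rule eq_sum)
    fix k
    have "t ^ l * (sc (?\<mu> ^ (l * k)) * f k * z i ^ k) = t ^ l * f k * (sc (?\<mu> ^ (l * k)) * z i ^ k)"
      by (simp add: mult.assoc sc_left[of "f k"])
    also have "\<dots> \<doteq> f k * t ^ l * (sc (?\<mu> ^ (l * k)) * z i ^ k)"
      by (intro eq_rmult eq_sym[OF c[OF f]])
    also have "\<dots> \<doteq> f k * (z i ^ k * t ^ l)"
      using eq_lmult[OF sw] by (simp add: mult.assoc)
    finally show "t ^ l * (sc (?\<mu> ^ (l * k)) * f k * z i ^ k) \<doteq> f k * z i ^ k * t ^ l"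
      by (simp add: mult.assoc)
  qed
  also have "\<dots> = F * t ^ l" by (simp only: F_def ev_def sum_distrib_right)
  finally have "u * (t ^ l * Ft ?\<mu> l) \<doteq> u * (F * t ^ l)" by (rule eq_lmult)
  moreover have "u * (F * t ^ l) \<in> J" using assms(4) J_rmult' by (simp add: ker_def)
  ultimately show ?thesis using eq_J by (simp add: mult.assoc)
qed

text \<open>If u t^(l+1) vanishes, so does u t^l t t', where t t' is z_{i+1} - \<alpha> z_i up to a
  scalar. Moving this factor to the left of t^l turns \<alpha> into \<alpha> \<rho>^l; it is
  injective on \<open>ker\<close> by assumption, so the exponent drops by one.\<close>

lemma ker_inj:
  assumes "t * z i \<doteq> sc \<rho> * z i * t" "t * z (Suc i) \<doteq> z (Suc i) * t"
    and "sc \<kappa> * t * t' \<doteq> z (Suc i) - sc \<alpha> * z i" "Suc i \<le> n"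
    and "\<And>u l. u \<in> ker \<Longrightarrow> u * (z (Suc i) - sc (\<alpha> * \<rho> ^ l) * z i) \<in> J \<Longrightarrow> u \<in> J"
    and "u \<in> ker" "u * t ^ l \<in> J"
  shows "u \<in> J"
  using assms(6,7)
proof (induction l arbitrary: u)
  case (Suc l)
  let ?e = "z (Suc i) - sc (\<alpha> * \<rho> ^ l) * z i"
  have "u * t ^ l * (sc \<kappa> * t * t') = u * t ^ Suc l * t' * sc \<kappa>"
    by (simp only: mult.assoc sc_comm[of \<kappa> "t * t'"] power_Suc2)
  then have "u * t ^ l * (sc \<kappa> * t * t') \<in> J" using Suc.prems(2) J_rmult by simp
  then have 1: "u * t ^ l * (z (Suc i) - sc \<alpha> * z i) \<in> J" using eq_J[OF eq_lmult[OF assms(3)]] by blast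
  have "t ^ l * (z (Suc i) - sc \<alpha> * z i) = t ^ l * z (Suc i) - sc \<alpha> * (t ^ l * z i ^ 1)"
    by (simp add: right_diff_distrib sc_left[of "t ^ l"])
  also have "\<dots> \<doteq> z (Suc i) * t ^ l - sc \<alpha> * (sc (\<rho> ^ (l * 1)) * z i ^ 1 * t ^ l)"
    by (intro eq_diff eq_lmult skew_power comm_power assms)
  also have "\<dots> = ?e * t ^ l" by (simp add: left_diff_distrib sc_mult mult.assoc)
  finally have "u * (t ^ l * (z (Suc i) - sc \<alpha> * z i)) \<doteq> u * (?e * t ^ l)" by (rule eq_lmult)
  then have "u * ?e * t ^ l \<in> J" using 1 eq_J by (simp add: mult.assoc)
  moreover have "?e \<in> D i" using i assms(4) by (auto intro!: D_diff D_mult D_sc D_z)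
  then have "u * ?e \<in> ker" by (rule stable_D[OF ker_stable _ Suc.prems(1)])
  ultimately have "u * ?e \<in> J" by (rule Suc.IH[rotated])
  then show ?case by (rule assms(5)[OF Suc.prems(1)])
qed simp

text \<open>By \<open>ker_inj\<close>, x can fail only if some z_{i+1} - p^k z_i with k > 0 kills a
  nonzero element of \<open>ker\<close>, and y only if this happens for some k \<le> 0. The two
  cases exclude each other, so y is taken precisely when x is obstructed.\<close>

lemma ker_step:
  assumes "Suc i \<le> n"
  obtains t where "t = x (Suc i) \<or> t = y (Suc i)"
    "\<And>u l. u \<in> ker \<Longrightarrow> u * t ^ l \<in> J \<Longrightarrow> u \<in> J"
    "\<And>u L l. \<lbrakk>\<And>l. l < L \<Longrightarrow> u l \<in> ker; (\<Sum>l<L. u l * t ^ l) \<in> J; l < L\<rbrakk> \<Longrightarrow> u l \<in> J"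
proof -
  let ?p = "p (Suc i)"
  have p: "?p \<noteq> 0" "\<And>k. k > 0 \<Longrightarrow> ?p ^ k \<noteq> 1"
    using p_nz[of "Suc i"] p_pow[of "Suc i"] assms by auto
  have p': "inverse ?p \<noteq> 0" "\<And>k. k > 0 \<Longrightarrow> inverse ?p ^ k \<noteq> 1"
    using p by (auto simp: power_inverse)
  have x: "x (Suc i) * z i \<doteq> sc ?p * z i * x (Suc i)"
    and y: "y (Suc i) * z i \<doteq> sc (inverse ?p) * z i * y (Suc i)"
    and xx: "x (Suc i) * z (Suc i) \<doteq> z (Suc i) * x (Suc i)"
    and yy: "y (Suc i) * z (Suc i) \<doteq> z (Suc i) * y (Suc i)"
    and xy: "sc (1 - ?p) * x (Suc i) * y (Suc i) \<doteq> z (Suc i) - sc ?p * z i"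
    and yx: "sc (1 - ?p) * y (Suc i) * x (Suc i) \<doteq> z (Suc i) - sc 1 * z i"
    using xz'[of i "Suc i"] yz'[of i "Suc i"] xz[of "Suc i" "Suc i"] yz[of "Suc i" "Suc i"]
      xy[of "Suc i"] yx[of "Suc i"] i assms by (simp_all add: eqI_def sc_1)
  have indep: "u l \<in> J"
    if t: "t = x (Suc i) \<or> t = y (Suc i)" "t * z i \<doteq> sc \<rho> * z i * t"
      and \<rho>: "\<rho> \<noteq> 0" "inverse \<rho> \<noteq> 0" "\<And>k. k > 0 \<Longrightarrow> inverse \<rho> ^ k \<noteq> 1"
      and inj: "\<And>u l. u \<in> ker \<Longrightarrow> u * t ^ l \<in> J \<Longrightarrow> u \<in> J"
      and u: "\<And>l. l < L \<Longrightarrow> u l \<in> ker" "(\<Sum>l<L. u l * t ^ l) \<in> J" "l < L" for t \<rho> u L l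
  proof -
    have "v * t \<in> M" if "v \<in> M" for v
      using t(1) stableD(5,6)[OF M that, of "Suc i"] assms by auto
    then have "u l * t ^ l \<in> M" if "l < L" for l
      using stable_power[of M t] ker_M[OF u(1)[OF that]] by blast
    moreover have "e * t \<doteq> t * e" if "e \<in> D (Suc i)" for e
      using t(1) D_x[OF that, of "Suc i"] D_y[OF that, of "Suc i"] by auto
    then have "u l * t ^ l * Ft (inverse \<rho>) l \<in> J" if "l < L" for l
      using ker_shift[OF t(2) \<rho>(1) _ u(1)[OF that]] by blast
    ultimately have "u l * t ^ l \<in> J"
      using Ft_independent[OF \<rho>(2,3), of L "\<lambda>l. u l * t ^ l"] u by blast
    then show ?thesis by (rule inj[OF u(1)[OF u(3)]])
  qed
  show ?thesis
  proof (cases "\<exists>u l. u \<in> ker \<and> u \<notin> J \<and> u * (z (Suc i) - sc (?p * ?p ^ l) * z i) \<in> J")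
    case False
    then have "\<And>u l. u \<in> ker \<Longrightarrow> u * x (Suc i) ^ l \<in> J \<Longrightarrow> u \<in> J"
      using ker_inj[OF x xx xy assms] by blast
    then show ?thesis
      using that[of "x (Suc i)"] indep[of "x (Suc i)" ?p] x p p' by blast
  next
    case True
    then obtain u l where u: "u \<in> ker" "u \<notin> J" "u * (z (Suc i) - sc (?p * ?p ^ l) * z i) \<in> J"
      by blast
    have e: "z (Suc i) - sc c * z i \<in> D i" for c
      using i assms by (auto intro!: D_diff D_mult D_sc D_z)
    \<comment> \<open>By \<open>ok_ker\<close> an obstruction to y annihilates all of
      \<open>ker\<close>, in particular the element u that obstructs x. The difference of the two
      factors is a multiple of z_i, which is injective; so the two powers of p agree, and p is a
      root of unity.\<close>
    have "v \<in> J" if v: "v \<in> ker" "v * (z (Suc i) - sc (1 * inverse ?p ^ m) * z i) \<in> J" for v m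
    proof (rule ccontr)
      assume "v \<notin> J"
      then have "zer ker (z (Suc i) - sc (inverse ?p ^ m) * z i)"
        using okD[OF ok_ker e v(1)] v(2) by simp
      then have "u * (z (Suc i) - sc (inverse ?p ^ m) * z i) \<in> J" using u(1) by (simp add: zer_def)
      then have "u * (z (Suc i) - sc (inverse ?p ^ m) * z i)
          - u * (z (Suc i) - sc (?p * ?p ^ l) * z i) \<in> J"
        using u(3) by (rule J_diff)
      also have "u * (z (Suc i) - sc (inverse ?p ^ m) * z i) - u * (z (Suc i) - sc (?p * ?p ^ l) * z i)
          = u * sc (?p ^ Suc l - inverse ?p ^ m) * z i"
        by (simp add: sc_diff algebra_simps)
      finally have "u * sc (?p ^ Suc l - inverse ?p ^ m) \<in> J" by (rule z_inj[OF i])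
      moreover have "?p ^ Suc l - inverse ?p ^ m \<noteq> 0"
      proof
        assume "?p ^ Suc l - inverse ?p ^ m = 0"
        then have "?p ^ m * ?p ^ Suc l = ?p ^ m * inverse ?p ^ m" by simp
        also have "\<dots> = 1" using p(1) by (simp add: power_mult_distrib[symmetric])
        finally have "?p ^ (m + Suc l) = 1" by (simp only: power_add)
        then show False using p(2)[of "m + Suc l"] by simp
      qed
      ultimately show False using sc_J u(2) by blast
    qed
    then have "\<And>u l. u \<in> ker \<Longrightarrow> u * y (Suc i) ^ l \<in> J \<Longrightarrow> u \<in> J"
      using ker_inj[OF y yy yx assms] by blast
    then show ?thesis
      using that[of "y (Suc i)"] y p p' indep[of "y (Suc i)" "inverse ?p", unfolded inverse_inverse_eq]
      by blast
  qed
qed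

end

section \<open>Induction over the normal elements\<close>

context skew begin

lemma obtain_alg:
  assumes "ok M (Suc i)" "1 \<le> i" "i \<le> n" "root_deg M i d"
  obtains f e where "skew_alg sc I J x y z p n M i e f"
proof -
  define e where "e = (LEAST e. root_deg M i e)"
  have "root_deg M i e" unfolding e_def using assms(4) by (rule LeastI)
  then obtain f where f: "\<forall>k. f k \<in> D (Suc i)" "\<not> zer M (f e)"
    "\<exists>u\<in>M. u \<notin> J \<and> u * ev i f (Suc e) \<in> J"
    unfolding root_deg_def by blast
  have "\<not> root_deg M i e'" if "e' < e" for e'
    using that unfolding e_def by (rule not_less_Least)
  then have "skew_alg sc I J x y z p n M i e f"
    using f assms by unfold_locales auto
  then show ?thesis by (rule that)
qed

lemma z_power_inj: "1 \<le> i \<Longrightarrow> i \<le> n \<Longrightarrow> u * z i ^ k \<in> J \<Longrightarrow> u \<in> J"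
proof (induction k)
  case (Suc k)
  then have "u * z i ^ k * z i \<in> J" by (simp add: mult.assoc power_commutes)
  then show ?case using z_inj Suc by blast
qed simp

definition xyz :: "'r set"
  where "xyz = x ` {1..n} \<union> y ` {1..n} \<union> z ` {1..n}"

text \<open>Coefficients from \<open>D (Suc N)\<close> instead of scalars make the induction work:
  in the transcendental case a polynomial in the new z_i becomes a coefficient for the induction
  hypothesis. Such a coefficient may act as zero without being zero, so the conclusion is that each
  summand, not each coefficient, vanishes.\<close>

lemma independent_family:
  assumes "ok M (Suc N)" "Suc N \<le> n"
  shows "\<exists>m ts. length ts = N \<and> set ts \<subseteq> xyz \<and>
    (\<forall>a. length a = N \<longrightarrow> m * wmono ts a \<in> M \<and> m * wmono ts a \<notin> J) \<and>
    (\<forall>s c. (\<forall>a. c a \<in> D (Suc N)) \<longrightarrow> (\<Sum>a\<in>box N s. m * wmono ts a * c a) \<in> J \<longrightarrow>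
      (\<forall>a\<in>box N s. m * wmono ts a * c a \<in> J))"
  using assms
proof (induction N arbitrary: M)
  case 0
  then obtain m where "m \<in> M" "m \<notin> J" by (auto simp: ok_def)
  then show ?case by (intro exI[of _ m] exI[of _ "[]"]) auto
next
  case (Suc N)
  let ?i = "Suc N"
  have i: "1 \<le> ?i" "?i \<le> n" using Suc.prems by auto
  have M: "stable M (Suc ?i)" using Suc.prems by (simp add: ok_def)
  have snoc: "\<exists>b k. a = b @ [k] \<and> length b = N" if "length a = Suc N" for a :: "nat list"
    using that by (metis length_Suc_conv_rev)
  show ?case
  proof (cases "\<exists>d. root_deg M ?i d")
    case False
    then have "ok M ?i" using ok_transcendental[OF Suc.prems(1) i] by blast
    then obtain m ts where IH: "length ts = N" "set ts \<subseteq> xyz"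
      "\<And>a. length a = N \<Longrightarrow> m * wmono ts a \<in> M" "\<And>a. length a = N \<Longrightarrow> m * wmono ts a \<notin> J"
      "\<And>s c a. \<lbrakk>\<And>a. c a \<in> D ?i; (\<Sum>a\<in>box N s. m * wmono ts a * c a) \<in> J; a \<in> box N s\<rbrakk>
        \<Longrightarrow> m * wmono ts a * c a \<in> J"
      using Suc.IH[of M] i(2) by blast
    let ?E = "\<lambda>a. m * wmono ts a"
    have E: "m * wmono (ts @ [z ?i]) (b @ [k]) = ?E b * z ?i ^ k" if "length b = N" for b k
      using that IH(1) by (simp add: wmono_snoc mult.assoc)
    have EM: "?E b * z ?i ^ k \<in> M" "?E b * z ?i ^ k \<notin> J" if "length b = N" for b k
      using that IH(3,4) stable_power[of M "z ?i", OF stableD(4)[OF M _ i]] z_power_inj[OF i]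
      by blast+
    show ?thesis
    proof (intro exI[of _ m] exI[of _ "ts @ [z ?i]"] conjI allI impI ballI)
      show "length (ts @ [z ?i]) = Suc N" "set (ts @ [z ?i]) \<subseteq> xyz"
        using IH(1,2) i by (auto simp: xyz_def)
    next
      fix a :: "nat list" assume "length a = Suc N"
      then show "m * wmono (ts @ [z ?i]) a \<in> M" "m * wmono (ts @ [z ?i]) a \<notin> J"
        using snoc[of a] E EM by auto
    next
      fix s :: nat and c :: "nat list \<Rightarrow> 'r" and a
      assume c: "\<forall>a. c a \<in> D (Suc ?i)" and a: "a \<in> box (Suc N) s"
        and S: "(\<Sum>a\<in>box (Suc N) s. m * wmono (ts @ [z ?i]) a * c a) \<in> J"
      have sw: "u * z ?i ^ k * c b \<doteq> u * (c b * z ?i ^ k)" for u b k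
        using eq_lmult[OF D_comm[OF D_power[OF D_z] c[rule_format]], of ?i ?i u k b] i
        by (simp add: mult.assoc)
      have "(\<Sum>a\<in>box (Suc N) s. m * wmono (ts @ [z ?i]) a * c a)
          = (\<Sum>k<s. \<Sum>b\<in>box N s. ?E b * z ?i ^ k * c (b @ [k]))"
        unfolding sum_box_Suc by (intro sum.cong refl) (simp add: E box_def)
      also have "\<dots> \<doteq> (\<Sum>k<s. \<Sum>b\<in>box N s. ?E b * (c (b @ [k]) * z ?i ^ k))"
        by (intro eq_sum sw)
      also have "\<dots> = (\<Sum>b\<in>box N s. ?E b * ev ?i (\<lambda>k. c (b @ [k])) s)"
        by (subst sum.swap) (simp add: ev_def sum_distrib_left)
      finally have S': "(\<Sum>b\<in>box N s. ?E b * ev ?i (\<lambda>k. c (b @ [k])) s) \<in> J" using S eq_J by blast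
      obtain b k where b: "a = b @ [k]" "length b = N" using snoc[of a] a by (auto simp: box_def)
      then have bk: "b \<in> box N s" "k < s" using a by (auto simp: box_def)
      have "?E b * ev ?i (\<lambda>k. c (b @ [k])) s \<in> J"
        by (rule IH(5)[OF _ S' bk(1)]) (use c i in \<open>auto intro: ev_D\<close>)
      \<comment> \<open>The induction hypothesis shows that the polynomial in z_i with coefficients
        c (b @ [k]) kills the nonzero element \<open>?E b\<close>; as z_i is transcendental, all of
        these coefficients annihilate M.\<close>
      then have "zer M (c (b @ [k]))"
        using below_root_deg[of s M ?i "\<lambda>k. c (b @ [k])" "?E b" k] False c IH(3,4) b(2) bk(2) by blast
      then show "m * wmono (ts @ [z ?i]) a * c a \<in> J"
        unfolding b(1) E[OF b(2)] using EM(1)[OF b(2)] by (simp add: zer_def)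
    qed
  next
    case True
    then obtain f d where "skew_alg sc I J x y z p n M ?i d f"
      using obtain_alg[OF Suc.prems(1) i] by blast
    then interpret skew_alg sc I J x y z p n M ?i d f .
    obtain m ts where IH: "length ts = N" "set ts \<subseteq> xyz"
      "\<And>a. length a = N \<Longrightarrow> m * wmono ts a \<in> ker" "\<And>a. length a = N \<Longrightarrow> m * wmono ts a \<notin> J"
      "\<And>s c a. \<lbrakk>\<And>a. c a \<in> D ?i; (\<Sum>a\<in>box N s. m * wmono ts a * c a) \<in> J; a \<in> box N s\<rbrakk>
        \<Longrightarrow> m * wmono ts a * c a \<in> J"
      using Suc.IH[of ker] ok_ker i(2) by blast
    obtain t where t: "t = x (Suc ?i) \<or> t = y (Suc ?i)"
      "\<And>u l. u \<in> ker \<Longrightarrow> u * t ^ l \<in> J \<Longrightarrow> u \<in> J"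
      "\<And>u L l. \<lbrakk>\<And>l. l < L \<Longrightarrow> u l \<in> ker; (\<Sum>l<L. u l * t ^ l) \<in> J; l < L\<rbrakk> \<Longrightarrow> u l \<in> J"
      using ker_step[OF Suc.prems(2)] by blast
    let ?E = "\<lambda>a. m * wmono ts a"
    have E: "m * wmono (ts @ [t]) (b @ [k]) = ?E b * t ^ k" if "length b = N" for b k
      using that IH(1) by (simp add: wmono_snoc mult.assoc)
    \<comment> \<open>Multiplication by t may lead out of \<open>ker\<close>, but not out of M,
      which is stable up to the index of t.\<close>
    have "v * t \<in> M" if "v \<in> M" for v
      using t(1) stableD(5,6)[OF M that, of "Suc ?i"] Suc.prems(2) by auto
    then have EM: "?E b * t ^ k \<in> M" "?E b * t ^ k \<notin> J" if "length b = N" for b k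
      using that IH(3,4) stable_power[of M t] ker_M t(2) by blast+
    show ?thesis
    proof (intro exI[of _ m] exI[of _ "ts @ [t]"] conjI allI impI ballI)
      show "length (ts @ [t]) = Suc N" "set (ts @ [t]) \<subseteq> xyz"
        using IH(1,2) t(1) Suc.prems(2) by (auto simp: xyz_def)
    next
      fix a :: "nat list" assume "length a = Suc N"
      then show "m * wmono (ts @ [t]) a \<in> M" "m * wmono (ts @ [t]) a \<notin> J"
        using snoc[of a] E EM by auto
    next
      fix s :: nat and c :: "nat list \<Rightarrow> 'r" and a
      assume c: "\<forall>a. c a \<in> D (Suc ?i)" and a: "a \<in> box (Suc N) s"
        and S: "(\<Sum>a\<in>box (Suc N) s. m * wmono (ts @ [t]) a * c a) \<in> J"
      have "c b * t \<doteq> t * c b" for b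
        using t(1) D_x[OF c[rule_format], of "Suc ?i"] D_y[OF c[rule_format], of "Suc ?i"] by auto
      then have sw: "u * t ^ k * c b \<doteq> u * c b * t ^ k" for u b k
        using eq_lmult[OF comm_power[OF eq_sym], of "c b" t u k] by (simp add: mult.assoc)
      have "(\<Sum>a\<in>box (Suc N) s. m * wmono (ts @ [t]) a * c a)
          = (\<Sum>k<s. \<Sum>b\<in>box N s. ?E b * t ^ k * c (b @ [k]))"
        unfolding sum_box_Suc by (intro sum.cong refl) (simp add: E box_def)
      also have "\<dots> \<doteq> (\<Sum>k<s. \<Sum>b\<in>box N s. ?E b * c (b @ [k]) * t ^ k)"
        by (intro eq_sum sw)
      also have "\<dots> = (\<Sum>k<s. (\<Sum>b\<in>box N s. ?E b * c (b @ [k])) * t ^ k)"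
        by (simp only: sum_distrib_right)
      finally have S': "(\<Sum>k<s. (\<Sum>b\<in>box N s. ?E b * c (b @ [k])) * t ^ k) \<in> J" using S eq_J by blast
      obtain b k where b: "a = b @ [k]" "length b = N" using snoc[of a] a by (auto simp: box_def)
      then have bk: "b \<in> box N s" "k < s" using a by (auto simp: box_def)
      have cD: "c b \<in> D ?i" for b using c D_mono[of _ "Suc ?i" ?i] by auto
      \<comment> \<open>The independence of the powers of t holds for coefficients in
        \<open>ker\<close>. The inner sums qualify because \<open>ker\<close> is stable under all
        z's.\<close>
      have "(\<Sum>b\<in>box N s. ?E b * c (b @ [l])) \<in> ker" for l
        by (intro stable_sum[OF ker_stable] stable_D[OF ker_stable cD] IH(3)) (simp add: box_def)
      then have "(\<Sum>b\<in>box N s. ?E b * c (b @ [k])) \<in> J"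
        using t(3)[of s "\<lambda>k. \<Sum>b\<in>box N s. ?E b * c (b @ [k])" k] S' bk(2) by blast
      then have "?E b * c (b @ [k]) \<in> J"
        using IH(5)[of "\<lambda>b. c (b @ [k])", OF cD _ bk(1)] by blast
      then have "?E b * c (b @ [k]) * t ^ k \<in> J" by (rule J_rmult)
      then show "m * wmono (ts @ [t]) a * c a \<in> J"
        unfolding b(1) E[OF b(2)] using eq_J[OF sw] by blast
    qed
  qed
qed

text \<open>The element z_n is treated first and without gaining a parameter, since no generators of
  index n + 1 exist. The remaining z_{n-1}, ..., z_1 give one parameter each.\<close>

theorem linearly_independent_family:
  assumes "1 \<le> n"
  obtains m ts where "length ts = n - 1" "set ts \<subseteq> xyz"
    "\<And>s c a. \<lbrakk>(\<Sum>a\<in>box (n - 1) s. m * wmono ts a * sc (c a)) \<in> J; a \<in> box (n - 1) s\<rbrakk> \<Longrightarrow> c a = 0"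
proof -
  have "\<exists>M. ok M n"
  proof (cases "\<exists>d. root_deg UNIV n d")
    case True
    then obtain f d where "skew_alg sc I J x y z p n UNIV n d f"
      using obtain_alg[OF ok_UNIV assms] by blast
    then interpret skew_alg sc I J x y z p n UNIV n d f .
    show ?thesis using ok_ker by blast
  next
    case False
    then show ?thesis using ok_transcendental[OF ok_UNIV assms] by blast
  qed
  then obtain M where M: "ok M (Suc (n - 1))" using assms by auto
  then obtain m ts where *: "length ts = n - 1" "set ts \<subseteq> xyz"
    "\<And>a. length a = n - 1 \<Longrightarrow> m * wmono ts a \<notin> J"
    "\<And>s c a. \<lbrakk>\<And>a. c a \<in> D (Suc (n - 1)); (\<Sum>a\<in>box (n - 1) s. m * wmono ts a * c a) \<in> J;
      a \<in> box (n - 1) s\<rbrakk> \<Longrightarrow> m * wmono ts a * c a \<in> J"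
    using independent_family[OF M] assms by (simp only: Suc_diff_1 le_eq_less_or_eq) blast
  have "c a = 0"
    if "(\<Sum>a\<in>box (n - 1) s. m * wmono ts a * sc (c a)) \<in> J" "a \<in> box (n - 1) s" for s c a
  proof (rule ccontr)
    assume "c a \<noteq> 0"
    \<comment> \<open>For scalar coefficients the vanishing of a summand does force the coefficient
      to vanish, since nonzero scalars are invertible and the monomials are nonzero modulo
      J.\<close>
    moreover have "m * wmono ts a * sc (c a) \<in> J" by (rule *(4)[OF D_sc that])
    ultimately show False using sc_J *(3)[of a] that(2) by (auto simp: box_def)
  qed
  then show ?thesis using that *(1,2) by blast
qed

end

subsection \<open>Relations in the algebra\<close>

lemma poly_mapping_sum_single:
  fixes f :: "'a \<Rightarrow>\<^sub>0 'b::comm_monoid_add"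
  shows "f = (\<Sum>w\<in>Poly_Mapping.keys f. Poly_Mapping.single w (Poly_Mapping.lookup f w))"
proof (rule poly_mapping_eqI)
  fix v
  have "(\<Sum>w\<in>Poly_Mapping.keys f. Poly_Mapping.lookup (Poly_Mapping.single w (Poly_Mapping.lookup f w)) v)
      = (\<Sum>w\<in>Poly_Mapping.keys f. if w = v then Poly_Mapping.lookup f v else 0)"
    by (intro sum.cong refl) (simp add: lookup_single when_def)
  also have "\<dots> = Poly_Mapping.lookup f v" by (simp add: in_keys_iff)
  finally show "Poly_Mapping.lookup f v
      = Poly_Mapping.lookup (\<Sum>w\<in>Poly_Mapping.keys f. Poly_Mapping.single w (Poly_Mapping.lookup f w)) v"
    by (simp add: lookup_sum)
qed

lemma poly_mapping_induct_single [case_names zero add single]: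
  fixes f :: "'a \<Rightarrow>\<^sub>0 'b::comm_monoid_add"
  assumes "P 0" "\<And>f g. P f \<Longrightarrow> P g \<Longrightarrow> P (f + g)" "\<And>w c. P (Poly_Mapping.single w c)"
  shows "P f"
proof -
  have "P (\<Sum>w\<in>S. Poly_Mapping.single w (Poly_Mapping.lookup f w))" for S
    by (induction S rule: infinite_finite_induct) (auto intro: assms)
  then show ?thesis using poly_mapping_sum_single[of f] by metis
qed

lemma scal_comm: "scal c * f = f * (scal c :: 'k::field ncpoly)"
  by (induction f rule: poly_mapping_induct_single)
    (simp_all add: distrib_left distrib_right mult_single mult.commute)

section \<open>Projection onto the free algebra on the generators of index 1 to n\<close>

definition restr :: "nat \<Rightarrow> 'k::field ncpoly \<Rightarrow> 'k ncpoly"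
  where "restr n = Poly_Mapping.mapp (\<lambda>w c. if set (letters w) \<subseteq> gens n then c else 0)"

lemma lookup_restr:
  "Poly_Mapping.lookup (restr n f) w = (if set (letters w) \<subseteq> gens n then Poly_Mapping.lookup f w else 0)"
  by (simp add: restr_def lookup_mapp when_def in_keys_iff)

lemma restr_add: "restr n (f + g) = restr n f + restr n g"
  by (rule poly_mapping_eqI) (simp add: lookup_restr lookup_add)

lemma restr_0 [simp]: "restr n 0 = 0"
  by (rule poly_mapping_eqI) (simp add: lookup_restr)

lemma restr_single:
  "restr n (Poly_Mapping.single w c) = (if set (letters w) \<subseteq> gens n then Poly_Mapping.single w c else 0)"
  by (rule poly_mapping_eqI) (auto simp: lookup_restr lookup_single when_def)

text \<open>A concatenation of two words contains only admissible letters exactly if both words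
  do.\<close>

lemma restr_mult: "restr n (f * g) = restr n f * restr n g"
proof (induction f rule: poly_mapping_induct_single)
  case (single u c)
  show ?case
    by (induction g rule: poly_mapping_induct_single)
      (auto simp: restr_add distrib_left mult_single restr_single plus_gword_def)
qed (simp_all add: restr_add distrib_right)

lemma restr_carrier: "restr n f \<in> carrier (free_alg n)"
  by (auto simp: free_alg_def in_keys_iff lookup_restr split: if_splits)

lemma restr_id: "f \<in> carrier (free_alg n) \<Longrightarrow> restr n f = f"
  by (rule poly_mapping_eqI) (auto simp: free_alg_def lookup_restr in_keys_iff)

text \<open>The relation ideal lives in the carrier of \<open>free_alg n\<close>. Its preimage under
  the projection is a two-sided ideal of the whole type, as \<open>scalar_ideal\<close> requires,
  and contains all generators of foreign index.\<close>

definition Kn_kernel ::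
  "nat \<Rightarrow> (nat \<Rightarrow> 'k::field) \<Rightarrow> (nat \<Rightarrow> 'k) \<Rightarrow> (nat \<Rightarrow> nat \<Rightarrow> 'k) \<Rightarrow> 'k ncpoly set"
  where "Kn_kernel n p q \<gamma> = {f. restr n f \<in> Kn_ideal n p q \<gamma>}"

lemma free_alg_simps:
  "mult (free_alg n) = (*)" "add (free_alg n) = (+)" "one (free_alg n) = 1" "zero (free_alg n) = 0"
  by (simp_all add: free_alg_def)

lemma scalar_ideal_Kn: "scalar_ideal scal (Kn_kernel n p q \<gamma> :: 'k::field ncpoly set)"
proof -
  interpret ideal "Kn_ideal n p q \<gamma>" "free_alg n" by (rule ideal_Kn)
  show ?thesis
  proof
    fix a b assume "a \<in> Kn_kernel n p q \<gamma>" "b \<in> Kn_kernel n p q \<gamma>"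
    then show "a + b \<in> Kn_kernel n p q \<gamma>"
      using additive_subgroup.a_closed[OF additive_subgroup_axioms, of "restr n a" "restr n b"] by (simp add: Kn_kernel_def restr_add free_alg_simps)
  next
    fix a b assume "a \<in> Kn_kernel n p q \<gamma>"
    then show "a * b \<in> Kn_kernel n p q \<gamma>" "b * a \<in> Kn_kernel n p q \<gamma>"
      using I_r_closed[OF _ restr_carrier, of "restr n a" b] I_l_closed[OF _ restr_carrier, of "restr n a" b]
      by (simp_all add: Kn_kernel_def restr_mult free_alg_simps)
  next
    show "0 \<in> Kn_kernel n p q \<gamma>"
      using additive_subgroup.zero_closed[OF additive_subgroup_axioms] by (simp add: Kn_kernel_def free_alg_simps)
  qed (simp_all add: single_add mult_single scal_comm)
qed

lemma Kn_ideal_kernel: "f \<in> Kn_ideal n p q \<gamma> \<Longrightarrow> f \<in> Kn_kernel n p q \<gamma>"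
  using ideal.Icarr[OF ideal_Kn, of f n p q \<gamma>] by (simp add: Kn_kernel_def restr_id)

lemma Kn_relator_kernel: "f \<in> Kn_relators n p q \<gamma> \<Longrightarrow> f \<in> Kn_kernel n p q \<gamma>"
  using ring.genideal_self[OF ring_free_alg Kn_relators_closed] Kn_ideal_kernel
  unfolding Kn_ideal_def by blast

section \<open>Commutation relations for q = 1\<close>

locale Kn_q1 =
  fixes n :: nat and p q :: "nat \<Rightarrow> 'k::field" and \<gamma> :: "nat \<Rightarrow> nat \<Rightarrow> 'k"
  assumes data: "Kn_data n p q \<gamma>"
    and q1: "\<forall>i\<in>{1..n}. q i = 1"

sublocale Kn_q1 \<subseteq> scalar_ideal scal "Kn_kernel n p q \<gamma>"
  by (rule scalar_ideal_Kn)

context Kn_q1 begin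

notation eqI (infix "\<doteq>" 50)

definition zf :: "nat \<Rightarrow> 'k ncpoly"
  where "zf i = (\<Sum>l\<in>{1..i}. scal (1 - p l) * (fy l * fx l))"

lemma p_nz: "i \<in> {1..n} \<Longrightarrow> p i \<noteq> 0" and p_ne_1: "i \<in> {1..n} \<Longrightarrow> p i \<noteq> 1"
  using data q1 by (auto simp: Kn_data_def)

lemma \<gamma>_mult: "i \<in> {1..n} \<Longrightarrow> j \<in> {1..n} \<Longrightarrow> \<gamma> i j * \<gamma> j i = 1"
  using data by (auto simp: Kn_data_def)

lemma \<gamma>_inv: "i \<in> {1..n} \<Longrightarrow> j \<in> {1..n} \<Longrightarrow> inverse (\<gamma> i j) = \<gamma> j i"
  by (rule inverse_unique) (rule \<gamma>_mult)

lemma \<gamma>_nz: "i \<in> {1..n} \<Longrightarrow> j \<in> {1..n} \<Longrightarrow> \<gamma> i j \<noteq> 0"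
  using \<gamma>_mult[of i j] by auto

lemma qcI: "a * b - scal c * b * a \<in> Kn_kernel n p q \<gamma> \<Longrightarrow> qc c a b"
  by (simp add: qc_def eqI_def mult.assoc)

context
  fixes i j assumes ij: "i \<in> {1..n}" "j \<in> {1..n}"
begin

lemma qc_xx:
  assumes "i < j" shows "qc (inverse (p j) * \<gamma> i j) (fx i) (fx j)"
proof -
  have "fx i * fx j - scal (q i * inverse (p j) * \<gamma> i j) * fx j * fx i \<in> Kn_relators n p q \<gamma>"
    unfolding Kn_relators_def using ij assms by blast
  then show ?thesis using ij q1 by (intro qcI Kn_relator_kernel) (simp add: \<gamma>_inv)
qed

lemma qc_yy:
  assumes "i < j" shows "qc (\<gamma> i j) (fy i) (fy j)"
proof -
  have "fy i * fy j - scal (\<gamma> i j) * fy j * fy i \<in> Kn_relators n p q \<gamma>"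
    unfolding Kn_relators_def using ij assms by blast
  then show ?thesis using ij q1 by (intro qcI Kn_relator_kernel) (simp add: \<gamma>_inv)
qed

lemma qc_xy_less:
  assumes "i < j" shows "qc (p j * \<gamma> j i) (fx i) (fy j)"
proof -
  have "fx i * fy j - scal (p j * inverse (\<gamma> i j)) * fy j * fx i \<in> Kn_relators n p q \<gamma>"
    unfolding Kn_relators_def using ij assms by blast
  then show ?thesis using ij q1 by (intro qcI Kn_relator_kernel) (simp add: \<gamma>_inv)
qed

lemma qc_xy_greater:
  assumes "j < i" shows "qc (\<gamma> j i) (fx i) (fy j)"
proof -
  have "fx i * fy j - scal (q j * inverse (\<gamma> i j)) * fy j * fx i \<in> Kn_relators n p q \<gamma>"
    unfolding Kn_relators_def using ij assms by blast
  then show ?thesis using ij q1 by (intro qcI Kn_relator_kernel) (simp add: \<gamma>_inv)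
qed

end

lemma zf_Suc: "zf (Suc i) = zf i + scal (1 - p (Suc i)) * (fy (Suc i) * fx (Suc i))"
  by (simp add: zf_def)

lemma zf_0 [simp]: "zf 0 = 0"
  by (simp add: zf_def)

lemma xy_same: 
  assumes "Suc i \<le> n"
  shows "fx (Suc i) * fy (Suc i) \<doteq> fy (Suc i) * fx (Suc i) + zf i"
proof -
  have "zf i = (\<Sum>l\<in>{1..<Suc i}. scal (q l - p l) * fy l * fx l)"
    unfolding zf_def by (intro sum.cong) (use assms q1 in \<open>auto simp: mult.assoc\<close>)
  moreover have "fx (Suc i) * fy (Suc i) - scal (q (Suc i)) * fy (Suc i) * fx (Suc i)
      - (\<Sum>l\<in>{1..<Suc i}. scal (q l - p l) * fy l * fx l) \<in> Kn_kernel n p q \<gamma>"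
    by (rule Kn_relator_kernel, unfold Kn_relators_def, intro UnI2 CollectI exI[of _ "Suc i"] conjI refl)
      (use assms in simp)
  ultimately show ?thesis using q1 assms by (simp add: eqI_def algebra_simps)
qed

text \<open>In y_l x_l the factors from \<gamma> always cancel. For i < l the two factors p_l cancel
  as well, and for l < i exactly one p_i survives.\<close>

lemma qc_x_yx:
  assumes "i \<in> {1..n}" "l \<in> {1..n}"
  shows "i < l \<Longrightarrow> qc 1 (fx i) (fy l * fx l)" "l < i \<Longrightarrow> qc (p i) (fx i) (fy l * fx l)"
proof -
  assume "i < l"
  moreover have "(p l * \<gamma> l i) * (inverse (p l) * \<gamma> i l) = 1"
    using p_nz[of l] \<gamma>_mult[of l i] assms by (simp add: field_simps)
  ultimately show "qc 1 (fx i) (fy l * fx l)"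
    using qc_mult_right[OF qc_xy_less[OF assms] qc_xx[OF assms]] by simp
next
  assume "l < i"
  then have "qc (inverse (inverse (p i) * \<gamma> l i)) (fx i) (fx l)"
    using assms p_nz \<gamma>_nz by (intro qc_sym qc_xx) auto
  moreover have "\<gamma> l i * inverse (inverse (p i) * \<gamma> l i) = p i"
    using p_nz[of i] \<gamma>_nz[of l i] assms by (simp add: field_simps)
  ultimately show "qc (p i) (fx i) (fy l * fx l)"
    using qc_mult_right[OF qc_xy_greater[OF assms \<open>l < i\<close>]] by metis
qed

lemma qc_y_yx:
  assumes "i \<in> {1..n}" "l \<in> {1..n}"
  shows "i < l \<Longrightarrow> qc 1 (fy i) (fy l * fx l)" "l < i \<Longrightarrow> qc (inverse (p i)) (fy i) (fy l * fx l)"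
proof -
  assume il: "i < l"
  then have "qc (inverse (\<gamma> i l)) (fy i) (fx l)"
    using assms \<gamma>_nz by (intro qc_sym qc_xy_greater) auto
  moreover have "\<gamma> i l * inverse (\<gamma> i l) = 1" using \<gamma>_nz[of i l] assms by simp
  ultimately show "qc 1 (fy i) (fy l * fx l)"
    using qc_mult_right[OF qc_yy[OF assms il]] by metis
next
  assume li: "l < i"
  have "qc (inverse (\<gamma> l i)) (fy i) (fy l)"
    by (intro qc_sym qc_yy) (use assms li \<gamma>_nz in auto)
  moreover have "qc (inverse (p i * \<gamma> i l)) (fy i) (fx l)"
    by (intro qc_sym qc_xy_less) (use assms li \<gamma>_nz p_nz in auto)
  moreover have "inverse (\<gamma> l i) * inverse (p i * \<gamma> i l) = inverse (p i)"
    using \<gamma>_mult[of l i] assms by (simp flip: inverse_mult_distrib add: mult.left_commute)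
  ultimately show "qc (inverse (p i)) (fy i) (fy l * fx l)"
    using qc_mult_right by metis
qed

lemma qc_xz_less: "j < i \<Longrightarrow> i \<le> n \<Longrightarrow> qc (p i) (fx i) (zf j)"
  unfolding zf_def by (intro qc_sum_right qc_sc_mult qc_x_yx) auto

lemma qc_yz_less: "j < i \<Longrightarrow> i \<le> n \<Longrightarrow> qc (inverse (p i)) (fy i) (zf j)"
  unfolding zf_def by (intro qc_sum_right qc_sc_mult qc_y_yx) auto

text \<open>Moving x past z_{i-1} costs a factor p_i, and moving it past (1 - p_i) y_i contributes
  the extra term (1 - p_i) z_{i-1} x. The two add up to z_{i-1} x.\<close>

lemma xz_same:
  assumes "Suc i \<le> n" shows "qc 1 (fx (Suc i)) (zf (Suc i))"
proof -
  let ?x = "fx (Suc i)" let ?y = "fy (Suc i)" let ?p = "p (Suc i)"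
  have "?x * zf (Suc i) = ?x * zf i + scal (1 - ?p) * (?x * ?y * ?x)"
    by (simp add: zf_Suc distrib_left mult.assoc sc_left[of ?x])
  also have "\<dots> \<doteq> scal ?p * (zf i * ?x) + scal (1 - ?p) * ((?y * ?x + zf i) * ?x)"
    using qc_xz_less[of i "Suc i"] assms
    by (intro eq_add eq_lmult eq_rmult xy_same) (auto simp: qc_def)
  also have "\<dots> = zf (Suc i) * ?x"
    by (simp add: zf_Suc sc_diff algebra_simps)
  finally show ?thesis by (simp add: qc_1)
qed

lemma yz_same:
  assumes "Suc i \<le> n" shows "qc 1 (fy (Suc i)) (zf (Suc i))"
proof -
  let ?x = "fx (Suc i)" let ?y = "fy (Suc i)" let ?p = "p (Suc i)"
  have yz: "qc ?p (zf i) ?y"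
    using qc_sym[OF qc_yz_less[of i "Suc i"]] assms p_nz[of "Suc i"] by auto
  have "zf (Suc i) * ?y = zf i * ?y + scal (1 - ?p) * (?y * (?x * ?y))"
    by (simp add: zf_Suc distrib_right mult.assoc)
  also have "\<dots> \<doteq> scal ?p * (?y * zf i) + scal (1 - ?p) * (?y * (?y * ?x + zf i))"
    using yz assms by (intro eq_add eq_lmult xy_same) (auto simp: qc_def)
  also have "\<dots> = ?y * zf (Suc i)"
    by (simp add: zf_Suc sc_diff algebra_simps sc_left[of ?y])
  finally show ?thesis by (simp add: qc_1 eq_sym)
qed

lemma qc_xz:
  assumes "1 \<le> i" "i \<le> j" "j \<le> n" shows "qc 1 (fx i) (zf j)"
  using assms(2,3)
proof (induction j rule: dec_induct)
  case base
  then show ?case using xz_same[of "i - 1"] assms(1) by simp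
next
  case (step j)
  then show ?case unfolding zf_Suc using assms(1)
    by (intro qc_add_right qc_sc_mult qc_x_yx) auto
qed

lemma qc_yz:
  assumes "1 \<le> i" "i \<le> j" "j \<le> n" shows "qc 1 (fy i) (zf j)"
  using assms(2,3)
proof (induction j rule: dec_induct)
  case base
  then show ?case using yz_same[of "i - 1"] assms(1) by simp
next
  case (step j)
  then show ?case unfolding zf_Suc using assms(1)
    by (intro qc_add_right qc_sc_mult qc_y_yx) auto
qed

text \<open>Each y_l x_l commutes with z_j: for l \<le> j both factors do, and for l > j their
  scalars 1/p_l and p_l cancel.\<close>

lemma qc_zz:
  assumes "i \<le> n" "j \<le> n" shows "qc 1 (zf i) (zf j)"
proof -
  have "qc 1 (fy l * fx l) (zf j)" if l: "1 \<le> l" "l \<le> n" for l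
  proof (cases "l \<le> j")
    case True
    then show ?thesis using qc_mult_left[OF qc_yz[of l j] qc_xz[of l j]] l assms by simp
  next
    case False
    then show ?thesis
      using qc_mult_left[OF qc_yz_less[of j l] qc_xz_less[of j l]] l p_nz[of l] by simp
  qed
  then show ?thesis unfolding zf_def[of i]
    using assms by (intro qc_sum_left qc_sc_mult) auto
qed

lemma yx_zf:
  "1 \<le> i \<Longrightarrow> scal (1 - p i) * fy i * fx i = zf i - zf (i - 1)"
  by (cases i) (simp_all add: zf_Suc mult.assoc)

lemma xy_zf:
  assumes "1 \<le> i" "i \<le> n"
  shows "scal (1 - p i) * fx i * fy i \<doteq> zf i - scal (p i) * zf (i - 1)"
proof -
  obtain j where i: "i = Suc j" using assms(1) by (cases i) auto
  have "scal (1 - p i) * fx i * fy i \<doteq> scal (1 - p i) * (fy i * fx i + zf j)"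
    unfolding mult.assoc i by (intro eq_lmult xy_same) (use assms i in simp)
  also have "\<dots> = zf i - scal (p i) * zf (i - 1)"
    by (simp add: i zf_Suc distrib_left sc_diff left_diff_distrib sc_1)
  finally show ?thesis .
qed

end

subsection \<open>Dimensions of filtered images\<close>

text \<open>Independent subsets of U are independent in the span of T, so they have at most card T
  elements. A maximal one therefore exists and spans U.\<close>

lemma (in vectorspace) subspace_of_finite_span:
  assumes U: "subspace K U V" and T: "finite T" "T \<subseteq> carrier V" "U \<subseteq> span T"
  shows "vectorspace.fin_dim K (vs U)" "vectorspace.dim K (vs U) \<le> card T"
proof -
  interpret U: vectorspace K "vs U" by (rule subspace_is_vs[OF U])
  have sT: "subspace K (span T) V" by (rule span_is_subspace[OF T(2)])
  interpret S: vectorspace K "vs (span T)" by (rule subspace_is_vs[OF sT])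
  have subU: "submodule K U V" and subS: "submodule K (span T) V"
    using U sT by (simp_all add: subspace_def)
  have TS: "T \<subseteq> span T" by (rule in_own_span[OF T(2)])
  have genT: "S.span T = span T" by (rule span_li_not_depend(1)[OF TS subS])
  have S_fin: "S.fin_dim" unfolding S.fin_dim_def using T(1) TS genT by auto
  have le: "finite A \<and> card A \<le> card T" if A: "A \<subseteq> U \<and> \<not> U.lin_dep A" for A
  proof -
    have "A \<subseteq> span T" using A T(3) by blast
    then have "\<not> S.lin_dep A"
      using A span_li_not_depend(2)[OF _ subU, of A] span_li_not_depend(2)[OF _ subS, of A] by blast
    moreover have "finite A"
      by (rule S.fin_dim_li_fin[OF S_fin calculation]) (use \<open>A \<subseteq> span T\<close> in simp)
    ultimately show ?thesis
      using S.li_smaller_than_gen[of A T] T(1) TS genT \<open>A \<subseteq> span T\<close> by simp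
  qed
  have "\<not> U.lin_dep {}" by (simp add: U.lin_dep_def)
  then obtain A where A: "finite A" "maximal A (\<lambda>S. S \<subseteq> U \<and> \<not> U.lin_dep S)"
    using maximal_exists[of "\<lambda>S. S \<subseteq> U \<and> \<not> U.lin_dep S" "card T" "{}"] le by blast
  then have gen: "U.span A = U" using U.max_li_is_gen[of A] by simp
  have AU: "A \<subseteq> U" "card A \<le> card T" using A le[of A] by (auto simp: maximal_def)
  show "U.fin_dim" unfolding U.fin_dim_def using A(1) gen AU by auto
  show "U.dim \<le> card T" using U.gen_ge_dim[of A] A(1) gen AU by simp
qed

section \<open>Linear maps out of the free algebra\<close>

locale lin_image = vectorspace "class_ring :: 'k::field ring" V
  for V :: "('k::field, 'v, 'x) module_scheme" +
  fixes \<phi> :: "'k::field ncpoly \<Rightarrow> 'v"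
  assumes phi_closed: "\<phi> f \<in> carrier V"
    and phi_add: "\<phi> (f + g) = \<phi> f \<oplus>\<^bsub>V\<^esub> \<phi> g"
    and phi_smult: "\<phi> (scal c * f) = c \<odot>\<^bsub>V\<^esub> \<phi> f"
begin

lemma phi_0: "\<phi> 0 = \<zero>\<^bsub>V\<^esub>"
  using phi_smult[of 0 0] lmult_0[OF phi_closed, of 0] by simp

lemma phi_sum: "finite S \<Longrightarrow> \<phi> (sum h S) = (\<Oplus>\<^bsub>V\<^esub>i\<in>S. \<phi> (h i))"
  by (induction S rule: finite_induct) (simp_all add: phi_0 phi_add phi_closed)

lemma phi_lincomb: "finite S \<Longrightarrow> \<phi> (\<Sum>i\<in>S. scal (c i) * h i) = (\<Oplus>\<^bsub>V\<^esub>i\<in>S. c i \<odot>\<^bsub>V\<^esub> \<phi> (h i))"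
  by (simp add: phi_sum phi_smult)

lemma image_subspace:
  assumes "0 \<in> B" "\<And>f g. f \<in> B \<Longrightarrow> g \<in> B \<Longrightarrow> f + g \<in> B" "\<And>c f. f \<in> B \<Longrightarrow> scal c * f \<in> B"
  shows "VectorSpace.subspace class_ring (\<phi> ` B) V"
proof (intro subspace.intro submodule.intro)
  show "vectorspace class_ring V" "Module.module class_ring V" by unfold_locales
  show "\<zero>\<^bsub>V\<^esub> \<in> \<phi> ` B" using assms(1) phi_0 by (metis imageI)
  fix v w assume "v \<in> \<phi> ` B" "w \<in> \<phi> ` B"
  then show "v \<oplus>\<^bsub>V\<^esub> w \<in> \<phi> ` B" using assms(2) phi_add by (auto simp flip: phi_add)
next
  fix c v assume "v \<in> \<phi> ` B"
  then show "c \<odot>\<^bsub>V\<^esub> v \<in> \<phi> ` B" using assms(3) by (auto simp flip: phi_smult)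
qed (auto simp: phi_closed)

lemma phi_in_subspace:
  assumes "VectorSpace.subspace class_ring W V" "finite S" "\<And>i. i \<in> S \<Longrightarrow> \<phi> (h i) \<in> W"
  shows "\<phi> (\<Sum>i\<in>S. scal (c i) * h i) \<in> W"
proof -
  have W: "submodule class_ring W V" using assms(1) by (simp add: subspace_def)
  show ?thesis
    using assms(2,3)
  proof (induction S rule: finite_induct)
    case empty
    then show ?case using submodule.zero_closed[OF W] by (simp add: phi_0)
  next
    case (insert i S)
    then have "c i \<odot>\<^bsub>V\<^esub> \<phi> (h i) \<oplus>\<^bsub>V\<^esub> \<phi> (\<Sum>i\<in>S. scal (c i) * h i) \<in> W"
      by (intro submodule.m_closed[OF W] submodule.smult_closed[OF W]) auto
    then show ?case using insert by (simp add: phi_add phi_smult)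
  qed
qed

lemma phi_in_span:
  assumes "finite S" shows "\<phi> (\<Sum>i\<in>S. scal (c i) * h i) \<in> span (\<phi> ` h ` S)"
proof -
  have "\<phi> ` h ` S \<subseteq> carrier V" using phi_closed by auto
  then show ?thesis
    using in_own_span by (intro phi_in_subspace[OF span_is_subspace assms]) blast+
qed

text \<open>Independence is stated for the indexed family through its preimages in the free algebra,
  where sums are type class sums. Injectivity of the family has to be derived first, because
  dimension counts the set of vectors.\<close>

lemma card_le_dim:
  assumes W: "fin_dim_subspace class_ring V W" and S: "finite S" "\<And>i. i \<in> S \<Longrightarrow> \<phi> (h i) \<in> W"
    and ind: "\<And>c i. \<phi> (\<Sum>i\<in>S. scal (c i) * h i) = \<zero>\<^bsub>V\<^esub> \<Longrightarrow> i \<in> S \<Longrightarrow> c i = 0"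
  shows "card S \<le> subspace_dim class_ring V W"
proof -
  have subW: "VectorSpace.subspace class_ring W V" "submodule class_ring W V"
    using W by (simp_all add: fin_dim_subspace_def subspace_def)
  interpret W: vectorspace "class_ring :: 'k ring" "vs W" by (rule subspace_is_vs[OF subW(1)])
  let ?v = "\<lambda>i. \<phi> (h i)"
  have inj: "inj_on ?v S"
  proof (rule inj_onI, rule ccontr)
    fix i j assume ij: "i \<in> S" "j \<in> S" "?v i = ?v j" "i \<noteq> j"
    \<comment> \<open>Two equal vectors would satisfy the relation with coefficients 1 and
      -1.\<close>
    let ?c = "\<lambda>k. (if k = i then 1 else 0) + (if k = j then - 1 else (0::'k))"
    have "(\<Sum>k\<in>S. scal (?c k) * h k) = (\<Sum>k\<in>S. (if k = i then h k else 0) + (if k = j then scal (- 1) * h k else 0))"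
      using ij(4) by (intro sum.cong) auto
    also have "\<dots> = h i + scal (- 1) * h j"
      using S(1) ij(1,2) by (simp add: sum.distrib)
    finally have "\<phi> (\<Sum>k\<in>S. scal (?c k) * h k) = \<phi> (h i) \<oplus>\<^bsub>V\<^esub> \<phi> (scal (- 1) * h j)"
      by (simp only: phi_add)
    also have "\<dots> = \<phi> (h j + scal (- 1) * h j)"
      using ij(3) by (simp only: phi_add)
    also have "h j + scal (- 1) * h j = 0"
      by (simp add: single_uminus)
    finally have "?c i = 0" using ind[of ?c i] ij(1) by (simp add: phi_0)
    then show False using ij(4) by simp
  qed
  have sub: "?v ` S \<subseteq> W" using S(2) by auto
  have carr: "?v ` S \<subseteq> carrier V" using phi_closed by auto
  have "\<not> lin_dep (?v ` S)"
  proof (rule finite_lin_indpt2)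
    fix a assume a: "lincomb a (?v ` S) = \<zero>\<^bsub>V\<^esub>"
    have "lincomb a (?v ` S) = (\<Oplus>\<^bsub>V\<^esub>i\<in>S. a (?v i) \<odot>\<^bsub>V\<^esub> ?v i)"
      unfolding lincomb_def by (rule finsum_reindex) (use inj phi_closed in auto)
    also have "\<dots> = \<phi> (\<Sum>i\<in>S. scal (a (?v i)) * h i)" by (rule phi_lincomb[OF S(1), symmetric])
    finally have "\<phi> (\<Sum>i\<in>S. scal (a (?v i)) * h i) = \<zero>\<^bsub>V\<^esub>" using a by (simp only:)
    then have "a (?v i) = 0" if "i \<in> S" for i using that by (rule ind)
    then show "\<forall>v\<in>?v ` S. a v = \<zero>\<^bsub>class_ring\<^esub>" by simp
  qed (use S carr in auto)
  then have "\<not> W.lin_dep (?v ` S)" using span_li_not_depend(2)[OF sub subW(2)] by simp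
  moreover have "W.fin_dim" using W by (simp add: fin_dim_subspace_def)
  ultimately have "card (?v ` S) \<le> W.dim" using W.li_le_dim(2)[of "?v ` S"] sub by simp
  then show ?thesis using card_image[OF inj] by (simp add: subspace_dim_def)
qed

end

section \<open>The degree filtration\<close>

definition deg_le :: "nat \<Rightarrow> nat \<Rightarrow> 'k::field ncpoly set"
  where "deg_le n k = {f. \<forall>w\<in>Poly_Mapping.keys f. set (letters w) \<subseteq> gens n \<and> length (letters w) \<le> k}"

definition words :: "nat \<Rightarrow> nat \<Rightarrow> gword set"
  where "words n k = {w. set (letters w) \<subseteq> gens n \<and> length (letters w) \<le> k}"

lemma finite_gens: "finite (gens n)"
  by (simp add: gens_def)

lemma finite_words: "finite (words n k)"
proof -
  have "words n k = GWord ` {xs. set xs \<subseteq> gens n \<and> length xs \<le> k}"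
    unfolding words_def by (auto simp: image_iff) (metis gword.collapse)
  then show ?thesis using finite_lists_length_le[OF finite_gens] by simp
qed

lemma deg_le_words: "f \<in> deg_le n k \<longleftrightarrow> Poly_Mapping.keys f \<subseteq> words n k"
  by (auto simp: deg_le_def words_def)

lemma deg_le_0: "0 \<in> deg_le n k"
  by (simp add: deg_le_def)

lemma deg_le_add: "f \<in> deg_le n k \<Longrightarrow> g \<in> deg_le n k \<Longrightarrow> f + g \<in> deg_le n k"
  unfolding deg_le_words using Poly_Mapping.keys_add[of f g] by blast

lemma deg_le_mult: "f \<in> deg_le n k \<Longrightarrow> g \<in> deg_le n l \<Longrightarrow> f * g \<in> deg_le n (k + l)"
  unfolding deg_le_def using keys_mult[of f g] by (fastforce simp: plus_gword_def)

lemma deg_le_single: "w \<in> words n k \<Longrightarrow> Poly_Mapping.single w c \<in> deg_le n k"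
  by (simp add: deg_le_words)

lemma deg_le_scal: "scal c \<in> deg_le n k"
  by (rule deg_le_single) (simp add: words_def zero_gword_def)

lemma deg_le_smult: "f \<in> deg_le n k \<Longrightarrow> scal c * f \<in> deg_le n k"
  using deg_le_mult[OF deg_le_scal[of c n 0], of f k] by simp

lemma deg_le_1: "1 \<in> deg_le n k"
  using deg_le_scal[of 1 n k] by simp

lemma deg_le_sum: "(\<And>i. i \<in> S \<Longrightarrow> f i \<in> deg_le n k) \<Longrightarrow> sum f S \<in> deg_le n k"
  by (induction S rule: infinite_finite_induct) (simp_all add: deg_le_0 deg_le_add)

lemma deg_le_power: "f \<in> deg_le n k \<Longrightarrow> f ^ l \<in> deg_le n (k * l)"
  by (induction l) (auto simp: deg_le_1 dest: deg_le_mult[of f n k])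

lemma deg_le_mono: "f \<in> deg_le n k \<Longrightarrow> k \<le> l \<Longrightarrow> f \<in> deg_le n l"
  by (force simp: deg_le_def)

lemma deg_le_gens: "i \<in> {1..n} \<Longrightarrow> fx i \<in> deg_le n 1" "i \<in> {1..n} \<Longrightarrow> fy i \<in> deg_le n 1"
  by (auto intro!: deg_le_single simp: words_def gens_def)

lemma deg_le_carrier: "f \<in> deg_le n k \<Longrightarrow> f \<in> carrier (free_alg n)"
  by (auto simp: deg_le_def free_alg_def)

lemma carrier_deg_le:
  assumes "f \<in> carrier (free_alg n)" obtains k where "f \<in> deg_le n k"
proof -
  have "finite ((\<lambda>w. length (letters w)) ` Poly_Mapping.keys f)" by simp
  then obtain k where "\<forall>m\<in>(\<lambda>w. length (letters w)) ` Poly_Mapping.keys f. m \<le> k"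
    using finite_nat_set_iff_bounded_le by blast
  then show ?thesis using assms that[of k] by (auto simp: deg_le_def free_alg_def)
qed

lemma deg_le_expand:
  assumes "f \<in> deg_le n k"
  obtains c where "f = (\<Sum>w\<in>words n k. scal (c w) * Poly_Mapping.single w 1)"
proof -
  have "f = (\<Sum>w\<in>Poly_Mapping.keys f. Poly_Mapping.single w (Poly_Mapping.lookup f w))"
    by (rule poly_mapping_sum_single)
  also have "\<dots> = (\<Sum>w\<in>words n k. Poly_Mapping.single w (Poly_Mapping.lookup f w))"
    using assms finite_words[of n k] by (intro sum.mono_neutral_left) (auto simp: deg_le_words in_keys_iff)
  finally show ?thesis using that[of "Poly_Mapping.lookup f"] by (simp add: mult_single)
qed

text \<open>Composing the quotient map with \<open>restr\<close> makes it a ring homomorphism on the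
  whole type, so no carrier conditions on its argument arise.\<close>

definition kq ::
  "nat \<Rightarrow> (nat \<Rightarrow> 'k::field) \<Rightarrow> (nat \<Rightarrow> 'k) \<Rightarrow> (nat \<Rightarrow> nat \<Rightarrow> 'k) \<Rightarrow> 'k ncpoly \<Rightarrow> 'k ncpoly set"
  where "kq n p q \<gamma> f = Kn_ideal n p q \<gamma> +>\<^bsub>free_alg n\<^esub> restr n f"

context
  fixes n :: nat and p q :: "nat \<Rightarrow> 'k::field" and \<gamma> :: "nat \<Rightarrow> nat \<Rightarrow> 'k"
begin

interpretation ideal "Kn_ideal n p q \<gamma>" "free_alg n"
  by (rule ideal_Kn)

lemma kq_closed: "kq n p q \<gamma> f \<in> carrier (Kn n p q \<gamma>)"
  using ring_hom_closed[OF rcos_ring_hom restr_carrier] by (simp add: kq_def Kn_simps)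

lemma kq_add: "kq n p q \<gamma> (f + g) = kq n p q \<gamma> f \<oplus>\<^bsub>Kn n p q \<gamma>\<^esub> kq n p q \<gamma> g"
  using ring_hom_add[OF rcos_ring_hom restr_carrier restr_carrier, of f g]
  by (simp add: kq_def Kn_simps restr_add free_alg_simps)

lemma kq_mult: "kq n p q \<gamma> (f * g) = kq n p q \<gamma> f \<otimes>\<^bsub>Kn n p q \<gamma>\<^esub> kq n p q \<gamma> g"
  using ring_hom_mult[OF rcos_ring_hom restr_carrier restr_carrier, of f g]
  by (simp add: kq_def Kn_simps restr_mult free_alg_simps)

lemma restr_scal: "restr n (scal c) = scal c"
  by (rule restr_id) (rule in_free_alg)

lemma kq_1: "kq n p q \<gamma> 1 = \<one>\<^bsub>Kn n p q \<gamma>\<^esub>"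
  using ring_hom_one[OF rcos_ring_hom] restr_scal[of "1::'k"]
  by (simp add: kq_def Kn_simps free_alg_simps)

lemma kq_smult: "kq n p q \<gamma> (scal c * f) = c \<odot>\<^bsub>Kn n p q \<gamma>\<^esub> kq n p q \<gamma> f"
  unfolding kq_mult by (simp add: kq_def Kn_simps restr_scal)

lemma kq_eq_0: "kq n p q \<gamma> f = \<zero>\<^bsub>Kn n p q \<gamma>\<^esub> \<longleftrightarrow> f \<in> Kn_kernel n p q \<gamma>"
  using rcos_const_imp_mem[OF restr_carrier, of f] a_rcos_const[of "restr n f"]
  by (auto simp: kq_def Kn_simps FactRing_def Kn_kernel_def)

lemma kq_0: "kq n p q \<gamma> 0 = \<zero>\<^bsub>Kn n p q \<gamma>\<^esub>"
  unfolding kq_eq_0 by (rule scalar_ideal.I_zero[OF scalar_ideal_Kn])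

lemma kq_surj: "a \<in> carrier (Kn n p q \<gamma>) \<Longrightarrow> \<exists>f\<in>carrier (free_alg n). a = kq n p q \<gamma> f"
  by (auto simp: Kn_simps FactRing_def A_RCOSETS_def' kq_def restr_id)

lemma lin_image_kq: "lin_image (Kn n p q \<gamma>) (kq n p q \<gamma>)"
  by (intro lin_image.intro vectorspace_Kn lin_image_axioms.intro kq_closed kq_add kq_smult)

end

subsection \<open>Powers of the generating subspace\<close>

lemma (in lin_image) image_deg_le_subset:
  "\<phi> ` deg_le n L \<subseteq> span (\<phi> ` (\<lambda>w. Poly_Mapping.single w 1) ` words n L)"
proof
  fix v assume "v \<in> \<phi> ` deg_le n L"
  then obtain f where f: "f \<in> deg_le n L" "v = \<phi> f" by auto
  obtain c where "f = (\<Sum>w\<in>words n L. scal (c w) * Poly_Mapping.single w 1)"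
    using deg_le_expand[OF f(1)] .
  then show "v \<in> span (\<phi> ` (\<lambda>w. Poly_Mapping.single w 1) ` words n L)"
    using phi_in_span[OF finite_words, of c "\<lambda>w. Poly_Mapping.single w 1" n L] f(2) by simp
qed

lemma (in lin_image) image_deg_le: "fin_dim_subspace class_ring V (\<phi> ` deg_le n L)"
proof -
  have "VectorSpace.subspace class_ring (\<phi> ` deg_le n L) V"
    by (intro image_subspace deg_le_0 deg_le_add deg_le_smult)
  moreover have "\<phi> ` (\<lambda>w. Poly_Mapping.single w 1) ` words n L \<subseteq> carrier V" by (auto simp: phi_closed)
  ultimately show ?thesis
    using subspace_of_finite_span(1)[OF _ _ _ image_deg_le_subset] finite_words
    by (auto simp: fin_dim_subspace_def)
qed

context
  fixes n :: nat and p q :: "nat \<Rightarrow> 'k::field" and \<gamma> :: "nat \<Rightarrow> nat \<Rightarrow> 'k"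
begin

interpretation lin_image "Kn n p q \<gamma>" "kq n p q \<gamma>"
  by (rule lin_image_kq)

lemma kq_Int: "kq n p q \<gamma> ` deg_le n k \<subseteq> carrier (Kn n p q \<gamma>)"
  by (auto simp: kq_closed)

lemma span_subset_deg_le:
  "S \<subseteq> kq n p q \<gamma> ` deg_le n k \<Longrightarrow> span S \<subseteq> kq n p q \<gamma> ` deg_le n k"
  using image_deg_le[of n k] by (intro span_is_subset) (simp_all add: fin_dim_subspace_def subspace_def)

lemma subspace_power_le:
  assumes "W \<subseteq> kq n p q \<gamma> ` deg_le n d"
  shows "subspace_power class_ring (Kn n p q \<gamma>) W k \<subseteq> kq n p q \<gamma> ` deg_le n (d * k)"
proof (induction k)
  case 0
  then show ?case
    by (simp, intro span_subset_deg_le) (auto simp: kq_1[symmetric] deg_le_1)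
next
  case (Suc k)
  have "u \<otimes>\<^bsub>Kn n p q \<gamma>\<^esub> v \<in> kq n p q \<gamma> ` deg_le n (d * Suc k)"
    if "u \<in> subspace_power class_ring (Kn n p q \<gamma>) W k" "v \<in> W" for u v
  proof -
    obtain f g where "f \<in> deg_le n (d * k)" "g \<in> deg_le n d" "u = kq n p q \<gamma> f" "v = kq n p q \<gamma> g"
      using Suc assms \<open>u \<in> _\<close> \<open>v \<in> _\<close> by blast
    then show ?thesis using deg_le_mult[of f n "d * k" g d] by (auto simp: kq_mult[symmetric] add.commute)
  qed
  then show ?case by (simp, intro span_subset_deg_le) auto
qed

lemma subspace_power_subspace:
  assumes "W \<subseteq> kq n p q \<gamma> ` deg_le n d"
  shows "VectorSpace.subspace class_ring (subspace_power class_ring (Kn n p q \<gamma>) W k) (Kn n p q \<gamma>)"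
proof (cases k)
  case 0
  then show ?thesis by (simp, intro span_is_subspace) (simp add: kq_1[symmetric] kq_closed)
next
  case (Suc l)
  interpret K: ring "Kn n p q \<gamma>" by (rule ring_Kn)
  have "subspace_power class_ring (Kn n p q \<gamma>) W l \<subseteq> carrier (Kn n p q \<gamma>)" "W \<subseteq> carrier (Kn n p q \<gamma>)"
    using subspace_power_le[OF assms, of l] assms kq_Int by blast+
  then show ?thesis unfolding Suc subspace_power.simps by (intro span_is_subspace) auto
qed

text \<open>A word of length at most k + 1 is cut into its first k letters and the rest.\<close>

lemma subspace_power_ge:
  "kq n p q \<gamma> ` deg_le n k \<subseteq> subspace_power class_ring (Kn n p q \<gamma>) (kq n p q \<gamma> ` deg_le n 1) k"
proof -
  let ?P = "subspace_power class_ring (Kn n p q \<gamma>) (kq n p q \<gamma> ` deg_le n 1)"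
  interpret K: ring "Kn n p q \<gamma>" by (rule ring_Kn)
  have "kq n p q \<gamma> (Poly_Mapping.single w 1) \<in> ?P k" if "w \<in> words n k" for w
    using that
  proof (induction k arbitrary: w)
    case 0
    then have "w = 0" by (cases w) (simp add: words_def zero_gword_def)
    then have "kq n p q \<gamma> (Poly_Mapping.single w 1) = \<one>\<^bsub>Kn n p q \<gamma>\<^esub>" by (simp add: kq_1)
    then show ?case using in_own_span[of "{\<one>\<^bsub>Kn n p q \<gamma>\<^esub>}"] by simp
  next
    case (Suc k)
    \<comment> \<open>For a word with at most k letters \<open>?v\<close> is empty; this is
      admissible, since \<open>words n 1\<close> contains the empty word.\<close>
    let ?u = "GWord (take k (letters w))" let ?v = "GWord (drop k (letters w))"
    have "set (take k (letters w)) \<subseteq> gens n" "set (drop k (letters w)) \<subseteq> gens n"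
      using Suc.prems set_take_subset[of k "letters w"] set_drop_subset[of k "letters w"]
      by (auto simp: words_def)
    then have uv: "?u \<in> words n k" "?v \<in> words n 1" using Suc.prems by (auto simp: words_def)
    have "w = ?u + ?v" by (cases w) (simp add: plus_gword_def)
    then have "kq n p q \<gamma> (Poly_Mapping.single w 1)
        = kq n p q \<gamma> (Poly_Mapping.single ?u 1 * Poly_Mapping.single ?v 1)" by (simp add: mult_single)
    also have "\<dots> = kq n p q \<gamma> (Poly_Mapping.single ?u 1) \<otimes>\<^bsub>Kn n p q \<gamma>\<^esub> kq n p q \<gamma> (Poly_Mapping.single ?v 1)"
      by (rule kq_mult)
    finally have e: "kq n p q \<gamma> (Poly_Mapping.single w 1) \<in>
        {u \<otimes>\<^bsub>Kn n p q \<gamma>\<^esub> v | u v. u \<in> ?P k \<and> v \<in> kq n p q \<gamma> ` deg_le n 1}"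
      using Suc.IH[OF uv(1)] deg_le_single[OF uv(2), of 1] by blast
    have "?P k \<subseteq> carrier (Kn n p q \<gamma>)"
      using subspace_power_le[OF order_refl] kq_Int by blast
    then have "{u \<otimes>\<^bsub>Kn n p q \<gamma>\<^esub> v | u v. u \<in> ?P k \<and> v \<in> kq n p q \<gamma> ` deg_le n 1} \<subseteq> carrier (Kn n p q \<gamma>)"
      using kq_Int by (auto intro!: K.m_closed)
    from in_own_span[OF this] e show ?case by auto
  qed
  note w = this
  show ?thesis
  proof
    fix a assume "a \<in> kq n p q \<gamma> ` deg_le n k"
    then obtain f where f: "f \<in> deg_le n k" "a = kq n p q \<gamma> f" by auto
    obtain c where "f = (\<Sum>w\<in>words n k. scal (c w) * Poly_Mapping.single w 1)"
      using deg_le_expand[OF f(1)] .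
    then show "a \<in> ?P k"
      using phi_in_subspace[OF subspace_power_subspace[OF order_refl] finite_words w] f(2) by simp
  qed
qed

lemma subspace_power_deg_le:
  "subspace_power class_ring (Kn n p q \<gamma>) (kq n p q \<gamma> ` deg_le n 1) k = kq n p q \<gamma> ` deg_le n k"
  using subspace_power_le[OF order_refl, of 1 k] subspace_power_ge[of k] by simp

text \<open>Finitely many generators have a common degree bound. Consequently the powers of any V in
  the supremum grow at most like the degree filtration with a linearly rescaled index.\<close>

lemma fin_dim_subset_deg_le:
  assumes "fin_dim_subspace class_ring (Kn n p q \<gamma>) W"
  obtains d where "W \<subseteq> kq n p q \<gamma> ` deg_le n d"
proof -
  have W: "VectorSpace.subspace class_ring W (Kn n p q \<gamma>)" "submodule class_ring W (Kn n p q \<gamma>)"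
    using assms by (simp_all add: fin_dim_subspace_def subspace_def)
  interpret W: vectorspace "class_ring :: 'k ring" "vs W" by (rule subspace_is_vs[OF W(1)])
  obtain A where A: "finite A" "A \<subseteq> W" "W.span A = W"
    using assms by (auto simp: fin_dim_subspace_def W.fin_dim_def)
  then have span: "span A = W" using span_li_not_depend(1)[OF A(2) W(2)] by simp
  have "\<exists>d. a \<in> kq n p q \<gamma> ` deg_le n d" if "a \<in> A" for a
  proof -
    have "a \<in> carrier (Kn n p q \<gamma>)" using that A(2) submodule.subset[OF W(2)] by blast
    then obtain f where f: "f \<in> carrier (free_alg n)" "a = kq n p q \<gamma> f" using kq_surj by blast
    obtain k where "f \<in> deg_le n k" using carrier_deg_le[OF f(1)] .
    then show ?thesis using f(2) by blast
  qed
  then obtain d where d: "\<And>a. a \<in> A \<Longrightarrow> a \<in> kq n p q \<gamma> ` deg_le n (d a)" by metis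
  have "A \<subseteq> kq n p q \<gamma> ` deg_le n (\<Sum>a\<in>A. d a)"
  proof
    fix a assume "a \<in> A"
    then show "a \<in> kq n p q \<gamma> ` deg_le n (\<Sum>a\<in>A. d a)"
      using d[of a] deg_le_mono[of _ n "d a"] member_le_sum[of a A d] A(1) by blast
  qed
  then show ?thesis using that span_subset_deg_le span by blast
qed

end

subsection \<open>Sorted words span\<close>

text \<open>Y i must precede X i: the relation for x_i y_i then rewrites it into y_i x_i and terms
  y_l x_l with l < i, all of which begin with a smaller letter than X i.\<close>

fun gord :: "gen \<Rightarrow> nat"
  where "gord (Y i) = 2 * i" | "gord (X i) = 2 * i + 1"

lemma gord_inj: "gord g = gord h \<Longrightarrow> g = h"
  by (cases g; cases h) (simp_all, presburger+)

definition sorted_words :: "nat \<Rightarrow> nat \<Rightarrow> gword set"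
  where "sorted_words n L = {w \<in> words n L. sorted (map gord (letters w))}"

lemma card_gens: "card (gens n) = 2 * n"
proof -
  have "card (X ` {1..n} \<union> Y ` {1..n}) = card (X ` {1..n}) + card (Y ` {1..n})"
    by (rule card_Un_disjoint) auto
  then show ?thesis by (simp add: gens_def card_image inj_on_def)
qed

text \<open>A sorted word is determined by how often each of the 2n letters occurs, and each count
  is at most L.\<close>

lemma card_sorted_words: "card (sorted_words n L) \<le> (L + 1) ^ (2 * n)"
proof -
  let ?c = "\<lambda>w. restrict (count_list (letters w)) (gens n)"
  have "inj_on ?c (sorted_words n L)"
  proof (rule inj_onI)
    fix v w assume v: "v \<in> sorted_words n L" and w: "w \<in> sorted_words n L" and c: "?c v = ?c w"
    have "count_list (letters v) g = count_list (letters w) g" for g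
    proof (cases "g \<in> gens n")
      case True
      then show ?thesis using fun_cong[OF c, of g] by simp
    next
      case False
      then have "g \<notin> set (letters v)" "g \<notin> set (letters w)"
        using v w by (auto simp: sorted_words_def words_def)
      then show ?thesis by simp
    qed
    then have "mset (letters v) = mset (letters w)" by (simp add: multiset_eq_iff count_mset)
    then have "mset (map gord (letters v)) = mset (map gord (letters w))" by simp
    then have "map gord (letters v) = map gord (letters w)"
      using v w by (metis (no_types, lifting) sorted_words_def mem_Collect_eq properties_for_sort)
    then have "letters v = letters w" by (rule map_injective) (auto simp: inj_def gord_inj)
    then show "v = w" by (rule gword.expand)
  qed
  moreover have "?c ` sorted_words n L \<subseteq> PiE (gens n) (\<lambda>_. {..L})"
    by (auto simp: sorted_words_def words_def intro: order_trans[OF count_le_length])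
  ultimately have "card (sorted_words n L) \<le> card (PiE (gens n) (\<lambda>_. {..L}))"
    by (intro card_inj_on_le finite_PiE finite_gens) auto
  then show ?thesis by (simp add: card_PiE finite_gens card_gens)
qed

lemma not_sorted_decomp:
  fixes f :: "'a \<Rightarrow> nat"
  assumes "\<not> sorted (map f xs)"
  obtains u g h v where "xs = u @ [g, h] @ v" "f h < f g"
proof -
  obtain i where i: "Suc i < length xs" "f (xs ! Suc i) < f (xs ! i)"
    using assms by (auto simp: sorted_iff_nth_Suc not_le)
  have "xs = take i xs @ xs ! i # xs ! Suc i # drop (Suc (Suc i)) xs"
    using i(1) by (simp add: Cons_nth_drop_Suc)
  then show ?thesis using that[of "take i xs" "xs ! i" "xs ! Suc i" "drop (Suc (Suc i)) xs"] i(2) by simp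
qed

context Kn_q1 begin

text \<open>Each relation rewrites a descending pair g h into pairs whose first letter is smaller
  than g. B is kept abstract so that the rewriting can be done inside a longer word.\<close>

lemma swap_letters:
  assumes B: "\<And>f g. f \<in> B \<Longrightarrow> g \<in> B \<Longrightarrow> f + g \<in> B" "\<And>c f. f \<in> B \<Longrightarrow> scal c * f \<in> B"
      "\<And>f g. f \<doteq> g \<Longrightarrow> g \<in> B \<Longrightarrow> f \<in> B"
    and less: "\<And>g' h'. \<lbrakk>g' \<in> gens n; h' \<in> gens n; gord g' < gord g\<rbrakk> \<Longrightarrow>
      Poly_Mapping.single (GWord [g', h']) 1 \<in> B"
    and gh: "g \<in> gens n" "h \<in> gens n" "gord h < gord g"
  shows "Poly_Mapping.single (GWord [g, h]) (1::'k) \<in> B"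
proof -
  let ?m = "\<lambda>g. Poly_Mapping.single (GWord [g]) (1::'k)"
  have m: "Poly_Mapping.single (GWord [g, h]) 1 = ?m g * ?m h" for g h
    by (simp add: mult_single plus_gword_def)
  have less': "?m g' * ?m h' \<in> B" if "g' \<in> gens n" "h' \<in> gens n" "gord g' < gord g" for g' h'
    using less[OF that] by (simp only: m)
  have qcB: "?m g * ?m h \<in> B" if "qc c (?m g) (?m h)" for c
    using that B(2)[OF less'[OF gh(2,1,3)], of c] B(3) by (simp add: qc_def)
  have sumB: "sum F {1..k} + a \<in> B" if a: "a \<in> B" and F: "\<And>l. l \<in> {1..k} \<Longrightarrow> F l \<in> B"
    for F :: "nat \<Rightarrow> 'k ncpoly" and k :: nat and a
    using F
  proof (induction k)
    case 0
    then show ?case using a by simp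
  next
    case (Suc k)
    have "sum F {1..k} + a \<in> B" by (rule Suc.IH) (use Suc.prems in auto)
    moreover have "F (Suc k) \<in> B" by (rule Suc.prems) simp
    moreover have "sum F {1..Suc k} + a = F (Suc k) + (sum F {1..k} + a)" by (simp add: algebra_simps)
    ultimately show ?case using B(1) by (simp only:)
  qed
  have "?m g * ?m h \<in> B"
  proof (cases g; cases h)
    fix i j assume g: "g = X i" "h = X j"
    then have "qc (inverse (inverse (p i) * \<gamma> j i)) (fx i) (fx j)"
      using gh p_nz \<gamma>_nz by (intro qc_sym qc_xx) (auto simp: gens_def)
    then show ?thesis using qcB g by blast
  next
    fix i j assume g: "g = Y i" "h = Y j"
    then have "qc (inverse (\<gamma> j i)) (fy i) (fy j)"
      using gh \<gamma>_nz by (intro qc_sym qc_yy) (auto simp: gens_def)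
    then show ?thesis using qcB g by blast
  next
    fix i j assume g: "g = Y i" "h = X j"
    then have "qc (inverse (p i * \<gamma> i j)) (fy i) (fx j)"
      using gh p_nz \<gamma>_nz by (intro qc_sym qc_xy_less) (auto simp: gens_def)
    then show ?thesis using qcB g by blast
  next
    fix i j assume g: "g = X i" "h = Y j"
    then have ij: "i \<in> {1..n}" "j \<in> {1..n}" "j \<le> i" using gh by (auto simp: gens_def)
    show ?thesis
    proof (cases "j = i")
      case False
      then have "qc (\<gamma> j i) (fx i) (fy j)" using ij by (intro qc_xy_greater) auto
      then show ?thesis using qcB g by blast
    next
      case True
      obtain k where k: "i = Suc k" using ij(1) by (cases i) auto
      have "fx i * fy i \<doteq> zf k + fy i * fx i"
        using xy_same[of k] ij by (simp add: k add.commute)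
      \<comment> \<open>This is the only relation with more than one term on the right; every term
        starts with Y l for some l \<le> i, hence before X i.\<close>
      moreover have "zf k + fy i * fx i \<in> B"
        unfolding zf_def using ij g k
        by (intro sumB B(2) less') (auto simp: gens_def)
      ultimately show ?thesis using B(3) g True by blast
    qed
  qed
  then show ?thesis by (simp only: m)
qed

text \<open>Rewriting a descending pair keeps the length and lowers the word lexicographically, so
  it terminates. Since the length never grows, the degree bound L is respected.\<close>

lemma sorted_words_span:
  assumes B: "\<And>f g. f \<in> B \<Longrightarrow> g \<in> B \<Longrightarrow> f + g \<in> B" "\<And>c f. f \<in> B \<Longrightarrow> scal c * f \<in> B"
      "\<And>f g. f \<doteq> g \<Longrightarrow> g \<in> B \<Longrightarrow> f \<in> B"
    and sorted: "\<And>w. w \<in> sorted_words n L \<Longrightarrow> Poly_Mapping.single w 1 \<in> B"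
    and "w \<in> words n L"
  shows "Poly_Mapping.single w (1::'k) \<in> B"
  using assms(5)
proof (induction "map gord (letters w)" arbitrary: w rule: wf_induct_rule[OF wf_lenlex[OF wf_less_than]])
  case (1 w)
  let ?s = "\<lambda>xs. Poly_Mapping.single (GWord xs) (1::'k)"
  show ?case
  proof (cases "sorted (map gord (letters w))")
    case True
    then show ?thesis using sorted 1 by (simp add: sorted_words_def)
  next
    case False
    then obtain u g h v where w: "letters w = u @ [g, h] @ v" "gord h < gord g"
      using not_sorted_decomp[of gord "letters w"] by metis
    have sub: "set u \<subseteq> gens n" "set v \<subseteq> gens n" "g \<in> gens n" "h \<in> gens n" "length u + length v + 2 \<le> L"
      using 1(2) w(1) by (auto simp: words_def)
    \<comment> \<open>The context of the pair is absorbed into the set to which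
      \<open>swap_letters\<close> is applied.\<close>
    let ?B = "{f. ?s u * f * ?s v \<in> B}"
    have s: "?s u * ?s [g, h] * ?s v = ?s (u @ [g, h] @ v)" for g h
      by (simp add: mult_single plus_gword_def)
    have "?s [g, h] \<in> ?B"
    proof (rule swap_letters[where g = g and h = h])
      fix g' h' assume g': "g' \<in> gens n" "h' \<in> gens n" "gord g' < gord g"
      have "?s (u @ [g', h'] @ v) \<in> B"
      proof (rule 1(1))
        have "(map gord (u @ [g', h'] @ v), map gord (u @ [g, h] @ v)) \<in> lex less_than"
          unfolding map_append by (rule lex_append_leftI) (simp add: g')
        then show "(map gord (letters (GWord (u @ [g', h'] @ v))), map gord (letters w)) \<in> lenlex less_than"
          unfolding w(1) by (simp add: lenlex_conv)
        show "GWord (u @ [g', h'] @ v) \<in> words n L"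
          using sub g' by (simp add: words_def)
      qed
      then show "?s [g', h'] \<in> ?B" by (simp only: s mem_Collect_eq)
    next
      fix f f' assume "f \<doteq> f'" "f' \<in> ?B"
      then show "f \<in> ?B" using B(3) eq_lmult eq_rmult by blast
    next
      fix c f assume "f \<in> ?B"
      then show "scal c * f \<in> ?B" using B(2)[of "?s u * f * ?s v" c] by (simp add: sc_left[of "?s u"] mult.assoc)
    qed (use B(1) sub w in \<open>auto simp: distrib_left distrib_right\<close>)
    then show ?thesis unfolding mem_Collect_eq s using w(1) by (metis gword.collapse)
  qed
qed

lemma dim_le_sorted_words:
  assumes U: "VectorSpace.subspace class_ring U (Kn n p q \<gamma>)" "U \<subseteq> kq n p q \<gamma> ` deg_le n L"
  shows "fin_dim_subspace class_ring (Kn n p q \<gamma>) U"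
    and "subspace_dim class_ring (Kn n p q \<gamma>) U \<le> (L + 1) ^ (2 * n)"
proof -
  interpret K: lin_image "Kn n p q \<gamma>" "kq n p q \<gamma>" by (rule lin_image_kq)
  let ?T = "kq n p q \<gamma> ` (\<lambda>w. Poly_Mapping.single w 1) ` sorted_words n L"
  have fin: "finite (sorted_words n L)" using finite_words by (simp add: sorted_words_def)
  have T: "finite ?T" "?T \<subseteq> carrier (Kn n p q \<gamma>)" using fin kq_closed by auto
  have sT: "VectorSpace.subspace class_ring (K.span ?T) (Kn n p q \<gamma>)" by (rule K.span_is_subspace[OF T(2)])
  then have sm: "submodule class_ring (K.span ?T) (Kn n p q \<gamma>)" by (simp add: subspace_def)
  have w: "Poly_Mapping.single w 1 \<in> {f. kq n p q \<gamma> f \<in> K.span ?T}" if "w \<in> words n L" for w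
  proof (rule sorted_words_span[OF _ _ _ _ that])
    fix f g assume "f \<doteq> g" "g \<in> {f. kq n p q \<gamma> f \<in> K.span ?T}"
    moreover have "kq n p q \<gamma> f = kq n p q \<gamma> (f - g) \<oplus>\<^bsub>Kn n p q \<gamma>\<^esub> kq n p q \<gamma> g"
      by (simp flip: kq_add)
    ultimately show "f \<in> {f. kq n p q \<gamma> f \<in> K.span ?T}"
      using kq_eq_0[of n p q \<gamma> "f - g"] submodule.m_closed[OF sm submodule.zero_closed[OF sm]]
      by (simp add: eqI_def)
  next
    fix w assume "w \<in> sorted_words n L"
    then show "Poly_Mapping.single w 1 \<in> {f. kq n p q \<gamma> f \<in> K.span ?T}"
      using K.in_own_span[OF T(2)] by auto
  qed (use submodule.m_closed[OF sm] submodule.smult_closed[OF sm] in \<open>auto simp: kq_add kq_smult\<close>)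
  have "kq n p q \<gamma> f \<in> K.span ?T" if f: "f \<in> deg_le n L" for f
  proof -
    obtain c where "f = (\<Sum>w\<in>words n L. scal (c w) * Poly_Mapping.single w 1)"
      using deg_le_expand[OF f] .
    then show ?thesis using K.phi_in_subspace[OF sT finite_words] w by auto
  qed
  then have "U \<subseteq> K.span ?T" using U(2) by auto
  note * = K.subspace_of_finite_span[OF U(1) T this]
  show "fin_dim_subspace class_ring (Kn n p q \<gamma>) U" using U(1) *(1) by (simp add: fin_dim_subspace_def)
  have "card ?T \<le> card (sorted_words n L)"
    using fin by (metis (no_types, lifting) card_image_le finite_imageI order_trans)
  then show "subspace_dim class_ring (Kn n p q \<gamma>) U \<le> (L + 1) ^ (2 * n)"
    using *(2) card_sorted_words[of n L] by (simp add: subspace_dim_def)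
qed

end

subsection \<open>A representation by weighted shifts\<close>

text \<open>The first argument records the shifts by the z's, the second those by the x's.\<close>

type_synonym 'k lattice_fun = "(nat \<Rightarrow>\<^sub>0 int) \<Rightarrow> (nat \<Rightarrow>\<^sub>0 int) \<Rightarrow> 'k"

context Kn_q1 begin

abbreviation e :: "nat \<Rightarrow> nat \<Rightarrow>\<^sub>0 int" where "e i \<equiv> Poly_Mapping.single i 1"
abbreviation e' :: "nat \<Rightarrow> nat \<Rightarrow>\<^sub>0 int" where "e' i \<equiv> Poly_Mapping.single i (- 1)"

lemma e_e' [simp]: "e i + e' i = 0" "e' i + e i = 0" "a + e i + e' i = a" "a + e' i + e i = a"
  by (simp_all add: add.assoc flip: single_add)

text \<open>A character of the lattice, with values at the unit vectors read off from x_i z_j = p_i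
  z_j x_i and x_j x_i = p_i^-1 \<gamma>_ji x_i x_j for j < i. Coordinates of index at least i do not
  enter.\<close>

definition cf :: "nat \<Rightarrow> (nat \<Rightarrow>\<^sub>0 int) \<Rightarrow> (nat \<Rightarrow>\<^sub>0 int) \<Rightarrow> 'k"
  where "cf i a b = (\<Prod>j\<in>{1..<i}. inverse (p i) powi Poly_Mapping.lookup a j *
    (inverse (p i) * \<gamma> j i) powi Poly_Mapping.lookup b j)"

definition yc :: "nat \<Rightarrow> (nat \<Rightarrow>\<^sub>0 int) \<Rightarrow> (nat \<Rightarrow>\<^sub>0 int) \<Rightarrow> 'k"
  where "yc i a b = inverse ((1 - p i) * cf i a b)"

lemma cf_nz: "i \<in> {1..n} \<Longrightarrow> cf i a b \<noteq> 0"
  using p_nz[of i] \<gamma>_nz[of _ i] by (auto simp: cf_def)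

lemma cf_add:
  "i \<in> {1..n} \<Longrightarrow> cf i (a + a') (b + b') = cf i a b * cf i a' b'"
  unfolding cf_def prod.distrib[symmetric] using p_nz[of i] \<gamma>_nz[of _ i]
  by (intro prod.cong refl) (auto simp: lookup_add power_int_add mult_ac)

lemma cf_e: "cf i (e j) 0 = (if j \<in> {1..<i} then inverse (p i) else 1)"
proof -
  have "cf i (e j) 0 = (\<Prod>k\<in>{1..<i}. if k = j then inverse (p i) else 1)"
    unfolding cf_def by (intro prod.cong refl) (auto simp: lookup_single when_def)
  then show ?thesis by simp
qed

lemma cf_e2: "cf i 0 (e j) = (if j \<in> {1..<i} then inverse (p i) * \<gamma> j i else 1)"
proof -
  have "cf i 0 (e j) = (\<Prod>k\<in>{1..<i}. if k = j then inverse (p i) * \<gamma> j i else 1)"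
    unfolding cf_def by (intro prod.cong refl) (auto simp: lookup_single when_def)
  then show ?thesis by simp
qed

lemma cf_e2': "i \<in> {1..n} \<Longrightarrow> cf i 0 (e' j) = (if j \<in> {1..<i} then p i * \<gamma> i j else 1)"
proof -
  assume i: "i \<in> {1..n}"
  have "cf i 0 (e' j) = (\<Prod>k\<in>{1..<i}. if k = j then inverse (inverse (p i) * \<gamma> j i) else 1)"
    unfolding cf_def
    by (intro prod.cong refl) (auto simp: lookup_single when_def power_int_minus)
  then show ?thesis using i \<gamma>_inv[of j i] by auto
qed

context
  fixes i assumes i: "i \<in> {1..n}"
begin

lemma cf_shift:
  "cf i (a + e j) b = (if j \<in> {1..<i} then inverse (p i) else 1) * cf i a b"
  "cf i a (b + e j) = (if j \<in> {1..<i} then inverse (p i) * \<gamma> j i else 1) * cf i a b"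
  "cf i a (b + e' j) = (if j \<in> {1..<i} then p i * \<gamma> i j else 1) * cf i a b"
  using cf_add[OF i, of a "e j" b 0] cf_add[OF i, of a 0 b "e j"] cf_add[OF i, of a 0 b "e' j"]
  by (simp_all only: cf_e cf_e2 cf_e2'[OF i] add_0_right mult.commute)

lemma yc_shift:
  "yc i (a + e j) b = (if j \<in> {1..<i} then p i else 1) * yc i a b"
  "yc i a (b + e j) = (if j \<in> {1..<i} then p i * \<gamma> i j else 1) * yc i a b"
  "yc i a (b + e' j) = (if j \<in> {1..<i} then inverse (p i) * \<gamma> j i else 1) * yc i a b"
  unfolding yc_def cf_shift using \<gamma>_inv[of j i] \<gamma>_inv[of i j] i
  by (auto simp: mult_ac)

lemma cf_yc: "cf i a b * yc i a b = inverse (1 - p i)" "yc i a b * cf i a b = inverse (1 - p i)"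
  using cf_nz[OF i, of a b] by (simp_all add: yc_def)

end

text \<open>With z_i acting as the shift by \<open>e i\<close> in the first argument, the formula
  for Y i is (z_i - z_{i-1}) x_i^-1 / (1 - p_i). The factor \<open>p i\<close> arises because the
  shift by \<open>e (i - 1)\<close> changes the weight of x_i^-1, and the case i = 1 reflects z_0 =
  0.\<close>

fun act_gen :: "gen \<Rightarrow> 'k lattice_fun \<Rightarrow> 'k lattice_fun" where
  "act_gen (X i) F = (\<lambda>a b. cf i a b * F a (b + e i))"
| "act_gen (Y i) F = (\<lambda>a b. yc i a b *
    (F (a + e i) (b + e' i) - (if i = 1 then 0 else p i * F (a + e (i - 1)) (b + e' i))))"

lemma act_gen_linear:
  "act_gen g (\<lambda>a b. F a b + G a b) = (\<lambda>a b. act_gen g F a b + act_gen g G a b)"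
  "act_gen g (\<lambda>a b. c * F a b) = (\<lambda>a b. c * act_gen g F a b)"
  by (cases g; simp add: fun_eq_iff algebra_simps)+

definition act_word :: "gword \<Rightarrow> 'k lattice_fun \<Rightarrow> 'k lattice_fun"
  where "act_word w F = foldr act_gen (letters w) F"

lemma act_word_linear:
  "act_word w (\<lambda>a b. F a b + G a b) = (\<lambda>a b. act_word w F a b + act_word w G a b)"
  "act_word w (\<lambda>a b. c * F a b) = (\<lambda>a b. c * act_word w F a b)"
proof -
  have "foldr act_gen gs (\<lambda>a b. F a b + G a b) = (\<lambda>a b. foldr act_gen gs F a b + foldr act_gen gs G a b)"
    "foldr act_gen gs (\<lambda>a b. c * F a b) = (\<lambda>a b. c * foldr act_gen gs F a b)" for gs
    by (induction gs) (simp_all add: act_gen_linear)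
  then show "act_word w (\<lambda>a b. F a b + G a b) = (\<lambda>a b. act_word w F a b + act_word w G a b)"
    "act_word w (\<lambda>a b. c * F a b) = (\<lambda>a b. c * act_word w F a b)"
    by (simp_all add: act_word_def)
qed

lemma act_word_zero: "act_word w (\<lambda>a b. 0) = (\<lambda>a b. 0)"
  using act_word_linear(2)[of w 0 "\<lambda>a b. 0"] by simp

lemma act_word_add: "act_word (u + v) F = act_word u (act_word v F)"
  by (simp add: act_word_def plus_gword_def)

definition act :: "'k ncpoly \<Rightarrow> 'k lattice_fun \<Rightarrow> 'k lattice_fun"
  where "act f F = (\<lambda>a b. \<Sum>w\<in>Poly_Mapping.keys f. Poly_Mapping.lookup f w * act_word w F a b)"

lemma act_superset:
  assumes "finite S" "Poly_Mapping.keys f \<subseteq> S"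
  shows "act f F a b = (\<Sum>w\<in>S. Poly_Mapping.lookup f w * act_word w F a b)"
  unfolding act_def using assms by (intro sum.mono_neutral_left) (auto simp: in_keys_iff)

lemma act_0: "act 0 F = (\<lambda>a b. 0)"
  by (simp add: act_def)

lemma act_add: "act (f + g) F = (\<lambda>a b. act f F a b + act g F a b)"
proof (intro ext)
  fix a b
  let ?S = "Poly_Mapping.keys f \<union> Poly_Mapping.keys g"
  have "Poly_Mapping.keys (f + g) \<subseteq> ?S" by (rule Poly_Mapping.keys_add)
  then show "act (f + g) F a b = act f F a b + act g F a b"
    using act_superset[of ?S f F a b] act_superset[of ?S g F a b] act_superset[of ?S "f + g" F a b]
    by (simp add: lookup_add distrib_right sum.distrib)
qed

lemma act_single: "act (Poly_Mapping.single w c) F = (\<lambda>a b. c * act_word w F a b)"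
  by (intro ext, subst act_superset[of "{w}"]) auto

lemma act_mult: "act (f * g) F = act f (act g F)"
proof (induction f rule: poly_mapping_induct_single)
  case (single u c)
  show ?case
  proof (induction g rule: poly_mapping_induct_single)
    case (single v d)
    show ?case by (simp add: mult_single act_single act_word_add act_word_linear mult_ac)
  qed (simp_all add: act_0 act_add distrib_left act_single act_word_linear act_word_zero)
qed (simp_all add: act_0 act_add distrib_right)

lemma act_scal: "act (scal c) F = (\<lambda>a b. c * F a b)"
  by (simp add: act_single act_word_def zero_gword_def)

lemma act_1: "act 1 F = F"
  using act_scal[of 1 F] by simp

lemma act_x: "act (fx i) F = act_gen (X i) F" and act_y: "act (fy i) F = act_gen (Y i) F"
  by (simp_all add: act_single act_word_def)

lemma act_minus: "act (- f) F = (\<lambda>a b. - act f F a b)"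
proof -
  have "- f = scal (- 1) * f" by (simp add: single_uminus)
  then show ?thesis by (simp only: act_mult act_scal) simp
qed

lemma act_diff: "act (f - g) F = (\<lambda>a b. act f F a b - act g F a b)"
  using act_add[of f "- g" F] by (simp add: act_minus)

lemma act_sum: "act (sum f S) F a b = (\<Sum>s\<in>S. act (f s) F a b)"
  by (induction S rule: infinite_finite_induct) (simp_all add: act_0 act_add)

lemma act_yx:
  assumes i: "i \<in> {1..n}"
  shows "act (scal (1 - p i) * (fy i * fx i)) F a b
    = F (a + e i) b - (if i = 1 then 0 else F (a + e (i - 1)) b)"
proof -
  have "act (scal (1 - p i) * (fy i * fx i)) F a b = (1 - p i) * (yc i a b * cf i a b) *
      (F (a + e i) b - (if i = 1 then 0 else F (a + e (i - 1)) b))"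
  proof (cases "i = 1")
    case False
    then have "i - 1 \<in> {1..<i}" using i by auto
    then show ?thesis using False p_nz[OF i]
      by (simp add: act_mult act_scal act_x act_y cf_shift[OF i] field_simps)
  next
    case True
    then show ?thesis using i by (simp add: act_mult act_scal act_x act_y cf_shift)
  qed
  then show ?thesis using p_ne_1[OF i] by (simp add: cf_yc[OF i])
qed

text \<open>The differences of shifts from \<open>act_yx\<close> telescope, so z_i acts as a shift
  with weight 1.\<close>

lemma act_zf: "i \<le> n \<Longrightarrow> act (zf i) F a b = (if i = 0 then 0 else F (a + e i) b)"
proof (induction i)
  case (Suc i)
  then show ?case using act_yx[of "Suc i" F a b] by (simp add: zf_Suc act_add)
qed (simp add: act_0)

lemma act_relator:
  assumes "f \<in> Kn_relators n p q \<gamma>"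
  shows "act f F = (\<lambda>a b. 0)"
proof (intro ext)
  fix a b
  consider
    (xx) i j where "i \<in> {1..n}" "j \<in> {1..n}" "i < j"
      "f = fx i * fx j - scal (q i * inverse (p j) * \<gamma> i j) * fx j * fx i"
  | (yy) i j where "i \<in> {1..n}" "j \<in> {1..n}" "i < j" "f = fy i * fy j - scal (\<gamma> i j) * fy j * fy i"
  | (xyl) i j where "i \<in> {1..n}" "j \<in> {1..n}" "i < j"
      "f = fx i * fy j - scal (p j * inverse (\<gamma> i j)) * fy j * fx i"
  | (xyg) i j where "i \<in> {1..n}" "j \<in> {1..n}" "i > j"
      "f = fx i * fy j - scal (q j * inverse (\<gamma> i j)) * fy j * fx i"
  | (xy) i where "i \<in> {1..n}"
      "f = fx i * fy i - scal (q i) * fy i * fx i - (\<Sum>l\<in>{1..<i}. scal (q l - p l) * fy l * fx l)"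
    using assms unfolding Kn_relators_def by blast
  then show "act f F a b = 0"
  proof cases
    case xx
    show ?thesis
      unfolding xx(4) using xx(1-3) q1 by (simp add: act_diff act_mult act_scal act_x cf_shift add_ac)
  next
    case yy
    \<comment> \<open>Here i \<le> j - 1, so the weight of y_i does not see the shift by
      \<open>e (j - 1)\<close>. The weight of y_j does see the shift by \<open>e (i - 1)\<close>,
      except for i = 1, where this shift is absent.\<close>
    then have "j - 1 \<notin> {1..<i}" "j \<noteq> 1" by auto
    then show ?thesis
    proof (cases "i = 1")
      case True
      then show ?thesis
        unfolding yy(4) using yy(1-3) p_nz[of j] \<open>j \<noteq> 1\<close>
        by (simp add: act_diff act_mult act_scal act_y yc_shift add_ac field_simps)
    next
      case False
      then have "i - 1 \<in> {1..<j}" using yy by auto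
      then show ?thesis
        unfolding yy(4) using yy(1-3) p_nz[of j] \<open>j \<noteq> 1\<close> \<open>j - 1 \<notin> {1..<i}\<close> False
        by (simp add: act_diff act_mult act_scal act_y yc_shift add_ac field_simps)
    qed
  next
    case xyl
    then have "j - 1 \<notin> {1..<i}" "j \<noteq> 1" by auto
    then show ?thesis
      unfolding xyl(4) using xyl(1-3) \<gamma>_inv[of i j]
      by (simp add: act_diff act_mult act_scal act_x act_y yc_shift cf_shift add_ac algebra_simps)
  next
    case xyg
    show ?thesis
    proof (cases "j = 1")
      case True
      then show ?thesis
        unfolding xyg(4) using xyg(1-3) q1 p_nz[of i] \<gamma>_nz[of i j]
        by (simp add: act_diff act_mult act_scal act_x act_y yc_shift cf_shift add_ac field_simps)
    next
      case False
      then have "j - 1 \<in> {1..<i}" using xyg by auto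
      then show ?thesis
        unfolding xyg(4) using xyg(1-3) q1 p_nz[of i] \<gamma>_nz[of i j] False
        by (simp add: act_diff act_mult act_scal act_x act_y yc_shift cf_shift add_ac field_simps)
    qed
  next
    case xy
    have "(\<Sum>l\<in>{1..<i}. scal (q l - p l) * fy l * fx l) = zf (i - 1)"
      unfolding zf_def by (intro sum.cong) (use xy(1) q1 in \<open>auto simp: mult.assoc\<close>)
    then have f: "f = fx i * fy i - fy i * fx i - zf (i - 1)" using xy q1 by simp
    have "act (fx i * fy i) F a b - act (fy i * fx i) F a b
        = (1 - p i) * (cf i a b * yc i a b) * (if i = 1 then 0 else F (a + e (i - 1)) b)"
    proof (cases "i = 1")
      case True
      then show ?thesis using xy(1) by (simp add: act_mult act_x act_y yc_shift cf_shift algebra_simps)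
    next
      case False
      then have "i - 1 \<in> {1..<i}" using xy(1) by auto
      then show ?thesis using False xy(1) p_nz[of i]
        by (simp add: act_mult act_x act_y yc_shift cf_shift algebra_simps)
    qed
    also have "\<dots> = act (zf (i - 1)) F a b"
    proof -
      obtain k where "i = Suc k" using xy(1) by (cases i) auto
      then show ?thesis
        using xy(1) p_ne_1[of i] act_zf[of k F a b] by (simp add: cf_yc act_0)
    qed
    finally show ?thesis by (simp add: f act_diff)
  qed
qed

text \<open>The elements of the carrier acting as zero form an ideal containing the relators.
  Projection by \<open>restr\<close> is essential: letters of foreign index lie in
  \<open>Kn_kernel\<close>, but need not act as zero.\<close>

lemma act_kernel:
  assumes "f \<in> Kn_kernel n p q \<gamma>" shows "act (restr n f) F = (\<lambda>a b. 0)"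
proof -
  let ?A = "free_alg n :: 'k ncpoly ring"
  let ?K = "{f \<in> carrier ?A. \<forall>F. act f F = (\<lambda>a b. 0)}"
  interpret A: ring ?A by (rule ring_free_alg)
  have "ideal ?K ?A"
  proof (rule idealI[OF ring_free_alg])
    show "subgroup ?K (add_monoid ?A)"
    proof (rule A.add.subgroupI)
      show "?K \<noteq> {}" using A.zero_closed by (force simp: free_alg_simps act_0)
    next
      fix f assume f: "f \<in> ?K"
      then have "\<ominus>\<^bsub>?A\<^esub> f \<oplus>\<^bsub>?A\<^esub> f = \<zero>\<^bsub>?A\<^esub>" by (intro A.l_neg) simp
      then have "\<ominus>\<^bsub>?A\<^esub> f = - f" by (simp add: free_alg_simps eq_neg_iff_add_eq_0)
      then show "\<ominus>\<^bsub>?A\<^esub> f \<in> ?K" using f A.a_inv_closed[of f] by (auto simp: act_minus)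
    next
      fix f g assume "f \<in> ?K" "g \<in> ?K"
      then show "f \<oplus>\<^bsub>?A\<^esub> g \<in> ?K" using A.a_closed[of f g] by (simp add: free_alg_simps act_add)
    qed auto
  next
    fix f g assume f: "f \<in> ?K" "g \<in> carrier ?A"
    have z: "act g (\<lambda>a b. 0) = (\<lambda>a b. 0)" for g by (simp add: act_def act_word_zero)
    show "g \<otimes>\<^bsub>?A\<^esub> f \<in> ?K" using f A.m_closed[of g f] by (simp add: free_alg_simps act_mult z)
    show "f \<otimes>\<^bsub>?A\<^esub> g \<in> ?K" using f A.m_closed[of f g] by (simp add: free_alg_simps act_mult)
  qed
  moreover have "Kn_relators n p q \<gamma> \<subseteq> ?K" using Kn_relators_closed act_relator by blast
  ultimately have "Kn_ideal n p q \<gamma> \<subseteq> ?K" unfolding Kn_ideal_def by (rule A.genideal_minimal)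
  then show ?thesis using assms by (auto simp: Kn_kernel_def)
qed

end

subsection \<open>Independence of the monomials in the normal elements and the x-generators\<close>

lemma wmono_append:
  "length ts = length a \<Longrightarrow> wmono (ts @ ts') (a @ b) = wmono ts a * wmono ts' b"
  by (simp add: wmono_def)

lemma deg_le_wmono:
  assumes "set ts \<subseteq> deg_le n d" "set a \<subseteq> {..<s}"
  shows "wmono ts a \<in> deg_le n (d * s * length ts)"
  using assms
proof (induction ts arbitrary: a)
  case (Cons t ts)
  show ?case
  proof (cases a)
    case Nil
    then show ?thesis by (simp add: wmono_def deg_le_1)
  next
    case (Cons k b)
    then have "t ^ k * wmono ts b \<in> deg_le n (d * k + d * s * length ts)"
      using Cons.prems by (intro deg_le_mult deg_le_power Cons.IH) auto
    moreover have "d * k + d * s * length ts \<le> d * s * length (t # ts)"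
      using Cons Cons.prems(2) by (simp add: mult.assoc)
    ultimately have "t ^ k * wmono ts b \<in> deg_le n (d * s * length (t # ts))" by (rule deg_le_mono)
    then show ?thesis using Cons by (simp add: wmono_def)
  qed
qed (simp add: deg_le_1)

lemma sum_single_inj:
  assumes "length a = m" "length b = m"
    and "(\<Sum>i<m. Poly_Mapping.single (Suc i) (int (a ! i))) = (\<Sum>i<m. Poly_Mapping.single (Suc i) (int (b ! i)))"
  shows "a = b"
proof -
  have "Poly_Mapping.lookup (\<Sum>i<m. Poly_Mapping.single (Suc i) (int (a ! i))) (Suc k) = int (a ! k)"
    if "k < m" for a k
    using that by (simp add: lookup_sum lookup_single when_def)
  then show ?thesis using assms by (metis nth_equalityI of_nat_eq_iff)
qed

lemma (in lin_image) span_image_deg_le: "span (\<phi> ` deg_le n k) = \<phi> ` deg_le n k"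
proof
  show "span (\<phi> ` deg_le n k) \<subseteq> \<phi> ` deg_le n k"
    using image_deg_le[of n k] by (intro span_is_subset) (simp_all add: fin_dim_subspace_def subspace_def)
  show "\<phi> ` deg_le n k \<subseteq> span (\<phi> ` deg_le n k)"
    using phi_closed by (intro in_own_span) auto
qed

context Kn_q1 begin

lemma zf_deg_le: "i \<le> n \<Longrightarrow> zf i \<in> deg_le n 2"
  unfolding zf_def
proof (intro deg_le_sum deg_le_smult)
  fix l assume "i \<le> n" "l \<in> {1..i}"
  then show "fy l * fx l \<in> deg_le n 2"
    using deg_le_mult[OF deg_le_gens(2)[of l n] deg_le_gens(1)[of l n]] by (simp add: numeral_2_eq_2)
qed

text \<open>The weight may depend on the point but vanishes nowhere, so a monomial maps an indicator
  function of a point to a nonzero multiple of a shifted one.\<close>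

definition wshift :: "'k ncpoly \<Rightarrow> (nat \<Rightarrow>\<^sub>0 int) \<Rightarrow> (nat \<Rightarrow>\<^sub>0 int) \<Rightarrow> bool"
  where "wshift f u v \<longleftrightarrow>
    (\<exists>c. (\<forall>a b. c a b \<noteq> 0) \<and> (\<forall>F a b. act f F a b = c a b * F (a + u) (b + v)))"

lemma wshift_mult:
  assumes "wshift f u v" "wshift g u' v'" shows "wshift (f * g) (u + u') (v + v')"
proof -
  obtain c where c: "\<And>a b. c a b \<noteq> 0" "\<And>F a b. act f F a b = c a b * F (a + u) (b + v)"
    using assms(1) unfolding wshift_def by blast
  obtain d where d: "\<And>a b. d a b \<noteq> 0" "\<And>F a b. act g F a b = d a b * F (a + u') (b + v')"
    using assms(2) unfolding wshift_def by blast
  show ?thesis unfolding wshift_def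
    by (intro exI[of _ "\<lambda>a b. c a b * d (a + u) (b + v)"]) (simp add: c d act_mult add.assoc)
qed

lemma wshift_1: "wshift 1 0 0"
  unfolding wshift_def by (intro exI[of _ "\<lambda>a b. 1"]) (simp add: act_1)

lemma wshift_zf: "1 \<le> i \<Longrightarrow> i \<le> n \<Longrightarrow> wshift (zf i) (e i) 0"
  unfolding wshift_def by (intro exI[of _ "\<lambda>a b. 1"]) (simp add: act_zf)

lemma wshift_fx: "1 \<le> i \<Longrightarrow> i \<le> n \<Longrightarrow> wshift (fx i) 0 (e i)"
  unfolding wshift_def by (intro exI[of _ "cf i"]) (simp add: act_x cf_nz)

lemma wshift_power:
  "wshift f (e i) 0 \<Longrightarrow> wshift (f ^ k) (Poly_Mapping.single i (int k)) 0"
  "wshift f 0 (e i) \<Longrightarrow> wshift (f ^ k) 0 (Poly_Mapping.single i (int k))"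
proof (induction k)
  case (Suc k)
  {
    case 1
    then show ?case using wshift_mult[OF 1 Suc.IH(1)[OF 1]] by (simp flip: single_add)
  next
    case 2
    then show ?case using wshift_mult[OF 2 Suc.IH(2)[OF 2]] by (simp flip: single_add)
  }
qed (simp_all add: wshift_1)

lemma wshift_wmono:
  assumes "m \<le> n" "length a = m"
  shows "wshift (wmono (map zf [1..<Suc m]) a) (\<Sum>i<m. Poly_Mapping.single (Suc i) (int (a ! i))) 0"
    and "wshift (wmono (map fx [1..<Suc m]) a) 0 (\<Sum>i<m. Poly_Mapping.single (Suc i) (int (a ! i)))"
  using assms
proof (induction m arbitrary: a)
  case (Suc m)
  {
    case 1
    obtain b k where a: "a = b @ [k]" "length b = m" using 1(2) by (metis length_Suc_conv_rev)
    have "wshift (wmono (map zf [1..<Suc m]) b * zf (Suc m) ^ k)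
        ((\<Sum>i<m. Poly_Mapping.single (Suc i) (int (b ! i))) + Poly_Mapping.single (Suc m) (int k)) (0 + 0)"
      using 1(1) a(2) by (intro wshift_mult wshift_power wshift_zf Suc.IH) auto
    then show ?case using a by (simp add: wmono_snoc nth_append)
  next
    case 2
    obtain b k where a: "a = b @ [k]" "length b = m" using 2(2) by (metis length_Suc_conv_rev)
    have "wshift (wmono (map fx [1..<Suc m]) b * fx (Suc m) ^ k) (0 + 0)
        ((\<Sum>i<m. Poly_Mapping.single (Suc i) (int (b ! i))) + Poly_Mapping.single (Suc m) (int k))"
      using 2(1) a(2) by (intro wshift_mult wshift_power wshift_fx Suc.IH) auto
    then show ?case using a by (simp add: wmono_snoc nth_append)
  }
qed (simp_all add: wshift_1)

definition zx :: "'k ncpoly list"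
  where "zx = map zf [1..<Suc n] @ map fx [1..<Suc n]"

lemma zx_deg_le: "set zx \<subseteq> deg_le n 2"
  using zf_deg_le deg_le_mono[OF deg_le_gens(1), of _ n 2] by (auto simp: zx_def)

text \<open>Different exponent vectors give different shifts, so evaluation on one indicator
  function isolates one coefficient.\<close>

lemma zx_independent:
  assumes "kq n p q \<gamma> (\<Sum>a\<in>box (2 * n) s. scal (c a) * wmono zx a) = \<zero>\<^bsub>Kn n p q \<gamma>\<^esub>" "a \<in> box (2 * n) s"
  shows "c a = 0"
proof -
  let ?f = "\<Sum>a\<in>box (2 * n) s. scal (c a) * wmono zx a"
  let ?S = "\<lambda>a. \<Sum>i<n. Poly_Mapping.single (Suc i) (int (a ! i))"
  let ?U = "\<lambda>a. ?S (take n a)" let ?V = "\<lambda>a. ?S (drop n a)"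
  have "wmono zx b \<in> deg_le n (2 * s * length zx)" if "b \<in> box (2 * n) s" for b
    using that by (intro deg_le_wmono zx_deg_le) (simp add: box_def)
  then have "?f \<in> deg_le n (2 * s * length zx)" by (intro deg_le_sum deg_le_smult)
  then have "restr n ?f = ?f" by (intro restr_id deg_le_carrier)
  moreover have "?f \<in> Kn_kernel n p q \<gamma>" using assms(1) kq_eq_0 by blast
  ultimately have f0: "act ?f F = (\<lambda>a b. 0)" for F using act_kernel[of ?f F] by simp
  \<comment> \<open>The indicator of the point to which the monomial of exponent a shifts the
    origin; at the origin all other monomials give 0.\<close>
  let ?F = "\<lambda>u v. if u = ?U a \<and> v = ?V a then (1::'k) else 0"
  have ws: "wshift (wmono zx b) (?U b) (?V b)" if "b \<in> box (2 * n) s" for b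
  proof -
    have l: "length (take n b) = n" "length (drop n b) = n" using that by (auto simp: box_def)
    have "wmono zx b = wmono zx (take n b @ drop n b)" by simp
    also have "\<dots> = wmono (map zf [1..<Suc n]) (take n b) * wmono (map fx [1..<Suc n]) (drop n b)"
      unfolding zx_def by (rule wmono_append) (use l in simp)
    finally show ?thesis
      using wshift_mult[OF wshift_wmono(1)[OF order_refl l(1)] wshift_wmono(2)[OF order_refl l(2)]] by simp
  qed
  have other: "act (wmono zx b) ?F 0 0 = 0" if b: "b \<in> box (2 * n) s" "b \<noteq> a" for b
  proof -
    have l: "length (take n b) = n" "length (drop n b) = n" "length (take n a) = n" "length (drop n a) = n"
      using b assms(2) by (auto simp: box_def)
    have "\<not> (?U b = ?U a \<and> ?V b = ?V a)"
      using sum_single_inj[OF l(1,3)] sum_single_inj[OF l(2,4)] b(2) by (metis append_take_drop_id)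
    then show ?thesis using ws[OF b(1)] unfolding wshift_def by auto
  qed
  have "0 = act ?f ?F 0 0" by (simp add: f0)
  also have "\<dots> = (\<Sum>b\<in>box (2 * n) s. c b * act (wmono zx b) ?F 0 0)"
    by (simp add: act_sum act_mult act_scal)
  also have "\<dots> = (\<Sum>b\<in>{a}. c b * act (wmono zx b) ?F 0 0)"
    using other assms(2) by (intro sum.mono_neutral_right) auto
  finally have "c a * act (wmono zx a) ?F 0 0 = 0" by simp
  moreover have "act (wmono zx a) ?F 0 0 \<noteq> 0" using ws[OF assms(2)] unfolding wshift_def by auto
  ultimately show ?thesis by simp
qed

end

subsection \<open>Growth rates\<close>

lemma ln_real_at_top: "filterlim (\<lambda>k::nat. ln (real k)) at_top sequentially"
  by (rule filterlim_compose[OF ln_at_top filterlim_real_sequentially])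

text \<open>A bound along the progression k = E + C * s is enough for a limes superior. There k
  \<le> (E + C) * s, so ln k exceeds ln s by at most a constant, which is negligible in the
  limit.\<close>

lemma limsup_log_ge:
  fixes d :: "nat \<Rightarrow> nat"
  assumes "\<And>s. s \<ge> 1 \<Longrightarrow> s ^ N \<le> d (E + C * s)" "C \<ge> 1"
  shows "ereal (real N) \<le> limsup (\<lambda>k. ereal (log (real k) (real (d k))))"
proof -
  let ?X = "\<lambda>k. ereal (log (real k) (real (d k)))"
  let ?D = "real (E + C)"
  have "(\<lambda>s. real N * (1 - ln ?D / (ln ?D + ln (real s)))) \<longlonglongrightarrow> real N * (1 - 0)"
    by (intro tendsto_intros tendsto_divide_0[OF tendsto_const] filterlim_at_top_imp_at_infinity
        filterlim_tendsto_add_at_top[OF tendsto_const] ln_real_at_top)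
  then have lim: "(\<lambda>s. ereal (real N * (1 - ln ?D / (ln ?D + ln (real s))))) \<longlonglongrightarrow> ereal (real N)"
    by simp
  have le: "ereal (real N * (1 - ln ?D / (ln ?D + ln (real s)))) \<le> ?X (E + C * s)" if s: "s \<ge> 2" for s
  proof -
    let ?k = "E + C * s"
    have "s \<le> ?k" "?k \<le> (E + C) * s" using assms(2) s by (simp_all add: add_mult_distrib trans_le_add2)
    then have k: "real s \<le> real ?k" "real ?k \<le> ?D * real s"
      by (simp_all only: of_nat_le_iff flip: of_nat_mult)
    have D: "?D \<ge> 1" using assms(2) by simp
    have ln_s: "ln (real s) > 0" using s by simp
    have ln_k: "ln (real ?k) > 0" using k(1) s by simp
    have "ln (real ?k) \<le> ln (?D * real s)" using k s by (intro ln_mono) auto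
    also have "\<dots> = ln ?D + ln (real s)" using D s by (intro ln_mult_pos) auto
    finally have ln_le: "ln (real ?k) \<le> ln ?D + ln (real s)" .
    have "ln (real (s ^ N)) \<le> ln (real (d ?k))"
      using assms(1)[of s] s by (intro ln_mono) (auto simp flip: of_nat_power intro: less_le_trans[of 0 "s ^ N"])
    then have "real N * ln (real s) \<le> ln (real (d ?k))" using s by (simp add: ln_realpow)
    then have "log (real ?k) (real (d ?k)) \<ge> real N * ln (real s) / ln (real ?k)"
      using ln_k by (simp add: log_def divide_right_mono)
    moreover have "real N * ln (real s) / ln (real ?k) \<ge> real N * ln (real s) / (ln ?D + ln (real s))"
      using ln_le ln_k ln_s by (intro divide_left_mono) auto
    moreover have "real N * (1 - ln ?D / (ln ?D + ln (real s))) = real N * ln (real s) / (ln ?D + ln (real s))"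
      using ln_le ln_k by (simp add: field_simps)
    ultimately show ?thesis by simp
  qed
  have "ereal (real N) = limsup (\<lambda>s. ereal (real N * (1 - ln ?D / (ln ?D + ln (real s)))))"
    using lim_imp_Limsup[OF _ lim] by simp
  also have "\<dots> \<le> limsup (?X \<circ> (\<lambda>s. E + C * s))"
    by (rule Limsup_mono, rule eventually_mono[OF eventually_ge_at_top[of 2]], unfold o_def, rule le)
  also have "\<dots> \<le> limsup ?X"
    using assms(2) by (intro limsup_subseq_mono) (simp add: strict_mono_def)
  finally show ?thesis .
qed

lemma limsup_log_le:
  fixes d :: "nat \<Rightarrow> nat"
  assumes "\<And>k. d k \<le> (D * k + 1) ^ N"
  shows "limsup (\<lambda>k. ereal (log (real k) (real (d k)))) \<le> ereal (real N)"
proof -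
  let ?D = "real (D + 1)"
  have "(\<lambda>k. real N * (ln ?D / ln (real k) + 1)) \<longlonglongrightarrow> real N * (0 + 1)"
    by (intro tendsto_intros tendsto_divide_0[OF tendsto_const] filterlim_at_top_imp_at_infinity ln_real_at_top)
  then have lim: "(\<lambda>k. ereal (real N * (ln ?D / ln (real k) + 1))) \<longlonglongrightarrow> ereal (real N)" by simp
  have le: "ereal (log (real k) (real (d k))) \<le> ereal (real N * (ln ?D / ln (real k) + 1))" if k: "k \<ge> 2" for k
  proof -
    have ln_k: "ln (real k) > 0" using k by simp
    \<comment> \<open>The summand 1 is absorbed into the slope, which leaves a pure power of k times
      a constant.\<close>
    have "D * k + 1 \<le> (D + 1) * k" using k by simp
    then have "(D * k + 1) ^ N \<le> ((D + 1) * k) ^ N" by (rule power_mono) simp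
    then have dk: "d k \<le> ((D + 1) * k) ^ N" using assms[of k] by simp
    have "ln (real (d k)) \<le> real N * (ln ?D + ln (real k))"
    proof (cases "d k = 0")
      case True
      then show ?thesis using ln_k by simp
    next
      case False
      have "real (d k) \<le> real (((D + 1) * k) ^ N)" using dk by (simp only: of_nat_le_iff)
      then have "ln (real (d k)) \<le> ln (real (((D + 1) * k) ^ N))" using False by (intro ln_mono) auto
      also have "\<dots> = ln ((?D * real k) ^ N)" by (simp only: of_nat_power of_nat_mult)
      also have "\<dots> = real N * ln (?D * real k)" by (rule ln_realpow)
      also have "\<dots> = real N * (ln ?D + ln (real k))" using k by (simp add: ln_mult_pos)
      finally show ?thesis .
    qed
    then have "ln (real (d k)) / ln (real k) \<le> real N * (ln ?D + ln (real k)) / ln (real k)"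
      using ln_k by (intro divide_right_mono) auto
    then show ?thesis using ln_k by (simp add: log_def field_simps)
  qed
  have "limsup (\<lambda>k. ereal (log (real k) (real (d k))))
      \<le> limsup (\<lambda>k. ereal (real N * (ln ?D / ln (real k) + 1)))"
    by (rule Limsup_mono, rule eventually_mono[OF eventually_ge_at_top[of 2]], rule le)
  also have "\<dots> = ereal (real N)" using lim_imp_Limsup[OF _ lim] by simp
  finally show ?thesis .
qed

theorem (in Kn_q1) GKdim_Kn: "GKdim_algebra class_ring (Kn n p q \<gamma>) = ereal (real (2 * n))"
proof (rule antisym)
  interpret K: lin_image "Kn n p q \<gamma>" "kq n p q \<gamma>" by (rule lin_image_kq)
  show "GKdim_algebra class_ring (Kn n p q \<gamma>) \<le> ereal (real (2 * n))"
    unfolding GKdim_algebra_def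
  proof (rule SUP_least)
    fix V assume "V \<in> {V. fin_dim_subspace class_ring (Kn n p q \<gamma>) V \<and> \<one>\<^bsub>Kn n p q \<gamma>\<^esub> \<in> V}"
    then obtain D where D: "V \<subseteq> kq n p q \<gamma> ` deg_le n D" using fin_dim_subset_deg_le by blast
    show "limsup (\<lambda>k. ereal (log (real k) (real (subspace_dim class_ring (Kn n p q \<gamma>)
        (subspace_power class_ring (Kn n p q \<gamma>) V k))))) \<le> ereal (real (2 * n))"
      by (rule limsup_log_le[of _ D])
        (rule dim_le_sorted_words(2)[OF subspace_power_subspace[OF D] subspace_power_le[OF D]])
  qed
  let ?V = "kq n p q \<gamma> ` deg_le n 1"
  have "\<one>\<^bsub>Kn n p q \<gamma>\<^esub> \<in> ?V" by (auto simp: deg_le_1 simp flip: kq_1)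
  moreover have "ereal (real (2 * n)) \<le> limsup (\<lambda>k. ereal (log (real k) (real
      (subspace_dim class_ring (Kn n p q \<gamma>) (subspace_power class_ring (Kn n p q \<gamma>) ?V k)))))"
    unfolding subspace_power_deg_le
  proof (rule limsup_log_ge)
    fix s :: nat
    \<comment> \<open>There are 2n factors of degree at most 2 with exponents below s, hence degree
      at most 4 * n * s. The extra 1 makes the factor of s positive for every n.\<close>
    let ?L = "0 + (4 * n + 1) * s"
    have "wmono zx a \<in> deg_le n ?L" if "a \<in> box (2 * n) s" for a
      using deg_le_wmono[OF zx_deg_le, of a s] that
      by (auto simp: box_def zx_def algebra_simps elim!: deg_le_mono)
    then have "card (box (2 * n) s) \<le> subspace_dim class_ring (Kn n p q \<gamma>) (kq n p q \<gamma> ` deg_le n ?L)"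
      by (intro K.card_le_dim[OF K.image_deg_le finite_box, of _ _ "wmono zx"] zx_independent) auto
    then show "s ^ (2 * n) \<le> subspace_dim class_ring (Kn n p q \<gamma>) (kq n p q \<gamma> ` deg_le n ?L)"
      by (simp add: card_box)
  qed simp
  ultimately show "ereal (real (2 * n)) \<le> GKdim_algebra class_ring (Kn n p q \<gamma>)"
    unfolding GKdim_algebra_def by (intro SUP_upper2[of ?V]) (auto simp: K.image_deg_le)
qed

subsection \<open>Modules that are not torsion\<close>

text \<open>One vector m that is not torsion suffices: the supremum defining the dimension of M
  includes the subspace spanned by m.\<close>

locale Kn_module = Kn_q1 n p q \<gamma> + right_module "Kn n p q \<gamma>" M
  for n and p q :: "nat \<Rightarrow> 'k::field" and \<gamma> :: "nat \<Rightarrow> nat \<Rightarrow> 'k"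
    and M :: "('k ncpoly set, 'm) right_module" +
  fixes m
  assumes m: "m \<in> carrier M" and m_Z: "\<And>s. s \<in> Kn_Z n p q \<gamma> \<Longrightarrow> m \<triangleleft>\<^bsub>M\<^esub> s \<noteq> \<zero>\<^bsub>M\<^esub>"
    and p_root: "\<forall>i\<in>{1..n}. \<not> root_of_unity (p i)"
begin

notation eqI (infix "\<doteq>" 50)

abbreviation K where "K \<equiv> Kn n p q \<gamma>"
abbreviation cl where "cl \<equiv> kq n p q \<gamma>"

definition \<phi> :: "'k ncpoly \<Rightarrow> 'm" where "\<phi> f = m \<triangleleft>\<^bsub>M\<^esub> cl f"

lemma phi_closed: "\<phi> f \<in> carrier M"
  unfolding \<phi>_def by (rule ract_closed[OF m kq_closed])

lemma phi_add: "\<phi> (f + g) = \<phi> f \<oplus>\<^bsub>M\<^esub> \<phi> g"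
  unfolding \<phi>_def kq_add by (rule ract_add_right[OF m kq_closed kq_closed])

lemma phi_mult: "\<phi> (f * g) = \<phi> f \<triangleleft>\<^bsub>M\<^esub> cl g"
  unfolding \<phi>_def kq_mult by (rule ract_mult[OF m kq_closed kq_closed])

lemma zero_ract: "a \<in> carrier K \<Longrightarrow> \<zero>\<^bsub>M\<^esub> \<triangleleft>\<^bsub>M\<^esub> a = \<zero>\<^bsub>M\<^esub>"
  using ract_add_left[of "\<zero>\<^bsub>M\<^esub>" "\<zero>\<^bsub>M\<^esub>" a] ract_closed[of "\<zero>\<^bsub>M\<^esub>" a]
  by (simp add: M.add.l_cancel_one)

lemma phi_kernel: "f \<in> Kn_kernel n p q \<gamma> \<Longrightarrow> \<phi> f = \<zero>\<^bsub>M\<^esub>"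
proof -
  assume "f \<in> Kn_kernel n p q \<gamma>"
  then have "cl f = cl 0" using kq_eq_0 kq_0 by metis
  then have "\<phi> f = \<phi> (0 + 0)" by (simp add: \<phi>_def)
  also have "\<dots> = \<phi> 0 \<oplus>\<^bsub>M\<^esub> \<phi> 0" by (rule phi_add)
  finally have "\<phi> 0 = \<phi> 0 \<oplus>\<^bsub>M\<^esub> \<phi> 0" using \<open>\<phi> f = \<phi> (0 + 0)\<close> by simp
  then show ?thesis
    using phi_closed[of 0] \<open>\<phi> f = \<phi> (0 + 0)\<close> by (simp add: M.add.l_cancel_one)
qed

lemma phi_cong: "f \<doteq> g \<Longrightarrow> \<phi> f = \<phi> g"
  using phi_add[of "f - g" g] phi_kernel[of "f - g"] phi_closed by (simp add: eqI_def)

lemma phi_mult_0: "\<phi> f = \<zero>\<^bsub>M\<^esub> \<Longrightarrow> \<phi> (f * g) = \<zero>\<^bsub>M\<^esub>"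
  by (simp add: phi_mult zero_ract kq_closed)

text \<open>Products in arbitrary order are closed under multiplication without any rearranging;
  \<open>Zl_zmon\<close> sorts them modulo the relations when \<open>Kn_Z\<close> is needed.\<close>

definition Zl :: "'k ncpoly set"
  where "Zl = {prod_list (map zf is) | is. set is \<subseteq> {1..n}}"

lemma Zl_1: "1 \<in> Zl"
  unfolding Zl_def by (intro CollectI exI[of _ "[]"]) simp

lemma Zl_mult: "s \<in> Zl \<Longrightarrow> t \<in> Zl \<Longrightarrow> s * t \<in> Zl"
  unfolding Zl_def by clarify (metis (no_types, lifting) Un_least map_append prod_list.append set_append)

lemma Zl_zf: "1 \<le> j \<Longrightarrow> j \<le> n \<Longrightarrow> zf j \<in> Zl"
  unfolding Zl_def by (intro CollectI exI[of _ "[j]"]) simp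

lemma Zl_zf_comm:
  assumes "s \<in> Zl" "j \<le> n" shows "qc 1 (zf j) s"
proof -
  have "qc 1 (zf j) (prod_list (map zf is))" if "set is \<subseteq> {1..n}" for "is"
    using that
  proof (induction "is")
    case (Cons i "is")
    then show ?case using qc_mult_right[OF qc_zz[of j i], of 1 "prod_list (map zf is)"] assms(2) by simp
  qed (simp add: qc_1)
  then show ?thesis using assms(1) by (auto simp: Zl_def)
qed

lemma Zl_comm:
  assumes "s \<in> Zl" "t \<in> Zl" shows "qc 1 s t"
proof -
  have "qc 1 (prod_list (map zf is)) t" if "set is \<subseteq> {1..n}" for "is"
    using that
  proof (induction "is")
    case (Cons i "is")
    then show ?case using qc_mult_left[OF Zl_zf_comm[OF assms(2), of i], of 1 "prod_list (map zf is)"] by simp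
  qed (simp add: qc_1)
  then show ?thesis using assms(1) by (auto simp: Zl_def)
qed

lemma letter_Zl:
  assumes "s \<in> Zl" "g \<in> gens n"
  shows "\<exists>c. qc c (Poly_Mapping.single (GWord [g]) 1) s"
proof -
  let ?g = "Poly_Mapping.single (GWord [g]) (1::'k)"
  have z: "\<exists>c. qc c ?g (zf j)" if j: "1 \<le> j" "j \<le> n" for j
  proof (cases g)
    case (X i)
    then show ?thesis
      using qc_xz[of i j] qc_xz_less[of j i] j assms(2) by (cases "i \<le> j") (auto simp: gens_def)
  next
    case (Y i)
    then show ?thesis
      using qc_yz[of i j] qc_yz_less[of j i] j assms(2) by (cases "i \<le> j") (auto simp: gens_def)
  qed
  have "\<exists>c. qc c ?g (prod_list (map zf is))" if "set is \<subseteq> {1..n}" for "is"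
    using that
  proof (induction "is")
    case Nil
    then show ?case by (intro exI[of _ 1]) (simp add: qc_1)
  next
    case (Cons i "is")
    then obtain c d where "qc c ?g (zf i)" "qc d ?g (prod_list (map zf is))" using z[of i] by auto
    then have "qc (c * d) ?g (zf i * prod_list (map zf is))" by (rule qc_mult_right)
    then show ?case by auto
  qed
  then show ?thesis using assms(1) by (auto simp: Zl_def)
qed

text \<open>Different letters commute with s up to different scalars, so g is in general not a
  multiple of f; it is built letter by letter and then by linearity. This is the Ore condition for
  the z's.\<close>

lemma Zl_normal:
  assumes s: "s \<in> Zl" shows "\<exists>g. f * s \<doteq> s * g"
proof (induction f rule: poly_mapping_induct_single)
  case zero
  show ?case by (intro exI[of _ 0]) simp
next
  case (add f f')
  then obtain g g' where "f * s \<doteq> s * g" "f' * s \<doteq> s * g'" by blast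
  then have "(f + f') * s \<doteq> s * (g + g')" using eq_add by (simp add: distrib_left distrib_right)
  then show ?case by blast
next
  case (single w c)
  have "\<exists>g. Poly_Mapping.single (GWord gs) 1 * s \<doteq> s * g" for gs
  proof (induction gs)
    case Nil
    have "Poly_Mapping.single (GWord []) 1 * s = s * 1" by (simp flip: zero_gword_def)
    then show ?case by (metis eq_refl)
  next
    case (Cons a gs)
    let ?a = "Poly_Mapping.single (GWord [a]) (1::'k)" let ?gs = "Poly_Mapping.single (GWord gs) (1::'k)"
    have e: "Poly_Mapping.single (GWord (a # gs)) 1 = ?a * ?gs" by (simp add: mult_single plus_gword_def)
    obtain g where g: "?gs * s \<doteq> s * g" using Cons by blast
    show ?case
    proof (cases "a \<in> gens n")
      case True
      obtain d where "?a * s \<doteq> scal d * (s * ?a)" using letter_Zl[OF s True] by (auto simp: qc_def)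
      then have "?a * s * g \<doteq> scal d * (s * ?a) * g" by (rule eq_rmult)
      moreover have "?a * (?gs * s) \<doteq> ?a * (s * g)" using g by (rule eq_lmult)
      ultimately have "?a * ?gs * s \<doteq> scal d * (s * ?a) * g"
        using eq_trans by (simp only: mult.assoc)
      moreover have "scal d * (s * ?a) * g = s * (scal d * (?a * g))"
        by (simp only: mult.assoc sc_left[of s])
      ultimately show ?thesis unfolding e by metis
    next
      \<comment> \<open>A letter of foreign index is congruent to 0, so g = 0 will do.\<close>
      case False
      then have "restr n ?a = 0" by (simp add: restr_single)
      then have "?a \<in> Kn_kernel n p q \<gamma>"
        using scalar_ideal.I_zero[OF scalar_ideal_Kn, of n p q \<gamma>] by (simp add: Kn_kernel_def)
      then have "?a * (?gs * s) \<doteq> s * 0" using I_rmult by (simp add: eqI_def)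
      then show ?thesis unfolding e by (metis mult.assoc)
    qed
  qed
  from this[of "letters w"] obtain g where g: "Poly_Mapping.single w 1 * s \<doteq> s * g" by auto
  have "scal c * (Poly_Mapping.single w 1 * s) \<doteq> scal c * (s * g)" using g by (rule eq_lmult)
  moreover have "scal c * (Poly_Mapping.single w 1 * s) = Poly_Mapping.single w c * s"
    by (simp add: mult_single flip: mult.assoc)
  moreover have "scal c * (s * g) = s * (scal c * g)" by (simp only: sc_left[of s])
  ultimately show ?case by metis
qed

primrec zmon :: "(nat \<Rightarrow> nat) \<Rightarrow> nat \<Rightarrow> 'k ncpoly"
  where "zmon j 0 = 1" | "zmon j (Suc k) = zmon j k * zf (Suc k) ^ j (Suc k)"

lemma zmon_comm: "i \<le> n \<Longrightarrow> k \<le> n \<Longrightarrow> zf i * zmon j k \<doteq> zmon j k * zf i"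
proof (induction k)
  case (Suc k)
  have "zf (Suc k) ^ l * zf i \<doteq> zf i * zf (Suc k) ^ l" for l
    using Suc.prems qc_zz[of "Suc k" i] by (intro comm_power) (simp add: qc_1)
  moreover have "zmon j k * zf i \<doteq> zf i * zmon j k" using Suc eq_sym by simp
  ultimately show ?case using commI_mult eq_sym by simp
qed simp

lemma zmon_cong: "(\<And>i. i \<le> k \<Longrightarrow> j i = j' i) \<Longrightarrow> zmon j k = zmon j' k"
  by (induction k) auto

lemma zmon_incr:
  "1 \<le> i \<Longrightarrow> i \<le> k \<Longrightarrow> k \<le> n \<Longrightarrow> zf i * zmon j k \<doteq> zmon (j(i := Suc (j i))) k"
proof (induction k)
  case (Suc k)
  define j' where "j' = j(i := Suc (j i))"
  have "zf i * zmon j (Suc k) \<doteq> zmon j' (Suc k)"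
  proof (cases "i = Suc k")
    case True
    have "zmon j' k = zmon j k" using True by (intro zmon_cong) (simp add: j'_def)
    moreover have "j' (Suc k) = Suc (j i)" using True by (simp add: j'_def)
    moreover have "zf i * zmon j k * zf i ^ j i \<doteq> zmon j k * zf i * zf i ^ j i"
      using Suc.prems by (intro eq_rmult zmon_comm) auto
    ultimately show ?thesis using True by (simp add: mult.assoc)
  next
    case False
    then have "zf i * zmon j k \<doteq> zmon j' k"
      unfolding j'_def using Suc.prems by (intro Suc.IH) auto
    moreover have "j' (Suc k) = j (Suc k)" using False by (simp add: j'_def)
    ultimately show ?thesis using eq_rmult by (simp flip: mult.assoc)
  qed
  then show ?case by (simp only: j'_def)
qed simp

lemma Zl_zmon:
  assumes "s \<in> Zl" shows "\<exists>j. s \<doteq> zmon j n"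
proof -
  have "\<exists>j. prod_list (map zf is) \<doteq> zmon j n" if "set is \<subseteq> {1..n}" for "is"
    using that
  proof (induction "is")
    case Nil
    have "zmon (\<lambda>_. 0) k = 1" for k by (induction k) auto
    then show ?case by (metis eq_refl list.simps(8) prod_list.Nil)
  next
    case (Cons i "is")
    then obtain j where "prod_list (map zf is) \<doteq> zmon j n" by auto
    then have "zf i * prod_list (map zf is) \<doteq> zf i * zmon j n" by (rule eq_lmult)
    also have "\<dots> \<doteq> zmon (j(i := Suc (j i))) n" using Cons.prems by (intro zmon_incr) auto
    finally show ?case by auto
  qed
  then show ?thesis using assms by (auto simp: Zl_def)
qed

lemma cl_zf: "1 \<le> i \<Longrightarrow> i \<le> n \<Longrightarrow> cl (zf i) = Kn_z n p q \<gamma> i"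
proof -
  assume i: "1 \<le> i" "i \<le> n"
  interpret L: lin_image K cl by (rule lin_image_kq)
  have "cl (zf i) = (\<Oplus>\<^bsub>K\<^esub>l\<in>{1..i}. (1 - p l) \<odot>\<^bsub>K\<^esub> cl (fy l * fx l))"
    unfolding zf_def by (rule L.phi_lincomb) simp
  also have "\<dots> = Kn_z n p q \<gamma> i"
    unfolding Kn_z_def
  proof (rule A.finsum_cong')
    fix l assume "l \<in> {1..i}"
    then have l: "l \<in> {1..n}" using i by simp
    then have "cl (fx l) = Kn_x n p q \<gamma> l" "cl (fy l) = Kn_y n p q \<gamma> l"
      by (simp_all add: kq_def Kn_x_def Kn_y_def restr_id[OF in_free_alg(2)] restr_id[OF in_free_alg(3)])
    then show "(1 - p l) \<odot>\<^bsub>K\<^esub> cl (fy l * fx l)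
        = (q l - p l) \<odot>\<^bsub>K\<^esub> (Kn_y n p q \<gamma> l \<otimes>\<^bsub>K\<^esub> Kn_x n p q \<gamma> l)"
      using q1 l by (simp add: kq_mult)
  next
    show "(\<lambda>l. (q l - p l) \<odot>\<^bsub>K\<^esub> (Kn_y n p q \<gamma> l \<otimes>\<^bsub>K\<^esub> Kn_x n p q \<gamma> l)) \<in> {1..i} \<rightarrow> carrier K"
    proof
      fix l assume "l \<in> {1..i}"
      then have "l \<in> {1..n}" using i by simp
      then have "cl (fx l) = Kn_x n p q \<gamma> l" "cl (fy l) = Kn_y n p q \<gamma> l"
        by (simp_all add: kq_def Kn_x_def Kn_y_def restr_id[OF in_free_alg(2)] restr_id[OF in_free_alg(3)])
      then have "(q l - p l) \<odot>\<^bsub>K\<^esub> (Kn_y n p q \<gamma> l \<otimes>\<^bsub>K\<^esub> Kn_x n p q \<gamma> l)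
          = cl (scal (q l - p l) * (fy l * fx l))"
        by (simp only: kq_smult kq_mult[of n p q \<gamma> "fy l" "fx l"])
      then show "(q l - p l) \<odot>\<^bsub>K\<^esub> (Kn_y n p q \<gamma> l \<otimes>\<^bsub>K\<^esub> Kn_x n p q \<gamma> l) \<in> carrier K"
        by (simp only: kq_closed)
    qed
  qed simp
  finally show ?thesis .
qed

lemma cl_power: "cl (f ^ k) = cl f [^]\<^bsub>K\<^esub> k"
proof (induction k)
  case 0
  then show ?case by (simp add: kq_1)
next
  case (Suc k)
  then show ?case by (simp only: power_Suc2 kq_mult A.nat_pow_Suc)
qed

lemma cl_zmon: "k \<le> n \<Longrightarrow> cl (zmon j k) = ordered_monomial K (Kn_z n p q \<gamma>) j k"
  by (induction k) (simp_all add: kq_1 kq_mult cl_power cl_zf)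

lemma Zl_phi: "s \<in> Zl \<Longrightarrow> \<phi> s \<noteq> \<zero>\<^bsub>M\<^esub>"
proof -
  assume "s \<in> Zl"
  then obtain j where "s \<doteq> zmon j n" using Zl_zmon by blast
  then have "\<phi> s = m \<triangleleft>\<^bsub>M\<^esub> ordered_monomial K (Kn_z n p q \<gamma>) j n"
    using phi_cong cl_zmon[OF order_refl] by (simp add: \<phi>_def)
  then show ?thesis using m_Z[of "ordered_monomial K (Kn_z n p q \<gamma>) j n"] by (auto simp: Kn_Z_def)
qed

text \<open>Modulo \<open>J\<close>, the free algebra is the quotient of \<open>m K\<^sub>n\<close> by its torsion submodule.\<close>

definition J :: "'k ncpoly set"
  where "J = {f. \<exists>s\<in>Zl. \<phi> (f * s) = \<zero>\<^bsub>M\<^esub>}"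

lemma phi_J: "\<phi> f = \<zero>\<^bsub>M\<^esub> \<Longrightarrow> f \<in> J"
  using Zl_1 by (auto simp: J_def intro!: bexI[of _ 1])

sublocale skew scal "Kn_kernel n p q \<gamma>" J fx fy zf p n
proof
  show "Kn_kernel n p q \<gamma> \<subseteq> J" using phi_kernel phi_J by blast
next
  fix f g assume "f \<in> J" "g \<in> J"
  then obtain s t where s: "s \<in> Zl" "\<phi> (f * s) = \<zero>\<^bsub>M\<^esub>" and t: "t \<in> Zl" "\<phi> (g * t) = \<zero>\<^bsub>M\<^esub>"
    by (auto simp: J_def)
  \<comment> \<open>The common witness is s * t. For g the factor t has to come first, which is
    possible because s and t commute modulo the relations.\<close>
  have "\<phi> (f * s * t) = \<zero>\<^bsub>M\<^esub>" by (rule phi_mult_0[OF s(2)])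
  moreover have "\<phi> (g * (s * t)) = \<phi> (g * (t * s))"
    using Zl_comm[OF s(1) t(1)] by (intro phi_cong eq_lmult) (simp add: qc_1)
  moreover have "\<phi> (g * t * s) = \<zero>\<^bsub>M\<^esub>" by (rule phi_mult_0[OF t(2)])
  ultimately have "\<phi> ((f + g) * (s * t)) = \<zero>\<^bsub>M\<^esub>"
    by (simp add: distrib_right phi_add mult.assoc)
  then show "f + g \<in> J" using Zl_mult[OF s(1) t(1)] by (auto simp: J_def)
next
  fix f g assume "f \<in> J"
  then obtain s where s: "s \<in> Zl" "\<phi> (f * s) = \<zero>\<^bsub>M\<^esub>" by (auto simp: J_def)
  \<comment> \<open>Normality moves s next to f, where it kills, so the same witness serves for f *
    g.\<close>
  obtain g' where "g * s \<doteq> s * g'" using Zl_normal[OF s(1)] by blast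
  then have "f * (g * s) \<doteq> f * (s * g')" by (rule eq_lmult)
  then have "\<phi> (f * g * s) = \<phi> (f * s * g')" using phi_cong by (simp add: mult.assoc)
  then have "\<phi> (f * g * s) = \<zero>\<^bsub>M\<^esub>" using phi_mult_0[OF s(2)] by simp
  then show "f * g \<in> J" using s(1) by (auto simp: J_def)
next
  show "1 \<notin> J" using Zl_phi by (auto simp: J_def)
next
  fix j u assume j: "1 \<le> j" "j \<le> n" and "u * zf j \<in> J"
  then obtain s where "s \<in> Zl" "\<phi> (u * (zf j * s)) = \<zero>\<^bsub>M\<^esub>" by (auto simp: J_def mult.assoc)
  then show "u \<in> J" using Zl_mult[OF Zl_zf[OF j]] by (auto simp: J_def)
next
  fix i j assume "1 \<le> i" "i \<le> n" "1 \<le> j" "j \<le> n"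
  then show "zf i * zf j - zf j * zf i \<in> Kn_kernel n p q \<gamma>"
    using qc_zz[of i j] by (simp add: qc_1 eqI_def)
next
  fix i j assume "1 \<le> i" "i \<le> j" "j \<le> n"
  then show "fx i * zf j - zf j * fx i \<in> Kn_kernel n p q \<gamma>"
    "fy i * zf j - zf j * fy i \<in> Kn_kernel n p q \<gamma>"
    using qc_xz[of i j] qc_yz[of i j] by (simp_all add: qc_1 eqI_def)
next
  fix i j assume "1 \<le> j" "j < i" "i \<le> n"
  then show "fx i * zf j - scal (p i) * zf j * fx i \<in> Kn_kernel n p q \<gamma>"
    "fy i * zf j - scal (inverse (p i)) * zf j * fy i \<in> Kn_kernel n p q \<gamma>"
    using qc_xz_less[of j i] qc_yz_less[of j i] by (simp_all add: qc_def eqI_def mult.assoc)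
next
  fix i assume "2 \<le> i" "i \<le> n"
  then show "scal (1 - p i) * fx i * fy i - (zf i - scal (p i) * zf (i - 1)) \<in> Kn_kernel n p q \<gamma>"
    "scal (1 - p i) * fy i * fx i - (zf i - zf (i - 1)) \<in> Kn_kernel n p q \<gamma>"
    using xy_zf[of i] yx_zf[of i] I_zero by (simp_all add: eqI_def)
qed (use p_nz p_root in auto)

lemma vectorspace_M: "vectorspace class_ring (scalar_space K M)"
  by (rule vectorspace_scalar_space) unfold_locales

lemma lin_image_phi: "lin_image (scalar_space K M) \<phi>"
proof (intro lin_image.intro vectorspace_M lin_image_axioms.intro)
  fix c f g
  show "\<phi> f \<in> carrier (scalar_space K M)" using phi_closed by (simp add: scalar_space_def)
  show "\<phi> (f + g) = \<phi> f \<oplus>\<^bsub>scalar_space K M\<^esub> \<phi> g" using phi_add by (simp add: scalar_space_def)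
  have "cl (scal c * 1) = c \<odot>\<^bsub>K\<^esub> \<one>\<^bsub>K\<^esub>" by (simp only: kq_smult kq_1)
  then have "\<phi> (f * (scal c * 1)) = c \<odot>\<^bsub>scalar_space K M\<^esub> \<phi> f"
    by (simp only: phi_mult) (simp add: scalar_space_def)
  \<comment> \<open>In \<open>scalar_space\<close> the scalar c acts from the right through c 1; its
    centrality in the free algebra brings it to the left.\<close>
  moreover have "scal c * f = f * (scal c * 1)" by (simp only: sc_comm mult_1_right)
  ultimately show "\<phi> (scal c * f) = c \<odot>\<^bsub>scalar_space K M\<^esub> \<phi> f" by simp
qed

text \<open>The degree 0 part consists of the scalars, so the left factor ranges over the line
  spanned by m.\<close>

lemma ract_deg_le:
  "{f \<triangleleft>\<^bsub>M\<^esub> v | f v. f \<in> \<phi> ` deg_le n 0 \<and> v \<in> cl ` deg_le n k} = \<phi> ` deg_le n k"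
proof (intro equalityI subsetI)
  fix v assume "v \<in> {f \<triangleleft>\<^bsub>M\<^esub> v | f v. f \<in> \<phi> ` deg_le n 0 \<and> v \<in> cl ` deg_le n k}"
  then obtain a b where ab: "a \<in> deg_le n 0" "b \<in> deg_le n k" "v = \<phi> a \<triangleleft>\<^bsub>M\<^esub> cl b" by auto
  then have "v = \<phi> (a * b)" by (simp add: phi_mult)
  moreover have "a * b \<in> deg_le n k" using deg_le_mult[OF ab(1,2)] by simp
  ultimately show "v \<in> \<phi> ` deg_le n k" by blast
next
  fix v assume "v \<in> \<phi> ` deg_le n k"
  then obtain f where f: "f \<in> deg_le n k" "v = \<phi> 1 \<triangleleft>\<^bsub>M\<^esub> cl f" by (auto simp flip: phi_mult)
  then show "v \<in> {f \<triangleleft>\<^bsub>M\<^esub> v | f v. f \<in> \<phi> ` deg_le n 0 \<and> v \<in> cl ` deg_le n k}"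
    using deg_le_1[of n 0] by blast
qed

theorem GKdim_module_ge:
  assumes "1 \<le> n"
  shows "ereal (real (n - 1)) \<le> GKdim_module class_ring K M"
proof -
  note fin = lin_image.image_deg_le[OF lin_image_phi] lin_image.image_deg_le[OF lin_image_kq]
  obtain u ts where ts: "length ts = n - 1" "set ts \<subseteq> xyz"
    and ind: "\<And>s c a. \<lbrakk>(\<Sum>a\<in>box (n - 1) s. u * wmono ts a * scal (c a)) \<in> J; a \<in> box (n - 1) s\<rbrakk> \<Longrightarrow> c a = 0"
    by (rule linearly_independent_family[OF assms]) (rule that)
  have "xyz \<subseteq> deg_le n 2"
    by (auto simp: xyz_def zf_deg_le intro!: deg_le_mono[OF deg_le_gens(1)] deg_le_mono[OF deg_le_gens(2)])
  then have ts2: "set ts \<subseteq> deg_le n 2" using ts(2) by blast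
  \<comment> \<open>The element u may contain letters of foreign index, so only its projection is
    sure to lie in the filtration; both have the same image under \<open>cl\<close>.\<close>
  obtain E where E: "restr n u \<in> deg_le n E" using carrier_deg_le[OF restr_carrier] by blast
  let ?V = "cl ` deg_le n 1" let ?F = "\<phi> ` deg_le n 0"
  let ?d = "\<lambda>k. subspace_dim class_ring (scalar_space K M) (\<phi> ` deg_le n k)"
  have "ereal (real (n - 1)) \<le> limsup (\<lambda>k. ereal (log (real k) (real (?d k))))"
  proof (rule limsup_log_ge)
    fix s :: nat
    \<comment> \<open>After u, of degree at most E, come n - 1 factors of degree at most 2 with
      exponents below s.\<close>
    let ?L = "E + (2 * n + 1) * s"
    have in_L: "\<phi> (u * wmono ts a) \<in> \<phi> ` deg_le n ?L" if "a \<in> box (n - 1) s" for a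
    proof -
      have "E + 2 * s * length ts \<le> E + 2 * s * n"
        unfolding ts(1) by (intro add_left_mono mult_le_mono2) simp
      also have "\<dots> \<le> ?L" by (simp add: algebra_simps)
      finally have "E + 2 * s * length ts \<le> ?L" .
      moreover have "restr n u * wmono ts a \<in> deg_le n (E + 2 * s * length ts)"
        using that by (intro deg_le_mult E deg_le_wmono ts2) (simp add: box_def)
      ultimately have "restr n u * wmono ts a \<in> deg_le n ?L" by (rule deg_le_mono[rotated])
      moreover have "cl (restr n u) = cl u" by (simp add: kq_def restr_id[OF restr_carrier])
      then have "\<phi> (u * wmono ts a) = \<phi> (restr n u * wmono ts a)" by (simp add: \<phi>_def kq_mult)
      ultimately show ?thesis by auto
    qed
    have "card (box (n - 1) s) \<le> ?d ?L"
    proof (rule lin_image.card_le_dim[OF lin_image_phi fin(1) finite_box in_L])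
      fix c :: "nat list \<Rightarrow> 'k" and a
      assume c: "\<phi> (\<Sum>a\<in>box (n - 1) s. scal (c a) * (u * wmono ts a)) = \<zero>\<^bsub>scalar_space K M\<^esub>"
        and a: "a \<in> box (n - 1) s"
      have "(\<Sum>a\<in>box (n - 1) s. scal (c a) * (u * wmono ts a)) \<in> J"
        using c by (intro phi_J) (simp add: scalar_space_def)
      then show "c a = 0" using ind[OF _ a, of c] by (simp only: sc_comm)
    qed
    then show "s ^ (n - 1) \<le> ?d ?L" by (simp add: card_box)
  qed simp
  also have "\<dots> = limsup (\<lambda>k. ereal (log (real k) (real (subspace_dim class_ring (scalar_space K M)
      (lspan class_ring (scalar_space K M) {f \<triangleleft>\<^bsub>M\<^esub> v | f v. f \<in> ?F \<and> v \<in> subspace_power class_ring K ?V k})))))"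
    by (simp only: subspace_power_deg_le ract_deg_le lin_image.span_image_deg_le[OF lin_image_phi])
  also have "\<dots> \<le> GKdim_module class_ring K M"
  proof -
    have "\<one>\<^bsub>K\<^esub> \<in> ?V" by (auto simp: deg_le_1 simp flip: kq_1)
    then have "(?V, ?F) \<in> {(V, F). fin_dim_subspace class_ring K V \<and> \<one>\<^bsub>K\<^esub> \<in> V \<and>
        fin_dim_subspace class_ring (scalar_space K M) F}"
      using fin by blast
    then show ?thesis unfolding GKdim_module_def by (rule SUP_upper2) simp
  qed
  finally show ?thesis .
qed

end

theorem mainTheorem2:
  fixes n :: nat
    and p q :: "nat \<Rightarrow> 'k::field"
    and \<gamma> :: "nat \<Rightarrow> nat \<Rightarrow> 'k"
    and M :: "('k ncpoly set, 'm) right_module"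
  assumes "n \<ge> 1"
    and "Kn_data n p q \<gamma>"
    and "\<forall>i\<in>{1..n}. q i = 1"
    and "\<forall>i\<in>{1..n}. \<not> root_of_unity (p i)"
    and "right_module (Kn n p q \<gamma>) M"
    and "carrier M \<noteq> {\<zero>\<^bsub>M\<^esub>}"
    and "fin_generated (Kn n p q \<gamma>) M"
    and "\<not> torsion_wrt (Kn_Z n p q \<gamma>) M"
  shows "GKdim_module (class_ring :: 'k ring) (Kn n p q \<gamma>) M \<ge> ereal (real n - 1) \<and>
    ereal (real n - 1) = GKdim_algebra (class_ring :: 'k ring) (Kn n p q \<gamma>) / 2 - 1"
proof -
  interpret Kn_q1 n p q \<gamma> using assms(2,3) by unfold_locales
  obtain m where "m \<in> carrier M" "\<And>s. s \<in> Kn_Z n p q \<gamma> \<Longrightarrow> m \<triangleleft>\<^bsub>M\<^esub> s \<noteq> \<zero>\<^bsub>M\<^esub>"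
    using assms(8) by (auto simp: torsion_wrt_def)
  then have "Kn_module n p q \<gamma> M m"
    using assms(4,5) by (intro Kn_module.intro Kn_module_axioms.intro Kn_q1_axioms) auto
  then have "ereal (real (n - 1)) \<le> GKdim_module class_ring (Kn n p q \<gamma>) M"
    using assms(1) by (rule Kn_module.GKdim_module_ge)
  moreover have "ereal (real (2 * n)) / 2 - 1 = ereal (real n - 1)"
    by (simp add: one_ereal_def)
  \<comment> \<open>With n \<ge> 1 the truncated difference n - 1 agrees with the real one.\<close>
  ultimately show ?thesis using assms(1) by (simp add: GKdim_Kn of_nat_diff)
qed

end
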